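(* Suppose $X$ is a Hausdorff space. Then $\pi_1^{top}(\Sigma(X_+))$ is a Hausdorff topological group if and only if the following conditions hold: 1. $\pi_0^{top}(X)$ is Hausdorff. 2. $(P_X)^n:X^n\to\pi_0^{top}(X)^n$ is a quotient map for every $n\ge 1$. 3. $\mathbf{i}_n:\coprod_{i=0}^n(\pi_0^{top}(X)\sqcup\pi_0^{top}(X)^{-1})^i\to F_n(\pi_0^{top}(X))$ is a quotient map for every $n\ge 1$. 4. $F_M(\pi_0^{top}(X))$ has the inductive limit topology of the subspaces $F_n(\pi_0^{top}(X))$. Moreover, if $\pi_0^{top}(X)$ is Hausdorff but fails to be completely regular, then conditions 2.-4. fail.
   Context: $\pi_0^{top}(X)$ is the set of path components of $X$ with the quotient topology from the canonical map $P_X:X\to\pi_0(X)$. For a based space $(Z,z)$, $\pi_1^{top}(Z,z)$ is $\pi_1(Z,z)$ with the quotient topology from the loop space $\Omega(Z,z)$ (compact-open topology). $X_+=X\sqcup\{*\}$ is $X$ with a disjoint basepoint, and $\Sigma(X_+)=\dfrac{X_+\times I}{X\times\{0,1\}\cup\{*\}\times I}$ ($I=[0,1]$) is the reduced suspension, based at the image of the collapsed set. For a space $Y$, $F_M(Y)$ is the free (Markov) topological group on $Y$: the free group $F(Y)$ on the underlying set of $Y$ with the group topology such that the canonical injection $\sigma:Y\to F_M(Y)$ is continuous and every continuous map $f:Y\to G$ to a topological group $G$ extends uniquely to a continuous homomorphism $\tilde f:F_M(Y)\to G$ with $\tilde f\circ\sigma=f$. $F_n(Y)\subseteq F_M(Y)$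 is the set of reduced words of length at most $n$, with the subspace topology. $Y^{-1}$ is a homeomorphic copy of $Y$, and $\mathbf{i}_n:\coprod_{i=0}^n(Y\sqcup Y^{-1})^i\to F_n(Y)$ sends a word to its reduction ($(Y\sqcup Y^{-1})^0$ is the one-point space consisting of the empty word). "Inductive limit topology of the subspaces $F_n(Y)$" means that a subset $C$ is closed if and only if $C\cap F_n(Y)$ is closed in $F_n(Y)$ for every $n\ge 0$.
   Formalization: "Conditions 2.-4. fail" is taken to mean that conditions 2, 3 and 4 do not all hold; that each of them fails is false, since condition 2 holds for every totally path-disconnected X (P_X is then a homeomorphism). *)

theory Defs
  imports "HOL-Analysis.Analysis" "HOL-Algebra.Group"
begin

section \<open>Quotient and compact-open topologies\<close>

definition quotient_topology :: "'a topology \<Rightarrow> ('a \<Rightarrow> 'b) \<Rightarrow> 'b topology" where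
  "quotient_topology X q =
     topology (\<lambda>U. U \<subseteq> q ` topspace X \<and> openin X {x \<in> topspace X. q x \<in> U})"

lemma openin_quotient_topology:
  "openin (quotient_topology X q) U \<longleftrightarrow>
     U \<subseteq> q ` topspace X \<and> openin X {x \<in> topspace X. q x \<in> U}"
proof -
  have *: "{x \<in> topspace X. q x \<in> S \<inter> T} = {x \<in> topspace X. q x \<in> S} \<inter> {x \<in> topspace X. q x \<in> T}"
    "{x \<in> topspace X. q x \<in> \<Union>K} = (\<Union>S\<in>K. {x \<in> topspace X. q x \<in> S})" for S T K
    by auto
  have "istopology (\<lambda>U. U \<subseteq> q ` topspace X \<and> openin X {x \<in> topspace X. q x \<in> U})"
    unfolding istopology_def * by (auto intro: openin_Int)
  then show ?thesis
    unfolding quotient_topology_def by (simp add: topology_inverse')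
qed

lemma topspace_quotient_topology [simp]:
  "topspace (quotient_topology X q) = q ` topspace X"
proof
  show "topspace (quotient_topology X q) \<subseteq> q ` topspace X"
    using openin_quotient_topology[of X q] by blast
  have "{x \<in> topspace X. q x \<in> q ` topspace X} = topspace X"
    by auto
  then show "q ` topspace X \<subseteq> topspace (quotient_topology X q)"
    by (intro openin_subset) (simp add: openin_quotient_topology)
qed

lemma quotient_map_quotient_topology: "quotient_map X (quotient_topology X q) q"
  by (simp add: quotient_map_def openin_quotient_topology)

text \<open>Continuous maps on \<open>X\<close> are represented by their extensional representatives, so that
  distinct points of the function space are distinct maps.\<close>

definition compact_open_topology :: "'a topology \<Rightarrow> 'b topology \<Rightarrow> ('a \<Rightarrow> 'b) topology" where
  "compact_open_topology X Y = topology_generated_by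
     {{f \<in> extensional (topspace X). continuous_map X Y f \<and> f ` K \<subseteq> U} | K U.
        compactin X K \<and> openin Y U}"


section \<open>The spaces of path components and of homotopy classes of loops\<close>

definition pi0_top :: "'a topology \<Rightarrow> 'a set topology" where
  "pi0_top X = quotient_topology X (path_component_of_set X)"

abbreviation unit_interval :: "real topology" where
  "unit_interval \<equiv> top_of_set {0..1}"

definition loops :: "'a topology \<Rightarrow> 'a \<Rightarrow> (real \<Rightarrow> 'a) set" where
  "loops Z z = {f \<in> extensional {0..1}. pathin Z f \<and> f 0 = z \<and> f 1 = z}"

definition loop_space :: "'a topology \<Rightarrow> 'a \<Rightarrow> (real \<Rightarrow> 'a) topology" where
  "loop_space Z z = subtopology (compact_open_topology unit_interval Z) (loops Z z)"

definition loop_homotopy :: "'a topology \<Rightarrow> 'a \<Rightarrow> (real \<Rightarrow> 'a) rel" where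
  "loop_homotopy Z z = {(f, g). f \<in> loops Z z \<and> g \<in> loops Z z \<and>
     homotopic_with (\<lambda>h. h 0 = z \<and> h 1 = z) unit_interval Z f g}"

definition loop_concat :: "(real \<Rightarrow> 'a) \<Rightarrow> (real \<Rightarrow> 'a) \<Rightarrow> real \<Rightarrow> 'a" where
  "loop_concat f g = (\<lambda>t\<in>{0..1}. if t \<le> 1/2 then f (2 * t) else g (2 * t - 1))"

definition fundamental_group :: "'a topology \<Rightarrow> 'a \<Rightarrow> (real \<Rightarrow> 'a) set monoid" where
  "fundamental_group Z z =
     \<lparr>carrier = loops Z z // loop_homotopy Z z,
      mult = (\<lambda>A B. \<Union>f\<in>A. \<Union>g\<in>B. loop_homotopy Z z `` {loop_concat f g}),
      one = loop_homotopy Z z `` {\<lambda>t\<in>{0..1}. z}\<rparr>"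

definition pi1_top :: "'a topology \<Rightarrow> 'a \<Rightarrow> (real \<Rightarrow> 'a) set topology" where
  "pi1_top Z z = quotient_topology (loop_space Z z) (\<lambda>f. loop_homotopy Z z `` {f})"

lemma topspace_loop_space [simp]: "topspace (loop_space Z z) = loops Z z"
proof -
  have "loops Z z \<subseteq> {f \<in> extensional (topspace unit_interval).
      continuous_map unit_interval Z f \<and> f ` {} \<subseteq> {}}"
    by (auto simp: loops_def pathin_def)
  moreover have "compactin unit_interval {}" "openin Z {}"
    by auto
  ultimately have "loops Z z \<subseteq> topspace (compact_open_topology unit_interval Z)"
    unfolding compact_open_topology_def topology_generated_by_topspace by blast
  then show ?thesis
    by (auto simp: loop_space_def)
qed

lemma topspace_pi1_top: "topspace (pi1_top Z z) = carrier (fundamental_group Z z)"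
  by (auto simp: pi1_top_def fundamental_group_def quotient_def)


section \<open>The reduced suspension of a space with a disjoint basepoint\<close>

definition add_point :: "'a topology \<Rightarrow> 'a option topology" where
  "add_point X = topology (\<lambda>U. U \<subseteq> insert None (Some ` topspace X) \<and> openin X (Some -` U))"

lemma openin_add_point:
  "openin (add_point X) U \<longleftrightarrow> U \<subseteq> insert None (Some ` topspace X) \<and> openin X (Some -` U)"
proof -
  have "istopology (\<lambda>U. U \<subseteq> insert None (Some ` topspace X) \<and> openin X (Some -` U))"
    unfolding istopology_def vimage_Int vimage_Union by auto
  then show ?thesis
    unfolding add_point_def by (simp add: topology_inverse')
qed

lemma topspace_add_point [simp]: "topspace (add_point X) = insert None (Some ` topspace X)"
proof -
  have "Some -` insert None (Some ` topspace X) = topspace X"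
    by auto
  then show ?thesis
    by (metis openin_add_point openin_subset openin_topspace order_refl subset_antisym)
qed

definition suspension_base :: "'a topology \<Rightarrow> ('a option \<times> real) set" where
  "suspension_base X = Some ` topspace X \<times> {0, 1} \<union> {None} \<times> {0..1}"

text \<open>A point of the suspension is a block of the partition whose only possibly non-trivial block
  is \<open>suspension_base X\<close>, which thus serves as the basepoint.\<close>

definition suspension_plus :: "'a topology \<Rightarrow> ('a option \<times> real) set topology" where
  "suspension_plus X = quotient_topology (prod_topology (add_point X) unit_interval)
     (\<lambda>p. if p \<in> suspension_base X then suspension_base X else {p})"


section \<open>Free groups\<close>

text \<open>The letter \<open>(True, y)\<close> stands for \<open>y\<close> and \<open>(False, y)\<close> for its formal inverse.\<close>

type_synonym 'a word = "(bool \<times> 'a) list"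

definition inv_letter :: "bool \<times> 'a \<Rightarrow> bool \<times> 'a" where
  "inv_letter l = (\<not> fst l, snd l)"

fun push_letter :: "bool \<times> 'a \<Rightarrow> 'a word \<Rightarrow> 'a word" where
  "push_letter l [] = [l]"
| "push_letter l (m # w) = (if m = inv_letter l then w else l # m # w)"

definition reduce :: "'a word \<Rightarrow> 'a word" where
  "reduce w = foldr push_letter w []"

fun reduced :: "'a word \<Rightarrow> bool" where
  "reduced (l # m # w) \<longleftrightarrow> m \<noteq> inv_letter l \<and> reduced (m # w)"
| "reduced _ \<longleftrightarrow> True"

definition inv_word :: "'a word \<Rightarrow> 'a word" where
  "inv_word w = rev (map inv_letter w)"

definition free_group :: "'a set \<Rightarrow> 'a word monoid" where
  "free_group A =
     \<lparr>carrier = {w. set w \<subseteq> UNIV \<times> A \<and> reduced w},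
      mult = (\<lambda>u v. reduce (u @ v)),
      one = []\<rparr>"

abbreviation free_gen :: "'a \<Rightarrow> 'a word" where
  "free_gen y \<equiv> [(True, y)]"

lemma inv_letter_inv_letter [simp]: "inv_letter (inv_letter l) = l"
  by (simp add: inv_letter_def)

lemma inv_letter_eq_iff: "inv_letter l = m \<longleftrightarrow> l = inv_letter m"
  by auto

lemma reduced_ConsD: "reduced (l # w) \<Longrightarrow> reduced w"
  by (cases w) auto

lemma reduced_push: "reduced w \<Longrightarrow> reduced (push_letter l w)"
  by (cases w) (auto dest: reduced_ConsD)

lemma reduced_foldr_push: "reduced w \<Longrightarrow> reduced (foldr push_letter u w)"
  by (induction u) (auto intro: reduced_push)

lemma reduced_reduce [simp]: "reduced (reduce w)"
  by (simp add: reduce_def reduced_foldr_push)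

lemma push_push_inv: "reduced w \<Longrightarrow> push_letter l (push_letter (inv_letter l) w) = w"
  by (induction w rule: reduced.induct) auto

lemma push_reduced: "reduced (l # w) \<Longrightarrow> push_letter l w = l # w"
  by (cases w) auto

lemma reduce_reduced [simp]: "reduced w \<Longrightarrow> reduce w = w"
proof (induction w)
  case (Cons l w)
  then show ?case
    using reduced_ConsD[of l w] push_reduced[of l w] by (simp add: reduce_def)
qed (simp add: reduce_def)

lemma foldr_push_push:
  assumes "reduced w"
  shows "foldr push_letter (push_letter l u) w = push_letter l (foldr push_letter u w)"
  using assms by (cases u) (simp_all add: push_push_inv reduced_foldr_push)

lemma foldr_push_reduce:
  assumes "reduced w"
  shows "foldr push_letter (reduce u) w = foldr push_letter u w"
proof (induction u)
  case (Cons l u)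
  have "reduce (l # u) = push_letter l (reduce u)"
    by (simp add: reduce_def)
  then show ?case
    using Cons assms by (simp add: foldr_push_push)
qed (simp add: reduce_def)

lemma reduce_append: "reduce (u @ v) = foldr push_letter u (reduce v)"
  by (simp add: reduce_def)

lemma reduce_append_reduce_left [simp]: "reduce (reduce u @ v) = reduce (u @ v)"
  by (simp add: reduce_append foldr_push_reduce)

lemma reduce_append_reduce_right [simp]: "reduce (u @ reduce v) = reduce (u @ v)"
  by (simp add: reduce_append)

lemma set_push: "set (push_letter l w) \<subseteq> insert l (set w)"
  by (cases w) auto

lemma set_reduce: "set (reduce w) \<subseteq> set w"
proof (induction w)
  case (Cons l w)
  then show ?case
    using set_push[of l "reduce w"] by (auto simp: reduce_def)
qed (simp add: reduce_def)

lemma reduce_inv_word_append: "reduce (inv_word w @ w) = []"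
proof (induction w)
  case (Cons l w)
  have "reduce (inv_word (l # w) @ (l # w)) =
      foldr push_letter (inv_word w) (push_letter (inv_letter l) (push_letter l (reduce w)))"
    by (simp add: inv_word_def reduce_def)
  also have "\<dots> = reduce (inv_word w @ w)"
    using push_push_inv[of "reduce w" "inv_letter l"] by (simp add: reduce_append)
  finally show ?case
    using Cons by simp
qed (simp add: inv_word_def reduce_def)

lemma group_free_group: "group (free_group A)"
proof (rule groupI)
  fix x y assume "x \<in> carrier (free_group A)" "y \<in> carrier (free_group A)"
  then show "x \<otimes>\<^bsub>free_group A\<^esub> y \<in> carrier (free_group A)"
    using set_reduce[of "x @ y"] by (auto simp: free_group_def)
next
  fix x assume x: "x \<in> carrier (free_group A)"
  then have "set (reduce (inv_word x)) \<subseteq> UNIV \<times> A"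
    using set_reduce[of "inv_word x"]
    by (force simp: free_group_def inv_word_def inv_letter_def)
  then have "reduce (inv_word x) \<in> carrier (free_group A)"
    by (simp add: free_group_def)
  moreover have "reduce (inv_word x) \<otimes>\<^bsub>free_group A\<^esub> x = \<one>\<^bsub>free_group A\<^esub>"
    by (simp add: free_group_def reduce_inv_word_append)
  ultimately show "\<exists>y\<in>carrier (free_group A). y \<otimes>\<^bsub>free_group A\<^esub> x = \<one>\<^bsub>free_group A\<^esub>"
    by blast
qed (auto simp: free_group_def)


section \<open>Topological groups and free topological groups\<close>

definition topological_group :: "'g monoid \<Rightarrow> 'g topology \<Rightarrow> bool" where
  "topological_group G T \<longleftrightarrow>
     group G \<and> topspace T = carrier G \<and>
     continuous_map (prod_topology T T) T (\<lambda>(x, y). x \<otimes>\<^bsub>G\<^esub> y) \<and>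
     continuous_map T T (\<lambda>x. inv\<^bsub>G\<^esub> x)"

text \<open>The universal property with respect to topological groups carried by the type \<open>'g\<close>;
  homomorphisms are taken extensional so that uniqueness means uniqueness on the free group.\<close>

definition free_topological_group :: "'g itself \<Rightarrow> 'a topology \<Rightarrow> 'a word topology \<Rightarrow> bool" where
  "free_topological_group (_ :: 'g itself) Y T \<longleftrightarrow>
     topological_group (free_group (topspace Y)) T \<and>
     continuous_map Y T free_gen \<and>
     (\<forall>(G :: 'g monoid) S f. topological_group G S \<and> continuous_map Y S f \<longrightarrow>
        (\<exists>!h. h \<in> extensional (carrier (free_group (topspace Y))) \<and>
              h \<in> hom (free_group (topspace Y)) G \<and> continuous_map T S h \<and>
              (\<forall>y \<in> topspace Y. h (free_gen y) = f y)))"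

text \<open>A definition cannot quantify over all types \<open>'g\<close>. Groups carried by the type of words suffice:
  they determine the topology, and it then has the universal property for every \<open>'g\<close>, see
  \<open>free_topological_group_free_markov\<close> and \<open>free_markov_unique\<close> below.\<close>

definition free_markov :: "'a topology \<Rightarrow> 'a word topology" where
  "free_markov Y = (THE T. free_topological_group TYPE('a word) Y T)"

definition word_eval :: "('g, 'm) monoid_scheme \<Rightarrow> ('a \<Rightarrow> 'g) \<Rightarrow> 'a word \<Rightarrow> 'g" where
  "word_eval G f w =
     foldr (\<lambda>(b, y) a. (if b then f y else inv\<^bsub>G\<^esub> f y) \<otimes>\<^bsub>G\<^esub> a) w \<one>\<^bsub>G\<^esub>"

lemma word_eval_hom:
  fixes G (structure)
  assumes G: "group G" and f: "f \<in> A \<rightarrow> carrier G"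
  shows "word_eval G f \<in> hom (free_group A) G"
proof -
  interpret group G by fact
  have closed: "word_eval G f w \<in> carrier G" if "set w \<subseteq> UNIV \<times> A" for w
    using that by (induction w) (use f in \<open>auto simp: word_eval_def Pi_iff\<close>)
  have push: "word_eval G f (push_letter l w) = word_eval G f (l # w)"
    if "set (l # w) \<subseteq> UNIV \<times> A" for l w
  proof (cases w)
    case (Cons m v)
    obtain b y where l: "l = (b, y)" by (cases l)
    have v: "word_eval G f v \<in> carrier G" "f y \<in> carrier G"
      using that closed[of v] f l Cons by auto
    have "word_eval G f ((b, y) # inv_letter (b, y) # v) = word_eval G f v"
      using v by (cases b) (simp_all add: word_eval_def inv_letter_def m_assoc[symmetric])
    then show ?thesis
      using Cons l by auto
  qed simp
  have red: "word_eval G f (reduce w) = word_eval G f w" if "set w \<subseteq> UNIV \<times> A" for w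
    using that
  proof (induction w)
    case (Cons l w)
    have "word_eval G f (reduce (l # w)) = word_eval G f (l # reduce w)"
      using push[of l "reduce w"] Cons.prems set_reduce[of w] by (auto simp: reduce_def)
    then show ?case
      using Cons by (simp add: word_eval_def)
  qed (simp add: reduce_def)
  have append: "word_eval G f (u @ v) = word_eval G f u \<otimes> word_eval G f v"
    if "set u \<subseteq> UNIV \<times> A" "set v \<subseteq> UNIV \<times> A" for u v
    using that(1)
  proof (induction u)
    case (Cons l u)
    obtain b y where l: "l = (b, y)" by (cases l)
    have "word_eval G f u \<in> carrier G" "word_eval G f v \<in> carrier G" "f y \<in> carrier G"
      using Cons.prems that closed f l by auto
    then show ?case
      using Cons l by (simp add: word_eval_def m_assoc)
  qed (use closed that in \<open>simp add: word_eval_def\<close>)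
  show ?thesis
    by (auto simp: hom_def free_group_def closed red append)
qed

lemma free_group_hom_unique:
  fixes G (structure)
  assumes G: "group G" and h: "h \<in> hom (free_group A) G" and k: "k \<in> hom (free_group A) G"
    and eq: "\<And>y. y \<in> A \<Longrightarrow> h (free_gen y) = k (free_gen y)"
    and w: "w \<in> carrier (free_group A)"
  shows "h w = k w"
proof -
  interpret F: group "free_group A" by (rule group_free_group)
  interpret h: group_hom "free_group A" G h
    by (intro group_hom.intro group_hom_axioms.intro G h group_free_group)
  interpret k: group_hom "free_group A" G k
    by (intro group_hom.intro group_hom_axioms.intro G k group_free_group)
  show ?thesis
    using w
  proof (induction w)
    case Nil
    have "[] = \<one>\<^bsub>free_group A\<^esub>" by (simp add: free_group_def)
    then show ?case by (metis h.hom_one k.hom_one)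
  next
    case (Cons l w)
    obtain b y where l: "l = (b, y)" by (cases l)
    have y: "y \<in> A" and w: "w \<in> carrier (free_group A)" and lw: "reduced (l # w)"
      using Cons.prems reduced_ConsD l by (auto simp: free_group_def)
    have gen: "free_gen y \<in> carrier (free_group A)" "[l] \<in> carrier (free_group A)"
      using y l by (auto simp: free_group_def)
    have "[(False, y)] \<otimes>\<^bsub>free_group A\<^esub> free_gen y = \<one>\<^bsub>free_group A\<^esub>"
      by (simp add: free_group_def reduce_def inv_letter_def)
    moreover have "[(False, y)] \<in> carrier (free_group A)"
      using y by (simp add: free_group_def)
    ultimately have "[(False, y)] = inv\<^bsub>free_group A\<^esub> free_gen y"
      using gen(1) by (simp add: F.inv_equality)
    then have "h [l] = k [l]"
      using l eq[OF y] gen(1) by (cases b) (simp_all add: h.hom_inv k.hom_inv)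
    moreover have "l # w = [l] \<otimes>\<^bsub>free_group A\<^esub> w"
      using lw by (simp add: free_group_def)
    ultimately show ?case
      using Cons.IH[OF w] gen(2) w by (metis h.hom_mult k.hom_mult)
  qed
qed

lemma free_markov_unique:
  fixes Y :: "'a topology"
  assumes "free_topological_group TYPE('a word) Y T" "free_topological_group TYPE('a word) Y T'"
  shows "T = T'"
proof -
  let ?F = "free_group (topspace Y)"
  have finer: "openin T U" if "openin T' U"
      and T: "free_topological_group TYPE('a word) Y T"
      and T': "free_topological_group TYPE('a word) Y T'" for T T' U
  proof -
    have T'F: "topological_group ?F T'" "continuous_map Y T' free_gen"
      using T' by (auto simp: free_topological_group_def)
    have top: "topspace T = carrier ?F" "topspace T' = carrier ?F" "group ?F"
      using T T' by (auto simp: free_topological_group_def topological_group_def)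
    obtain h where h: "h \<in> hom ?F ?F" "continuous_map T T' h"
        "\<forall>y\<in>topspace Y. h (free_gen y) = free_gen y"
      using T T'F unfolding free_topological_group_def by blast
    have "(\<lambda>w. w) \<in> hom ?F ?F"
      by (auto simp: hom_def)
    then have "h w = w" if "w \<in> carrier ?F" for w
      using free_group_hom_unique[OF top(3) h(1) _ _ that] h(3) by blast
    then have "{w \<in> topspace T. h w \<in> U} = U"
      using openin_subset[OF that(1)] top by auto
    then show ?thesis
      using openin_continuous_map_preimage[OF h(2) that(1)] by simp
  qed
  show ?thesis
    unfolding topology_eq using finer[OF _ assms] finer[OF _ assms(2,1)] by (intro allI iffI)
qed

lemma continuous_map_finer:
  assumes "topspace T = topspace S" "\<And>U. openin S U \<Longrightarrow> openin T U"
  shows "continuous_map T S (\<lambda>x. x)"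
proof -
  have "{x \<in> topspace T. x \<in> U} = U" if "openin S U" for U
    using openin_subset[OF that] assms(1) by auto
  then show ?thesis
    using assms by (auto simp: continuous_map_def)
qed

lemma topological_group_pullback:
  fixes F :: "'f monoid" and G :: "'g monoid"
  assumes F: "group F" and G: "topological_group G S" and h: "h \<in> hom F G"
  shows "topological_group F (pullback_topology (carrier F) h S)"
proof -
  let ?P = "pullback_topology (carrier F) h S"
  have gG: "group G" and S: "topspace S = carrier G"
    and mS: "continuous_map (prod_topology S S) S (\<lambda>(x, y). x \<otimes>\<^bsub>G\<^esub> y)"
    and iS: "continuous_map S S (\<lambda>x. inv\<^bsub>G\<^esub> x)"
    using G by (auto simp: topological_group_def)
  interpret group_hom F G h
    by (intro group_hom.intro group_hom_axioms.intro F gG h)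
  have P: "topspace ?P = carrier F"
    using S by (auto simp: topspace_pullback_topology)
  have hP: "continuous_map ?P S h"
    using continuous_map_pullback[of S S id "carrier F" h] by simp
  have 1: "continuous_map (prod_topology ?P ?P) S (h \<circ> (\<lambda>(x, y). x \<otimes>\<^bsub>F\<^esub> y))"
  proof (rule continuous_map_eq)
    have "continuous_map (prod_topology ?P ?P) (prod_topology S S) (\<lambda>p. (h (fst p), h (snd p)))"
      using continuous_map_compose[OF continuous_map_fst[of ?P ?P] hP]
        continuous_map_compose[OF continuous_map_snd[of ?P ?P] hP]
      by (simp add: continuous_map_paired o_def)
    from continuous_map_compose[OF this mS]
    show "continuous_map (prod_topology ?P ?P) S
        ((\<lambda>(x, y). x \<otimes>\<^bsub>G\<^esub> y) \<circ> (\<lambda>p. (h (fst p), h (snd p))))" .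
  qed (auto simp: P)
  have 2: "continuous_map ?P S (h \<circ> (\<lambda>x. inv\<^bsub>F\<^esub> x))"
    by (rule continuous_map_eq[OF continuous_map_compose[OF hP iS]]) (auto simp: P)
  show ?thesis
    unfolding topological_group_def
    by (intro conjI F P continuous_map_pullback' 1 2) (auto simp: P)
qed

lemma free_topological_group_exists:
  fixes Y :: "'a topology"
  obtains T where "free_topological_group TYPE('g) Y T" "free_topological_group TYPE('a word) Y T"
proof -
  let ?F = "free_group (topspace Y)"
  define \<B> where "\<B> = insert (carrier ?F)
    {U. \<exists>S. topological_group ?F S \<and> continuous_map Y S free_gen \<and> openin S U}"
  define T where "T = topology_generated_by \<B>"
  have subF: "U \<subseteq> carrier ?F" if "U \<in> \<B>" for U
    using that openin_subset by (fastforce simp: \<B>_def topological_group_def)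
  have T: "topspace T = carrier ?F"
    unfolding T_def topology_generated_by_topspace using subF by (auto simp: \<B>_def)
  have into: "continuous_map X T f"
    if f: "f \<in> topspace X \<rightarrow> carrier ?F"
      and *: "\<And>S. topological_group ?F S \<Longrightarrow> continuous_map Y S free_gen \<Longrightarrow> continuous_map X S f"
    for X :: "'c topology" and f
    unfolding T_def
  proof (rule continuous_on_generated_topo)
    fix U assume U: "U \<in> \<B>"
    show "openin X (f -` U \<inter> topspace X)"
    proof (cases "U = carrier ?F")
      case True
      then have "f -` U \<inter> topspace X = topspace X"
        using f by auto
      then show ?thesis by simp
    next
      case False
      then obtain S where S: "topological_group ?F S" "continuous_map Y S free_gen" "openin S U"
        using U by (auto simp: \<B>_def)
      have "f -` U \<inter> topspace X = {x \<in> topspace X. f x \<in> U}"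
        by auto
      then show ?thesis
        using openin_continuous_map_preimage[OF *[OF S(1,2)] S(3)] by simp
    qed
  qed (use f in \<open>auto simp: \<B>_def\<close>)
  have id: "continuous_map T S (\<lambda>x. x)"
    if "topological_group ?F S" "continuous_map Y S free_gen" for S
  proof (rule continuous_map_finer)
    show "topspace T = topspace S"
      using that T by (simp add: topological_group_def)
    show "openin T U" if "openin S U" for U
      unfolding T_def using that \<open>topological_group ?F S\<close> \<open>continuous_map Y S free_gen\<close>
      by (intro topology_generated_by_Basis) (auto simp: \<B>_def)
  qed
  interpret F: group ?F by (rule group_free_group)
  have mult: "continuous_map (prod_topology T T) T (\<lambda>(x, y). x \<otimes>\<^bsub>?F\<^esub> y)"
  proof (rule into)
    fix S assume S: "topological_group ?F S" "continuous_map Y S free_gen"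
    have "continuous_map (prod_topology T T) (prod_topology S S) (\<lambda>p. (fst p, snd p))"
      unfolding continuous_map_paired
      using continuous_map_compose[OF continuous_map_fst[of T T] id[OF S]]
        continuous_map_compose[OF continuous_map_snd[of T T] id[OF S]]
      by (simp add: o_def)
    moreover have "continuous_map (prod_topology S S) S (\<lambda>(x, y). x \<otimes>\<^bsub>?F\<^esub> y)"
      using S by (simp add: topological_group_def)
    ultimately show "continuous_map (prod_topology T T) S (\<lambda>(x, y). x \<otimes>\<^bsub>?F\<^esub> y)"
      by (auto dest: continuous_map_compose simp: o_def case_prod_unfold)
  qed (auto simp: T)
  have inv: "continuous_map T T (\<lambda>x. inv\<^bsub>?F\<^esub> x)"
  proof (rule into)
    fix S assume S: "topological_group ?F S" "continuous_map Y S free_gen"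
    then have "continuous_map S S (\<lambda>x. inv\<^bsub>?F\<^esub> x)"
      by (simp add: topological_group_def)
    then show "continuous_map T S (\<lambda>x. inv\<^bsub>?F\<^esub> x)"
      using continuous_map_compose[OF id[OF S], of S "\<lambda>x. inv\<^bsub>?F\<^esub> x"] by (simp add: o_def)
  qed (auto simp: T)
  have gen: "free_gen y \<in> carrier ?F" if "y \<in> topspace Y" for y
    using that by (simp add: free_group_def)
  have genT: "continuous_map Y T free_gen"
    by (rule into) (use gen in auto)
  have tg: "topological_group ?F T"
    using T mult inv F.is_group by (simp add: topological_group_def)
  have univ: "\<exists>!h. h \<in> extensional (carrier ?F) \<and> h \<in> hom ?F G \<and> continuous_map T S h \<and>
      (\<forall>y \<in> topspace Y. h (free_gen y) = f y)"
    if G: "topological_group G S" and f: "continuous_map Y S f"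
    for G :: "'h monoid" and S f
  proof (rule ex_ex1I)
    have gG: "group G" and S: "topspace S = carrier G"
      using G by (auto simp: topological_group_def)
    interpret G: group G by fact
    have fG: "f \<in> topspace Y \<rightarrow> carrier G"
      using continuous_map_image_subset_topspace[OF f] S by auto
    define h where "h = restrict (word_eval G f) (carrier ?F)"
    have hh: "h \<in> hom ?F G"
      using word_eval_hom[OF gG fG] by (auto simp: hom_def h_def)
    have hgen: "h (free_gen y) = f y" if "y \<in> topspace Y" for y
      using gen[OF that] fG that by (auto simp: h_def word_eval_def Pi_iff)
    let ?P = "pullback_topology (carrier ?F) h S"
    have "topological_group ?F ?P"
      by (rule topological_group_pullback[OF group_free_group G hh])
    moreover have "continuous_map Y ?P free_gen"
    proof (rule continuous_map_pullback')
      show "continuous_map Y S (h \<circ> free_gen)"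
        by (rule continuous_map_eq[OF f]) (simp add: hgen)
    qed (use gen in auto)
    ultimately have "continuous_map T ?P (\<lambda>x. x)"
      by (rule id)
    moreover have "continuous_map ?P S h"
      using continuous_map_pullback[of S S id "carrier ?F" h] by simp
    ultimately have "continuous_map T S h"
      using continuous_map_compose[of T ?P "\<lambda>x. x" S h] by (simp add: o_def)
    then show "\<exists>h. h \<in> extensional (carrier ?F) \<and> h \<in> hom ?F G \<and> continuous_map T S h \<and>
        (\<forall>y \<in> topspace Y. h (free_gen y) = f y)"
      using hh hgen by (intro exI[of _ h]) (auto simp: h_def)
    fix h k
    assume h: "h \<in> extensional (carrier ?F) \<and> h \<in> hom ?F G \<and> continuous_map T S h \<and>
        (\<forall>y \<in> topspace Y. h (free_gen y) = f y)"
      and k: "k \<in> extensional (carrier ?F) \<and> k \<in> hom ?F G \<and> continuous_map T S k \<and>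
        (\<forall>y \<in> topspace Y. k (free_gen y) = f y)"
    then have "h w = k w" if "w \<in> carrier ?F" for w
      using free_group_hom_unique[OF gG, of h "topspace Y" k w] that by auto
    then show "h = k"
      using h k by (auto intro: extensionalityI)
  qed
  have "free_topological_group TYPE('g) Y T"
    unfolding free_topological_group_def by (intro conjI tg genT allI impI univ) auto
  moreover have "free_topological_group TYPE('a word) Y T"
    unfolding free_topological_group_def by (intro conjI tg genT allI impI univ) auto
  ultimately show thesis
    by (rule that)
qed

theorem free_topological_group_free_markov: "free_topological_group TYPE('g) Y (free_markov Y)"
proof -
  obtain T where T: "free_topological_group TYPE('g) Y T"
      "free_topological_group TYPE('a word) Y T"
    by (rule free_topological_group_exists)
  then have "free_markov Y = T"
    unfolding free_markov_def by (intro the_equality free_markov_unique)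
  then show ?thesis
    using T by simp
qed


section \<open>The filtration by word length\<close>

definition words_upto :: "nat \<Rightarrow> 'a topology \<Rightarrow> 'a word set" where
  "words_upto n Y = {w \<in> carrier (free_group (topspace Y)). length w \<le> n}"

definition free_markov_upto :: "nat \<Rightarrow> 'a topology \<Rightarrow> 'a word topology" where
  "free_markov_upto n Y = subtopology (free_markov Y) (words_upto n Y)"

definition letter_space :: "'a topology \<Rightarrow> (bool \<times> 'a) topology" where
  "letter_space Y = sum_topology (\<lambda>_. Y) UNIV"

text \<open>A point \<open>(i, x)\<close> is the not necessarily reduced word \<open>x 0, \<dots>, x (i - 1)\<close>.\<close>

definition unreduced_words_upto :: "nat \<Rightarrow> 'a topology \<Rightarrow> (nat \<times> (nat \<Rightarrow> bool \<times> 'a)) topology" where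
  "unreduced_words_upto n Y =
     sum_topology (\<lambda>i. product_topology (\<lambda>_. letter_space Y) {..<i}) {..n}"

definition reduction_map :: "nat \<times> (nat \<Rightarrow> bool \<times> 'a) \<Rightarrow> 'a word" where
  "reduction_map = (\<lambda>(i, x). reduce (map x [0..<i]))"

definition has_inductive_limit_topology :: "'a topology \<Rightarrow> bool" where
  "has_inductive_limit_topology Y \<longleftrightarrow>
     (\<forall>C \<subseteq> topspace (free_markov Y).
        closedin (free_markov Y) C \<longleftrightarrow>
        (\<forall>n. closedin (free_markov_upto n Y) (C \<inter> words_upto n Y)))"

definition power_map :: "nat \<Rightarrow> ('a \<Rightarrow> 'b) \<Rightarrow> (nat \<Rightarrow> 'a) \<Rightarrow> nat \<Rightarrow> 'b" where
  "power_map n f = (\<lambda>x. \<lambda>i\<in>{..<n}. f (x i))"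

end

theory Submission
  imports Defs
begin

text \<open>A partition of the interval cuts a loop in the suspension into pieces lying in \<open>X \<times> (0, 1)\<close> or in
  the complement of the middle level, so the loop crosses that level essentially finitely often. The
  \<open>X\<close>-coordinates of the crossings form a word in \<open>X\<close> whose letters vary continuously with the loop, and
  whose reduction over the path components is a complete homotopy invariant. Hence the fundamental group
  of the suspension is the free group on \<open>\<pi>\<^sub>0(X)\<close> with the quotient topology \<open>Q\<close> from the words in \<open>X\<close>.
  The topology \<open>Q\<close> is always finer than that of the free topological group \<open>F\<^sub>M(\<pi>\<^sub>0(X))\<close> and agrees with it
  exactly if it is a group topology; factoring the quotient map from words in \<open>X\<close> through words in \<open>\<pi>\<^sub>0(X)\<close>
  turns the agreement into the conditions 2 to 4. For this one needs that a set of reduced words of length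
  at most \<open>n\<close> is \<open>Q\<close>-closed as soon as its preimage among words of length at most \<open>n\<close> is closed.
  Finally, condition 3 for \<open>n = 1\<close> embeds \<open>\<pi>\<^sub>0(X)\<close> into a topological group, which is completely regular.\<close>

section \<open>Path homotopies in abstract topological spaces\<close>

text \<open>\<open>X\<close> need not be locally path connected and its path components need not be
  open. Then the transition function of the two charts is not locally constant on their overlap, and
  the suspension need not have a simply connected covering from which words could be read off. Along
  a single path the transition function is locally constant, so lifts are attached to paths, and the
  dependence of the word on the loop becomes a separate question. The letters are kept in
  \<open>X\<close> and not in the space of path components: a finite power of a quotient map need
  not be a quotient map, so words in path components may define a strictly coarser topology than
  words in \<open>X\<close>. The same phenomenon can make multiplication discontinuous for the
  quotient topology. The free topological group has no convenient description of its open sets. It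
  enters only through its universal property: as soon as the quotient topology is a group topology,
  the identity from the free topological group to it is continuous.\<close>

definition path_join :: "(real \<Rightarrow> 'a) \<Rightarrow> (real \<Rightarrow> 'a) \<Rightarrow> real \<Rightarrow> 'a" where
  "path_join f g = (\<lambda>t. if t \<le> 1/2 then f (2 * t) else g (2 * t - 1))"

lemma path_join_ends [simp]: "path_join f g 0 = f 0" "path_join f g 1 = g 1"
  by (simp_all add: path_join_def)

lemma loop_concat_eq: "loop_concat f g = restrict (path_join f g) {0..1}"
  by (simp add: loop_concat_def path_join_def)

text \<open>Defined for arbitrary paths given by unrestricted functions: segments of a loop and the
  vertical lines that close them up are deformed separately. The extensional representatives in
  \<open>loops\<close> come in only at the end.\<close>

definition path_homotopic :: "'a topology \<Rightarrow> (real \<Rightarrow> 'a) \<Rightarrow> (real \<Rightarrow> 'a) \<Rightarrow> bool" where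
  "path_homotopic Z f g \<longleftrightarrow>
     homotopic_with (\<lambda>h. h 0 = f 0 \<and> h 1 = f 1) unit_interval Z f g"

lemma path_homotopicD:
  assumes "path_homotopic Z f g"
  shows "pathin Z f" "pathin Z g" "g 0 = f 0" "g 1 = f 1"
  using homotopic_with_imp_continuous_maps[OF assms[unfolded path_homotopic_def]]
    homotopic_with_imp_property[OF assms[unfolded path_homotopic_def]]
  by (auto simp: pathin_def)

lemma path_homotopic_refl: "pathin Z f \<Longrightarrow> path_homotopic Z f f"
  by (simp add: path_homotopic_def pathin_def)

lemma path_homotopic_sym: "path_homotopic Z f g \<Longrightarrow> path_homotopic Z g f"
  using path_homotopicD[of Z f g] by (simp add: path_homotopic_def homotopic_with_symD)

lemma path_homotopic_trans [trans]:
  "path_homotopic Z f g \<Longrightarrow> path_homotopic Z g h \<Longrightarrow> path_homotopic Z f h"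
  using path_homotopicD[of Z f g] homotopic_with_trans[of _ unit_interval Z f g h]
  by (simp add: path_homotopic_def)

lemma path_homotopicE:
  assumes "path_homotopic Z f g"
  obtains h where "continuous_map (prod_topology (top_of_set {0..1::real}) unit_interval) Z h"
    "\<forall>t. h (0, t) = f t" "\<forall>t. h (1, t) = g t" "\<forall>s\<in>{0..1}. h (s, 0) = f 0 \<and> h (s, 1) = f 1"
proof -
  have "\<exists>h. continuous_map (prod_topology (top_of_set {0..1::real}) unit_interval) Z h \<and>
      (\<forall>t. h (0, t) = f t) \<and> (\<forall>t. h (1, t) = g t) \<and> (\<forall>s\<in>{0..1}. h (s, 0) = f 0 \<and> h (s, 1) = f 1)"
    using assms unfolding path_homotopic_def homotopic_with_def by simp
  then show thesis
    by (elim exE conjE) (rule that)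
qed

text \<open>Values outside the unit interval are immaterial, which allows passing between a path and
  its restriction.\<close>

lemma path_homotopic_cong:
  assumes "path_homotopic Z f g"
    and "\<And>t. t \<in> {0..1} \<Longrightarrow> f' t = f t" "\<And>t. t \<in> {0..1} \<Longrightarrow> g' t = g t"
  shows "path_homotopic Z f' g'"
proof -
  have 0: "f' 0 = f 0" "f' 1 = f 1"
    using assms(2) by auto
  show ?thesis
    unfolding path_homotopic_def 0
    by (rule homotopic_with_eq[OF assms(1)[unfolded path_homotopic_def]]) (use assms in auto)
qed

text \<open>The straight-line homotopy in \<open>K\<close>, followed by \<open>h\<close>. It is
  applied with \<open>K\<close> the unit interval, for reparametrizations, and with \<open>K\<close>
  the unit square, in \<open>pinch_word\<close>.\<close>

lemma path_homotopic_convex: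
  fixes K :: "'v::real_normed_vector set"
  assumes h: "continuous_map (top_of_set K) Z h" and K: "convex K"
    and p: "continuous_on {0..1} p" "p \<in> {0..1} \<rightarrow> K"
    and q: "continuous_on {0..1} q" "q \<in> {0..1} \<rightarrow> K"
    and ends: "p 0 = q 0" "p 1 = q 1"
  shows "path_homotopic Z (h \<circ> p) (h \<circ> q)"
proof -
  let ?k = "\<lambda>(s::real, t). (1 - s) *\<^sub>R p t + s *\<^sub>R q t"
  have im: "?k \<in> {0..1} \<times> {0..1} \<rightarrow> K"
    using K p(2) q(2) by (auto simp: Pi_iff convex_alt)
  have "continuous_on ({0..1} \<times> {0..1}) ?k"
    unfolding case_prod_unfold
    by (intro continuous_intros continuous_on_compose2[OF p(1)] continuous_on_compose2[OF q(1)]) auto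
  then have "continuous_map (top_of_set ({0..1} \<times> {0..1})) (top_of_set K) ?k"
    using im by (simp add: image_subset_iff_funcset)
  from continuous_map_compose[OF this h]
  have "continuous_map (prod_topology (top_of_set {0..1}) unit_interval) Z (h \<circ> ?k)"
    by (simp only: prod_topology_subtopology_eu)
  moreover have "(1 - s) *\<^sub>R v + s *\<^sub>R v = v" for s and v :: 'v
    by (simp flip: scaleR_left_distrib)
  ultimately show ?thesis
    unfolding path_homotopic_def homotopic_with_def
    by (intro exI[of _ "h \<circ> ?k"]) (simp add: ends)
qed

lemma path_homotopic_reparam:
  assumes "pathin Z f" "continuous_on {0..1} p" "p \<in> {0..1} \<rightarrow> {0..1}"
    "continuous_on {0..1} q" "q \<in> {0..1} \<rightarrow> {0..1}" "p 0 = q 0" "p 1 = q 1"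
  shows "path_homotopic Z (\<lambda>t. f (p t)) (\<lambda>t. f (q t))"
  using path_homotopic_convex[OF assms(1)[unfolded pathin_def] _ assms(2-)] by (simp add: o_def)

text \<open>The parameter space \<open>A\<close> is an interval when homotopies are joined, and a
  space of words when the loop of a word is shown to depend continuously on its letters.\<close>

lemma continuous_map_path_join:
  assumes F: "continuous_map (prod_topology A unit_interval) Z F"
    and G: "continuous_map (prod_topology A unit_interval) Z G"
    and FG: "\<And>a. a \<in> topspace A \<Longrightarrow> F (a, 1) = G (a, 0)"
  shows "continuous_map (prod_topology A unit_interval) Z
    (\<lambda>(a, t). if t \<le> 1/2 then F (a, 2 * t) else G (a, 2 * t - 1))"
proof -
  let ?A = "prod_topology A unit_interval"
  have t: "continuous_map ?A euclideanreal snd"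
    using continuous_map_snd continuous_map_into_fulltopology by blast
  have half: "continuous_map (subtopology ?A S) ?A (\<lambda>x. (fst x, a * snd x + b))"
    if "\<And>x. x \<in> topspace ?A \<Longrightarrow> x \<in> S \<Longrightarrow> a * snd x + b \<in> {0..1}" for S and a b :: real
  proof -
    have "continuous_map (subtopology ?A S) euclideanreal (\<lambda>x. a * snd x + b)"
      by (intro continuous_intros continuous_map_from_subtopology[OF t])
    then show ?thesis
      using that by (auto simp: continuous_map_paired continuous_map_in_subtopology
          intro!: continuous_map_from_subtopology[OF continuous_map_fst])
  qed
  have "continuous_map ?A Z (\<lambda>x. if snd x \<le> 1/2 then F (fst x, 2 * snd x) else G (fst x, 2 * snd x - 1))"
  proof (rule continuous_map_cases_le)
    show "continuous_map (subtopology ?A {x \<in> topspace ?A. snd x \<le> 1/2}) Z (\<lambda>x. F (fst x, 2 * snd x))"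
      using continuous_map_compose[OF half[of "{x \<in> topspace ?A. snd x \<le> 1/2}" 2 0] F]
      by (auto simp: o_def)
    show "continuous_map (subtopology ?A {x \<in> topspace ?A. 1/2 \<le> snd x}) Z (\<lambda>x. G (fst x, 2 * snd x - 1))"
      using continuous_map_compose[OF half[of "{x \<in> topspace ?A. 1/2 \<le> snd x}" 2 "-1"] G]
      by (auto simp: o_def)
  next
    fix x assume "x \<in> topspace ?A" "snd x = 1/2"
    then obtain a where "x = (a, 1/2)" "a \<in> topspace A"
      by (cases x) auto
    then show "F (fst x, 2 * snd x) = G (fst x, 2 * snd x - 1)"
      using FG by simp
  qed (use t in auto)
  then show ?thesis
    by (simp add: case_prod_unfold)
qed

lemma path_homotopic_join:
  assumes f: "path_homotopic Z f f'" and g: "path_homotopic Z g g'" and fg: "f 1 = g 0"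
  shows "path_homotopic Z (path_join f g) (path_join f' g')"
proof -
  let ?I = "top_of_set {0..1::real}"
  obtain h where h: "continuous_map (prod_topology ?I unit_interval) Z h"
      "\<And>x. h (0, x) = f x" "\<And>x. h (1, x) = f' x"
      "\<And>s. s \<in> {0..1} \<Longrightarrow> h (s, 0) = f 0 \<and> h (s, 1) = f 1"
    using f unfolding path_homotopic_def homotopic_with_def by auto
  obtain k where k: "continuous_map (prod_topology ?I unit_interval) Z k"
      "\<And>x. k (0, x) = g x" "\<And>x. k (1, x) = g' x"
      "\<And>s. s \<in> {0..1} \<Longrightarrow> k (s, 0) = g 0 \<and> k (s, 1) = g 1"
    using g unfolding path_homotopic_def homotopic_with_def by auto
  show ?thesis
    unfolding path_homotopic_def homotopic_with_def path_join_def
    by (intro exI[of _ "\<lambda>(a, t). if t \<le> 1/2 then h (a, 2 * t) else k (a, 2 * t - 1)"] conjI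
        continuous_map_path_join h(1) k(1)) (use h k fg in auto)
qed

lemma pathin_path_join:
  assumes "pathin Z f" "pathin Z g" "f 1 = g 0"
  shows "pathin Z (path_join f g)"
  using path_homotopicD(1)[OF path_homotopic_join[OF assms(1,2)[THEN path_homotopic_refl] assms(3)]] .

lemma path_homotopic_assoc:
  assumes "pathin Z f" "pathin Z g" "pathin Z h" "f 1 = g 0" "g 1 = h 0"
  shows "path_homotopic Z (path_join (path_join f g) h) (path_join f (path_join g h))"
proof -
  let ?F = "path_join f (path_join g h)"
  \<comment> \<open>The piecewise linear map taking 1/4 to 1/2 and 1/2 to 3/4. Its slopes 2, 1, 1/2
    decrease, so it is the minimum of the three lines.\<close>
  let ?p = "\<lambda>t::real. min ((t + 1)/2) (min (2 * t) (t + 1/4))"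
  have F: "pathin Z ?F"
    using pathin_path_join[OF assms(1) pathin_path_join[OF assms(2,3,5)]] assms by simp
  show ?thesis
  proof (rule path_homotopic_cong)
    show "path_homotopic Z (\<lambda>t. ?F (?p t)) (\<lambda>t. ?F t)"
      by (rule path_homotopic_reparam[OF F]) (auto intro!: continuous_intros simp: min_le_iff_disj)
  next
    fix t :: real assume "t \<in> {0..1}"
    consider "t \<le> 1/4" | "1/4 < t" "t \<le> 1/2" | "1/2 < t" by linarith
    then show "path_join (path_join f g) h t = ?F (?p t)"
    proof cases
      case 1
      then have "?p t = 2 * t" by auto
      then show ?thesis using 1 by (simp add: path_join_def)
    next
      case 2
      then have "?p t = t + 1/4" by auto
      then show ?thesis using 2 by (simp add: path_join_def)
    next
      case 3
      then have "?p t = (t + 1)/2" by auto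
      then show ?thesis using 3 by (simp add: path_join_def add_divide_distrib)
    qed
  qed auto
qed

lemma path_homotopic_const_join:
  assumes "pathin Z f" "z = f 0"
  shows "path_homotopic Z (path_join (\<lambda>_. z) f) f"
proof (rule path_homotopic_cong)
  show "path_homotopic Z (\<lambda>t. f (max 0 (2 * t - 1))) (\<lambda>t. f t)"
    by (rule path_homotopic_reparam[OF assms(1)]) (auto intro!: continuous_intros)
qed (use assms in \<open>auto simp: path_join_def\<close>)

lemma path_homotopic_join_const:
  assumes "pathin Z f" "z = f 1"
  shows "path_homotopic Z (path_join f (\<lambda>_. z)) f"
proof (rule path_homotopic_cong)
  show "path_homotopic Z (\<lambda>t. f (min 1 (2 * t))) (\<lambda>t. f t)"
    by (rule path_homotopic_reparam[OF assms(1)]) (auto intro!: continuous_intros)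
qed (use assms in \<open>auto simp: path_join_def\<close>)

text \<open>The join is \<open>f\<close> after the tent map, and the tent map can be deformed to the
  constant 0 within the interval.\<close>

lemma path_homotopic_join_rev:
  assumes "pathin Z f"
  shows "path_homotopic Z (path_join f (\<lambda>t. f (1 - t))) (\<lambda>_. f 0)"
proof (rule path_homotopic_cong)
  show "path_homotopic Z (\<lambda>t. f (min (2 * t) (2 - 2 * t))) (\<lambda>t. f 0)"
  proof (rule path_homotopic_reparam[OF assms(1), where q = "\<lambda>_. 0"])
    show "(\<lambda>t. min (2 * t) (2 - 2 * t)) \<in> {0..1} \<rightarrow> {0..1::real}"
      by (auto simp: min_def)
  qed (auto intro!: continuous_intros)
qed (simp_all add: min_def path_join_def)

lemma pathin_rev: "pathin Z f \<Longrightarrow> pathin Z (\<lambda>t. f (1 - t))"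
proof -
  assume "pathin Z f"
  from path_homotopic_reparam[OF this, of "(-) 1" "(-) 1"]
  have "path_homotopic Z (\<lambda>t. f (1 - t)) (\<lambda>t. f (1 - t))"
    by (simp add: Pi_iff continuous_on_op_minus)
  then show ?thesis
    by (rule path_homotopicD(1))
qed

lemma path_homotopic_rev_join:
  assumes "pathin Z f"
  shows "path_homotopic Z (path_join (\<lambda>t. f (1 - t)) f) (\<lambda>_. f 1)"
  using path_homotopic_join_rev[OF pathin_rev[OF assms]] by simp

lemma pathin_segment:
  assumes "pathin Z f" "0 \<le> a" "a \<le> b" "b \<le> 1"
  shows "pathin Z (\<lambda>t. f (a + t * (b - a)))"
proof -
  let ?p = "\<lambda>t. a + t * (b - a)"
  have "?p \<in> {0..1} \<rightarrow> {0..1}"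
  proof
    fix t :: real assume t: "t \<in> {0..1}"
    with assms have "0 \<le> t * (b - a)" "t * (b - a) \<le> b - a"
      by (auto intro!: mult_left_le_one_le mult_nonneg_nonneg)
    with assms show "?p t \<in> {0..1}" by auto
  qed
  moreover have "continuous_on {0..1} ?p"
    by (intro continuous_intros)
  ultimately show ?thesis
    using path_homotopicD(1)[OF path_homotopic_reparam[OF assms(1), of ?p ?p]] by simp
qed

lemma path_homotopic_join_segments:
  assumes f: "pathin Z f" and "0 \<le> a" "a \<le> b" "b \<le> c" "c \<le> 1"
  shows "path_homotopic Z (path_join (\<lambda>t. f (a + t * (b - a))) (\<lambda>t. f (b + t * (c - b))))
    (\<lambda>t. f (a + t * (c - a)))"
proof (rule path_homotopic_cong)
  \<comment> \<open>The first summand after \<open>a\<close> moves from \<open>a\<close> to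
    \<open>b\<close> during the first half and then rests; the second rests and then moves from
    \<open>b\<close> to \<open>c\<close>.\<close>
  let ?p = "\<lambda>t::real. a + min 1 (2 * t) * (b - a) + max 0 (2 * t - 1) * (c - b)"
  let ?q = "\<lambda>t. a + t * (c - a)"
  have p: "?p \<in> {0..1} \<rightarrow> {0..1}"
  proof
    fix t :: real assume t: "t \<in> {0..1}"
    with assms have "0 \<le> min 1 (2 * t) * (b - a)" "min 1 (2 * t) * (b - a) \<le> b - a"
      "0 \<le> max 0 (2 * t - 1) * (c - b)" "max 0 (2 * t - 1) * (c - b) \<le> c - b"
      by (auto intro!: mult_left_le_one_le mult_nonneg_nonneg)
    with assms show "?p t \<in> {0..1}" by auto
  qed
  have q: "?q \<in> {0..1} \<rightarrow> {0..1}"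
  proof
    fix t :: real assume t: "t \<in> {0..1}"
    with assms have "0 \<le> t * (c - a)" "t * (c - a) \<le> c - a"
      by (auto intro!: mult_left_le_one_le mult_nonneg_nonneg)
    with assms show "?q t \<in> {0..1}" by auto
  qed
  show "path_homotopic Z (\<lambda>t. f (?p t)) (\<lambda>t. f (?q t))"
    by (rule path_homotopic_reparam[OF f _ p _ q]) (auto intro!: continuous_intros)
qed (auto simp: min_def max_def path_join_def algebra_simps)


section \<open>Loop spaces\<close>

lemma openin_loop_space:
  assumes "compactin unit_interval K" "openin Z U"
  shows "openin (loop_space Z z) {f \<in> loops Z z. f ` K \<subseteq> U}"
proof -
  let ?S = "{f \<in> extensional (topspace unit_interval). continuous_map unit_interval Z f \<and> f ` K \<subseteq> U}"
  have "openin (compact_open_topology unit_interval Z) ?S"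
    unfolding compact_open_topology_def using assms by (intro topology_generated_by_Basis) auto
  moreover have "{f \<in> loops Z z. f ` K \<subseteq> U} = ?S \<inter> loops Z z"
    by (auto simp: loops_def pathin_def)
  ultimately show ?thesis
    unfolding loop_space_def openin_subtopology by blast
qed

lemma continuous_map_loop_eval:
  assumes "t \<in> {0..1}"
  shows "continuous_map (loop_space Z z) Z (\<lambda>f. f t)"
proof -
  have "openin (loop_space Z z) {f \<in> loops Z z. f t \<in> U}" if "openin Z U" for U
    using openin_loop_space[of "{t}" Z U z] that assms by auto
  moreover have "(\<lambda>f. f t) \<in> loops Z z \<rightarrow> topspace Z"
    using assms by (auto simp: loops_def pathin_def continuous_map_def)
  ultimately show ?thesis
    by (simp add: continuous_map_def)
qed

text \<open>One direction of the exponential law. The preimage of a subbasic set consists of the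
  \<open>a\<close> whose slice \<open>{a} \<times> K\<close> lies in an open set, and this is an
  open condition by the tube lemma, as \<open>K\<close> is compact.\<close>

lemma continuous_map_curry_loop:
  assumes h: "continuous_map (prod_topology A unit_interval) Z h"
    and ends: "\<And>a. a \<in> topspace A \<Longrightarrow> h (a, 0) = z \<and> h (a, 1) = z"
  shows "continuous_map A (loop_space Z z) (\<lambda>a. \<lambda>t\<in>{0..1}. h (a, t))"
proof -
  have path: "pathin Z (\<lambda>t\<in>{0..1}. h (a, t))" if "a \<in> topspace A" for a
  proof -
    have "continuous_map unit_interval (prod_topology A unit_interval) (\<lambda>t. (a, t))"
      using that by (simp add: continuous_map_pairedI)
    from continuous_map_compose[OF this h] show ?thesis
      unfolding pathin_def by (rule continuous_map_eq) auto
  qed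
  then have loop: "(\<lambda>t\<in>{0..1}. h (a, t)) \<in> loops Z z" if "a \<in> topspace A" for a
    using that ends by (auto simp: loops_def)
  show ?thesis
    unfolding loop_space_def continuous_map_in_subtopology compact_open_topology_def
  proof (intro conjI continuous_on_generated_topo)
    fix S assume "S \<in> {{f \<in> extensional (topspace unit_interval).
        continuous_map unit_interval Z f \<and> f ` K \<subseteq> U} |K U. compactin unit_interval K \<and> openin Z U}"
    then obtain K U where K: "compactin unit_interval K" and U: "openin Z U"
      and S: "S = {f \<in> extensional {0..1}. continuous_map unit_interval Z f \<and> f ` K \<subseteq> U}"
      by auto
    have K01: "K \<subseteq> {0..1}"
      using compactin_subset_topspace[OF K] by simp
    let ?W = "{p \<in> topspace (prod_topology A unit_interval). h p \<in> U}"
    have W: "openin (prod_topology A unit_interval) ?W"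
      using openin_continuous_map_preimage[OF h U] .
    have "(\<lambda>a. \<lambda>t\<in>{0..1}. h (a, t)) -` S \<inter> topspace A = {a \<in> topspace A. {a} \<times> K \<subseteq> ?W}"
    proof (intro equalityI subsetI)
      fix a assume "a \<in> (\<lambda>a. \<lambda>t\<in>{0..1}. h (a, t)) -` S \<inter> topspace A"
      then have "a \<in> topspace A" "(\<lambda>t\<in>{0..1}. h (a, t)) ` K \<subseteq> U"
        by (auto simp: S)
      then show "a \<in> {a \<in> topspace A. {a} \<times> K \<subseteq> ?W}"
        using K01 by (auto simp: image_subset_iff subset_iff)
    next
      fix a assume "a \<in> {a \<in> topspace A. {a} \<times> K \<subseteq> ?W}"
      then have a: "a \<in> topspace A" "\<And>t. t \<in> K \<Longrightarrow> h (a, t) \<in> U"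
        by auto
      then have "(\<lambda>t\<in>{0..1}. h (a, t)) ` K \<subseteq> U"
        using K01 by auto
      then show "a \<in> (\<lambda>a. \<lambda>t\<in>{0..1}. h (a, t)) -` S \<inter> topspace A"
        using path[OF a(1)] a(1) by (simp add: S pathin_def)
    qed
    moreover have "openin A {a \<in> topspace A. {a} \<times> K \<subseteq> ?W}"
    proof (subst openin_subopen, clarify)
      fix a assume "a \<in> topspace A" "{a} \<times> K \<subseteq> ?W"
      from tube_lemma_right[OF W K this] obtain O' V where
        "openin A O'" "openin unit_interval V" "a \<in> O'" "K \<subseteq> V" "O' \<times> V \<subseteq> ?W" by blast
      then show "\<exists>T. openin A T \<and> a \<in> T \<and> T \<subseteq> {a \<in> topspace A. {a} \<times> K \<subseteq> ?W}"
        using openin_subset[of A O'] by (intro exI[of _ O']) blast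
    qed
    ultimately show "openin A ((\<lambda>a. \<lambda>t\<in>{0..1}. h (a, t)) -` S \<inter> topspace A)"
      by simp
  next
    have "(\<lambda>a. \<lambda>t\<in>{0..1}. h (a, t)) ` topspace A \<subseteq>
        {f \<in> extensional (topspace unit_interval). continuous_map unit_interval Z f \<and> f ` {} \<subseteq> {}}"
      using path by (auto simp: pathin_def)
    moreover have "compactin unit_interval {}" "openin Z {}" by auto
    ultimately show "(\<lambda>a. \<lambda>t\<in>{0..1}. h (a, t)) ` topspace A \<subseteq>
      \<Union> {{f \<in> extensional (topspace unit_interval). continuous_map unit_interval Z f \<and> f ` K \<subseteq> U} |K U.
        compactin unit_interval K \<and> openin Z U}"
      by blast
  next
    show "(\<lambda>a. \<lambda>t\<in>{0..1}. h (a, t)) \<in> topspace A \<rightarrow> loops Z z"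
      using loop by blast
  qed
qed

lemma loop_homotopy_iff:
  assumes "f \<in> loops Z z" "g \<in> loops Z z"
  shows "(f, g) \<in> loop_homotopy Z z \<longleftrightarrow> path_homotopic Z f g"
  using assms by (simp add: loop_homotopy_def path_homotopic_def loops_def)

lemma equiv_loop_homotopy: "equiv (loops Z z) (loop_homotopy Z z)"
proof (rule equivI)
  show "loop_homotopy Z z \<subseteq> loops Z z \<times> loops Z z"
    by (auto simp: loop_homotopy_def)
  show "refl_on (loops Z z) (loop_homotopy Z z)"
    by (auto simp: refl_on_def loop_homotopy_iff path_homotopic_refl loops_def)
  show "sym (loop_homotopy Z z)"
  proof (rule symI)
    fix f g assume fg: "(f, g) \<in> loop_homotopy Z z"
    then have "f \<in> loops Z z" "g \<in> loops Z z"
      by (auto simp: loop_homotopy_def)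
    then show "(g, f) \<in> loop_homotopy Z z"
      using fg path_homotopic_sym[of Z f g] by (simp add: loop_homotopy_iff)
  qed
  show "trans (loop_homotopy Z z)"
  proof (rule transI)
    fix f g h assume fg: "(f, g) \<in> loop_homotopy Z z" and gh: "(g, h) \<in> loop_homotopy Z z"
    then have "f \<in> loops Z z" "g \<in> loops Z z" "h \<in> loops Z z"
      by (auto simp: loop_homotopy_def)
    then show "(f, h) \<in> loop_homotopy Z z"
      using fg gh path_homotopic_trans[of Z f g h] by (simp add: loop_homotopy_iff)
  qed
qed

lemma loop_concat_in_loops:
  assumes "f \<in> loops Z z" "g \<in> loops Z z"
  shows "loop_concat f g \<in> loops Z z"
proof -
  have "pathin Z (path_join f g)"
    using assms by (intro pathin_path_join) (auto simp: loops_def)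
  then have "pathin Z (loop_concat f g)"
    unfolding pathin_def loop_concat_eq by (rule continuous_map_eq) auto
  then show ?thesis
    using assms by (auto simp: loop_concat_eq loops_def)
qed

section \<open>The suspension\<close>

definition susp_proj :: "'a topology \<Rightarrow> 'a option \<times> real \<Rightarrow> ('a option \<times> real) set" where
  "susp_proj X p = (if p \<in> suspension_base X then suspension_base X else {p})"

abbreviation susp_pt :: "'a topology \<Rightarrow> 'a \<Rightarrow> real \<Rightarrow> ('a option \<times> real) set" where
  "susp_pt X x t \<equiv> susp_proj X (Some x, t)"

definition susp_x :: "('a option \<times> real) set \<Rightarrow> 'a" where
  "susp_x z = the (fst (the_elem z))"

definition susp_t :: "('a option \<times> real) set \<Rightarrow> real" where
  "susp_t z = snd (the_elem z)"

lemma suspension_plus_eq: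
  "suspension_plus X = quotient_topology (prod_topology (add_point X) unit_interval) (susp_proj X)"
  unfolding suspension_plus_def susp_proj_def[abs_def] ..

lemma openin_suspension_plus:
  "openin (suspension_plus X) U \<longleftrightarrow> U \<subseteq> topspace (suspension_plus X) \<and>
     openin (prod_topology (add_point X) unit_interval)
       {p \<in> topspace (prod_topology (add_point X) unit_interval). susp_proj X p \<in> U}"
  unfolding suspension_plus_eq openin_quotient_topology topspace_quotient_topology ..

lemma quotient_map_susp_proj:
  "quotient_map (prod_topology (add_point X) unit_interval) (suspension_plus X) (susp_proj X)"
  unfolding suspension_plus_eq by (rule quotient_map_quotient_topology)

text \<open>The block of the basepoint has at least two elements even if \<open>X\<close> is empty,
  so it differs from every singleton block.\<close>

lemma susp_proj_eq_base: "susp_proj X p = suspension_base X \<longleftrightarrow> p \<in> suspension_base X"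
proof -
  have "(None, 0) \<in> suspension_base X" "(None, 1) \<in> suspension_base X"
    by (auto simp: suspension_base_def)
  then have "{p} \<noteq> suspension_base X"
    by (metis prod.inject singletonD zero_neq_one)
  then show ?thesis
    by (auto simp: susp_proj_def)
qed

lemma susp_pt_base [simp]:
  "x \<in> topspace X \<Longrightarrow> susp_pt X x 0 = suspension_base X"
  "x \<in> topspace X \<Longrightarrow> susp_pt X x 1 = suspension_base X"
  unfolding susp_proj_eq_base by (auto simp: suspension_base_def)

lemma
  assumes "0 < t" "t < 1"
  shows susp_pt_eq_singleton: "susp_pt X x t = {(Some x, t)}"
    and susp_pt_neq_base: "susp_pt X x t \<noteq> suspension_base X"
proof -
  have "(Some x, t) \<notin> suspension_base X"
    using assms by (auto simp: suspension_base_def)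
  then show "susp_pt X x t = {(Some x, t)}" "susp_pt X x t \<noteq> suspension_base X"
    unfolding susp_proj_eq_base by (simp_all add: susp_proj_def)
qed

lemma susp_coords [simp]:
  assumes "0 < t" "t < 1"
  shows "susp_x (susp_pt X x t) = x" "susp_t (susp_pt X x t) = t"
  using assms by (simp_all add: susp_x_def susp_t_def susp_pt_eq_singleton)

lemma topspace_suspension_plus:
  "topspace (suspension_plus X) =
     insert (suspension_base X) {susp_pt X x t | x t. x \<in> topspace X \<and> 0 < t \<and> t < 1}"
proof -
  have "susp_proj X (None, 0) = suspension_base X"
    unfolding susp_proj_eq_base by (simp add: suspension_base_def)
  moreover have *: "susp_proj X (o', t) \<in> insert (suspension_base X)
      {susp_pt X x t | x t. x \<in> topspace X \<and> 0 < t \<and> t < 1}"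
    if o: "o' \<in> insert None (Some ` topspace X)" and t: "0 \<le> t" "t \<le> 1" for o' t
  proof (cases "(o', t) \<in> suspension_base X")
    case True
    then show ?thesis by (simp add: susp_proj_eq_base)
  next
    case False
    with o t obtain x where "o' = Some x" "x \<in> topspace X" "t \<noteq> 0" "t \<noteq> 1"
      by (auto simp: suspension_base_def)
    with t have "susp_proj X (o', t) = susp_pt X x t \<and> x \<in> topspace X \<and> 0 < t \<and> t < 1"
      by simp
    then show ?thesis
      by blast
  qed
  ultimately have "susp_proj X ` (insert None (Some ` topspace X) \<times> {0..1}) =
      insert (suspension_base X) {susp_pt X x t | x t. x \<in> topspace X \<and> 0 < t \<and> t < 1}" (is "?L = ?R")
  proof (intro equalityI)
    show "?R \<subseteq> ?L"
    proof
      fix z assume "z \<in> ?R"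
      then consider "z = susp_proj X (None, 0)" | x t where "z = susp_pt X x t" "x \<in> topspace X" "0 < t" "t < 1"
        using \<open>susp_proj X (None, 0) = suspension_base X\<close> by blast
      then show "z \<in> ?L"
        by cases auto
    qed
  next
    show "?L \<subseteq> ?R"
    proof
      fix z assume "z \<in> ?L"
      then obtain p where p: "p \<in> insert None (Some ` topspace X) \<times> {0..1}" "z = susp_proj X p"
        by blast
      obtain o' t where "p = (o', t)"
        by (cases p)
      with p *[of o' t] show "z \<in> ?R"
        by simp
    qed
  qed
  then show ?thesis
    unfolding suspension_plus_eq by simp
qed

lemma suspension_plus_cases:
  assumes "z \<in> topspace (suspension_plus X)"
  obtains "z = suspension_base X"
  | x t where "x \<in> topspace X" "0 < t" "t < 1" "z = susp_pt X x t"
  using assms unfolding topspace_suspension_plus by blast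

lemma suspension_base_in_topspace [simp]: "suspension_base X \<in> topspace (suspension_plus X)"
  by (simp add: topspace_suspension_plus)

lemma continuous_map_Some: "continuous_map X (add_point X) Some"
proof -
  have "{x \<in> topspace X. Some x \<in> U} = Some -` U" if "openin (add_point X) U" for U
    using that openin_subset[of X "Some -` U"] by (auto simp: openin_add_point)
  then show ?thesis
    by (auto simp: continuous_map_def openin_add_point)
qed

lemma continuous_map_susp_pt:
  "continuous_map (prod_topology X unit_interval) (suspension_plus X) (\<lambda>(x, t). susp_pt X x t)"
proof -
  have "continuous_map (prod_topology X unit_interval) (prod_topology (add_point X) unit_interval)
      (\<lambda>p. (Some (fst p), snd p))"
    using continuous_map_compose[OF continuous_map_fst continuous_map_Some]
    by (simp add: continuous_map_paired continuous_map_snd o_def)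
  from continuous_map_compose[OF this quotient_imp_continuous_map[OF quotient_map_susp_proj]]
  show ?thesis by (simp add: o_def case_prod_unfold)
qed

lemma continuous_map_susp_pt_compose:
  assumes "continuous_map A X f" "continuous_map A euclideanreal g"
    "\<And>a. a \<in> topspace A \<Longrightarrow> g a \<in> {0..1}"
  shows "continuous_map A (suspension_plus X) (\<lambda>a. susp_pt X (f a) (g a))"
proof -
  have "continuous_map A (prod_topology X unit_interval) (\<lambda>a. (f a, g a))"
    using assms by (auto simp: continuous_map_paired continuous_map_in_subtopology)
  from continuous_map_compose[OF this continuous_map_susp_pt] show ?thesis
    by (simp add: o_def)
qed

text \<open>The open cover of the suspension: \<open>susp_chart X False\<close> is \<open>X \<times> (0, 1)\<close> and
  \<open>susp_chart X True\<close> is the complement of the middle level, which contracts to the basepoint.\<close>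

definition susp_chart :: "'a topology \<Rightarrow> bool \<Rightarrow> ('a option \<times> real) set set" where
  "susp_chart X c = topspace (suspension_plus X) -
     (if c then {susp_pt X x (1/2) | x. x \<in> topspace X} else {suspension_base X})"

lemma susp_chart_interiorE:
  assumes "z \<in> susp_chart X False"
  obtains x t where "x \<in> topspace X" "0 < t" "t < 1" "z = susp_pt X x t" "susp_x z = x" "susp_t z = t"
proof -
  have "z \<in> topspace (suspension_plus X)" "z \<noteq> suspension_base X"
    using assms by (auto simp: susp_chart_def)
  then show thesis
    using that by (metis suspension_plus_cases susp_coords)
qed

lemma susp_chart_interiorD:
  assumes "z \<in> susp_chart X False"
  shows "susp_x z \<in> topspace X" "0 < susp_t z" "susp_t z < 1" "susp_pt X (susp_x z) (susp_t z) = z"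
  using susp_chart_interiorE[OF assms] by metis+

lemma susp_pt_in_chart:
  assumes "x \<in> topspace X" "0 < t" "t < 1"
  shows "susp_pt X x t \<in> susp_chart X False" "susp_pt X x t \<in> susp_chart X True \<longleftrightarrow> t \<noteq> 1/2"
proof -
  have "susp_pt X x t \<noteq> susp_pt X y (1/2)" if "t \<noteq> 1/2" for y
    using that assms by (simp add: susp_pt_eq_singleton)
  moreover have top: "susp_pt X x t \<in> topspace (suspension_plus X)"
    using assms by (auto simp: topspace_suspension_plus)
  ultimately show "susp_pt X x t \<in> susp_chart X True \<longleftrightarrow> t \<noteq> 1/2"
    using assms(1) unfolding susp_chart_def if_True Diff_iff mem_Collect_eq by blast
  show "susp_pt X x t \<in> susp_chart X False"
    using top susp_pt_neq_base[OF assms(2,3), of X x] unfolding susp_chart_def by simp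
qed

lemma susp_base_in_chart [simp]:
  "suspension_base X \<in> susp_chart X True" "suspension_base X \<notin> susp_chart X False"
  using susp_pt_neq_base[of "1/2" X] by (auto simp: susp_chart_def)

lemma susp_chart_cover: "z \<in> topspace (suspension_plus X) \<Longrightarrow> \<exists>c. z \<in> susp_chart X c"
  by (metis susp_base_in_chart(1) susp_pt_in_chart(1) suspension_plus_cases)

text \<open>No collapsed point lies over the chart \<open>False\<close>, so the preimage under the
  projection is a product of open sets. This is what makes both coordinates continuous on that
  chart.\<close>

lemma openin_susp_interior:
  assumes W: "openin X W" and T: "open T"
  shows "openin (suspension_plus X) {z \<in> susp_chart X False. susp_x z \<in> W \<and> susp_t z \<in> T}"
    (is "openin _ ?U")
proof -
  let ?P = "prod_topology (add_point X) unit_interval"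
  have "{p \<in> topspace ?P. susp_proj X p \<in> ?U} = Some ` W \<times> ({0<..<1} \<inter> T)"
  proof (intro equalityI subsetI)
    fix p assume p: "p \<in> {p \<in> topspace ?P. susp_proj X p \<in> ?U}"
    obtain o' t where ot: "p = (o', t)" by (cases p)
    have "p \<notin> suspension_base X"
      using p unfolding susp_chart_def susp_proj_eq_base[symmetric] by simp
    with p ot obtain x where "o' = Some x" "0 < t" "t < 1"
      by (fastforce simp: suspension_base_def)
    with p ot show "p \<in> Some ` W \<times> ({0<..<1} \<inter> T)"
      by auto
  next
    fix p assume "p \<in> Some ` W \<times> ({0<..<1} \<inter> T)"
    then show "p \<in> {p \<in> topspace ?P. susp_proj X p \<in> ?U}"
      using openin_subset[OF W] by (auto simp: susp_pt_in_chart)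
  qed
  moreover have "openin (add_point X) (Some ` W)"
    using W openin_subset[OF W] by (auto simp: openin_add_point inj_vimage_image_eq)
  moreover have "openin unit_interval ({0<..<1} \<inter> T)"
  proof -
    have "{0<..<1} \<inter> T = {0..1} \<inter> ({0<..<1} \<inter> T)" by auto
    then show ?thesis
      using T by (metis openin_open open_Int open_greaterThanLessThan)
  qed
  ultimately have "openin ?P {p \<in> topspace ?P. susp_proj X p \<in> ?U}"
    by (simp add: openin_prod_Times_iff)
  moreover have "?U \<subseteq> topspace (suspension_plus X)"
    by (auto simp: susp_chart_def)
  ultimately show ?thesis
    using quotient_map_susp_proj unfolding quotient_map_def by blast
qed

lemma openin_susp_chart: "openin (suspension_plus X) (susp_chart X c)"
proof (cases c)
  case False
  have "{z \<in> susp_chart X False. susp_x z \<in> topspace X \<and> susp_t z \<in> UNIV} = susp_chart X False"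
    by (auto dest: susp_chart_interiorD)
  then show ?thesis
    using False openin_susp_interior[OF openin_topspace open_UNIV, of X] by simp
next
  case True
  let ?P = "prod_topology (add_point X) unit_interval"
  have "Some -` {None} = ({} :: 'a set)"
    by auto
  then have "openin (add_point X) (Some ` topspace X)" "openin (add_point X) {None}"
    by (simp_all add: openin_add_point inj_vimage_image_eq image_subset_iff)
  moreover have "openin unit_interval ({0..1} - {1/2})"
    unfolding Diff_eq by (intro openin_open_Int) auto
  ultimately have "openin ?P (Some ` topspace X \<times> ({0..1} - {1/2}) \<union> {None} \<times> {0..1})"
    by (intro openin_Un) (simp_all add: openin_prod_Times_iff)
  moreover have "susp_proj X p \<in> susp_chart X True \<longleftrightarrow>
      p \<in> Some ` topspace X \<times> ({0..1} - {1/2}) \<union> {None} \<times> {0..1}" if p: "p \<in> topspace ?P" for p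
  proof -
    have "susp_proj X (None, t) = suspension_base X" if "t \<in> {0..1}" for t
      using that unfolding susp_proj_eq_base by (simp add: suspension_base_def)
    moreover have *: "susp_pt X x t \<in> susp_chart X True \<longleftrightarrow> t \<noteq> 1/2" if "x \<in> topspace X" "t \<in> {0..1}" for x t
      using that susp_pt_in_chart(2)[of x X t] by (cases "t = 0 \<or> t = 1") auto
    moreover obtain o' t where ot: "p = (o', t)" "t \<in> {0..1}" "o' = None \<or> (\<exists>x\<in>topspace X. o' = Some x)"
      using p by (cases p) auto
    ultimately show ?thesis
    proof (cases o')
      case (Some x)
      with ot have "x \<in> topspace X" by simp
      then show ?thesis
        using Some ot *[of x t]
        by simp
    qed (use ot in simp)
  qed
  then have "{p \<in> topspace ?P. susp_proj X p \<in> susp_chart X True} =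
      Some ` topspace X \<times> ({0..1} - {1/2}) \<union> {None} \<times> {0..1}"
    by auto
  moreover have "susp_chart X True \<subseteq> topspace (suspension_plus X)"
    by (auto simp: susp_chart_def)
  ultimately show ?thesis
    using True by (simp only: openin_suspension_plus)
qed

lemma susp_chart_subset: "susp_chart X c \<subseteq> topspace (suspension_plus X)"
  by (simp add: susp_chart_def)

lemma continuous_map_susp_coords:
  "continuous_map (subtopology (suspension_plus X) (susp_chart X False)) X susp_x"
  "continuous_map (subtopology (suspension_plus X) (susp_chart X False)) euclideanreal susp_t"
proof -
  have top: "topspace (subtopology (suspension_plus X) (susp_chart X False)) = susp_chart X False"
    using susp_chart_subset by auto
  have "openin (subtopology (suspension_plus X) (susp_chart X False)) {z \<in> susp_chart X False. susp_x z \<in> W}"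
    if "openin X W" for W
    using openin_susp_interior[OF that open_UNIV]
    by (subst openin_open_subtopology[OF openin_susp_chart]) auto
  moreover have "openin (subtopology (suspension_plus X) (susp_chart X False)) {z \<in> susp_chart X False. susp_t z \<in> T}"
    if "open T" for T
  proof -
    have "{z \<in> susp_chart X False. susp_t z \<in> T} = {z \<in> susp_chart X False. susp_x z \<in> topspace X \<and> susp_t z \<in> T}"
      by (auto dest: susp_chart_interiorD)
    then show ?thesis
      using openin_susp_interior[OF openin_topspace that, of X]
      by (subst openin_open_subtopology[OF openin_susp_chart]) auto
  qed
  ultimately show "continuous_map (subtopology (suspension_plus X) (susp_chart X False)) X susp_x"
    "continuous_map (subtopology (suspension_plus X) (susp_chart X False)) euclideanreal susp_t"
    unfolding continuous_map_def top by (auto dest: susp_chart_interiorD)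
qed

text \<open>The vertical path from the basepoint to \<open>z\<close>, through the nearer end of the
  interval. Level 1/2 counts as lower half, the same convention as in \<open>lift_label\<close>
  below. The path exists for every point, but it jumps as a function of \<open>z\<close> at the
  middle level.\<close>

definition susp_contract :: "'a topology \<Rightarrow> ('a option \<times> real) set \<Rightarrow> real \<Rightarrow> ('a option \<times> real) set" where
  "susp_contract X z u = (if z = suspension_base X then z
     else susp_pt X (susp_x z) (if susp_t z \<le> 1/2 then susp_t z * u else 1 - (1 - susp_t z) * u))"

lemma susp_contract_ends [simp]:
  assumes "z \<in> topspace (suspension_plus X)"
  shows "susp_contract X z 0 = suspension_base X" "susp_contract X z 1 = z"
  using assms by (auto elim!: suspension_plus_cases simp: susp_contract_def susp_pt_neq_base)

lemma mult_mem_unit_interval: "s \<in> {0..1} \<Longrightarrow> u \<in> {0..1} \<Longrightarrow> s * u \<in> {0..1::real}"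
  by (simp add: mult_le_one)

text \<open>The interval is locally compact Hausdorff, so the product of the suspension projection
  with it is still a quotient map. Continuity can therefore be checked before collapsing, where the
  chart splits into the disjoint open sets over the added point, below level 1/2 and above
  it.\<close>

lemma continuous_map_susp_contract:
  "continuous_map (prod_topology (subtopology (suspension_plus X) (susp_chart X True)) unit_interval)
     (suspension_plus X) (\<lambda>(z, u). susp_contract X z u)"
proof -
  let ?P = "prod_topology (add_point X) unit_interval"
  define W where "W = {p \<in> topspace ?P. susp_proj X p \<in> susp_chart X True}"
  define Q where "Q = prod_topology (subtopology ?P W) unit_interval"
  have q: "quotient_map Q (prod_topology (subtopology (suspension_plus X) (susp_chart X True)) unit_interval)
      (\<lambda>(p, u). (susp_proj X p, u))"
    unfolding Q_def
  proof (rule quotient_map_prod_left)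
    show "quotient_map (subtopology ?P W) (subtopology (suspension_plus X) (susp_chart X True)) (susp_proj X)"
      by (rule quotient_map_restriction[OF quotient_map_susp_proj W_def[symmetric]]) (simp add: openin_susp_chart)
    have "compact_space unit_interval"
      by (simp add: compact_space_subtopology)
    then show "locally_compact_space unit_interval"
      by (simp add: compact_imp_locally_compact_space Hausdorff_space_subtopology)
  qed (simp add: Hausdorff_space_subtopology)
  have PQ: "continuous_map Q ?P fst" "continuous_map Q unit_interval snd"
    unfolding Q_def using continuous_map_into_fulltopology[OF continuous_map_fst] by (auto simp: continuous_map_snd)
  have t: "continuous_map Q euclideanreal (\<lambda>x. snd (fst x))" "continuous_map Q euclideanreal snd"
    "continuous_map Q (add_point X) (\<lambda>x. fst (fst x))"
    using continuous_map_compose[OF PQ(1) continuous_map_fst] PQ(2)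
      continuous_map_compose[OF PQ(1) continuous_map_snd]
    by (simp_all add: o_def continuous_map_in_subtopology)
  have top: "fst (fst x) \<in> insert None (Some ` topspace X)" "snd (fst x) \<in> {0..1}" "snd x \<in> {0..1}"
    if "x \<in> topspace Q" for x
    using that by (auto simp: Q_def)
  let ?h = "(\<lambda>(z, u). susp_contract X z u) \<circ> (\<lambda>(p, u). (susp_proj X p, u))"
  \<comment> \<open>Index 0 is the part over the added point, 1 the lower half, and every other
    index the upper half; three open pieces suffice as level 1/2 is excluded over
    \<open>X\<close>.\<close>
  define T where "T = (\<lambda>i::nat. {x \<in> topspace Q. if i = 0 then fst (fst x) = None
    else if i = 1 then snd (fst x) < 1/2 else snd (fst x) > 1/2})"
  define k where "k = (\<lambda>i::nat. \<lambda>x. susp_proj X (if i = 0 then (None, 0)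
    else (fst (fst x), if i = 1 then snd (fst x) * snd x else 1 - (1 - snd (fst x)) * snd x)))"
  have None: "susp_proj X (None, r) = suspension_base X" if "r \<in> {0..1}" for r
    using that unfolding susp_proj_eq_base by (simp add: suspension_base_def)
  have unit: "s * u \<in> {0..1}" "1 - (1 - s) * u \<in> {0..1}" if "s \<in> {0..1}" "u \<in> {0..1}" for s u :: real
    using mult_mem_unit_interval[OF that] mult_mem_unit_interval[of "1 - s" u] that by auto
  have h: "?h x = k i x" if x: "x \<in> T i" for x i
  proof -
    obtain o' s u where xo: "x = ((o', s), u)" by (metis prod.exhaust)
    have su: "s \<in> {0..1}" "u \<in> {0..1}" and o: "o' \<in> insert None (Some ` topspace X)"
      using x top[of x] by (simp_all add: T_def xo)
    have i: "i = 0 \<longrightarrow> o' = None" "i = 1 \<longrightarrow> s < 1/2" "i \<noteq> 0 \<longrightarrow> i \<noteq> 1 \<longrightarrow> s > 1/2"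
      using x by (auto simp: T_def xo split: if_splits)
    show ?thesis
    proof (cases o')
      case o': None
      then show ?thesis
        using None[of s] None[of 0] None[OF unit(1)[OF su]] None[OF unit(2)[OF su]] su
        by (simp add: k_def xo susp_contract_def)
    next
      case (Some y)
      then have y: "y \<in> topspace X" and "i \<noteq> 0"
        using o i by auto
      consider "s = 0" | "s = 1" | "0 < s" "s < 1" using su by fastforce
      then show ?thesis
        by cases (use y i Some \<open>i \<noteq> 0\<close> in
            \<open>cases "i = 1"; simp add: k_def xo susp_contract_def susp_pt_neq_base\<close>)+
    qed
  qed
  have "continuous_map Q (suspension_plus X) ?h"
  proof (rule pasting_lemma[where I = UNIV and T = T and f = k])
    show "openin Q (T i)" for i
    proof -
      have "Some -` {None} = ({} :: 'a set)" by auto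
      then have "openin (add_point X) {None}"
        by (simp add: openin_add_point)
      from openin_continuous_map_preimage[OF t(3) this]
      have "openin Q {x \<in> topspace Q. fst (fst x) = None}" by simp
      moreover have "openin Q {x \<in> topspace Q. snd (fst x) < 1/2}" "openin Q {x \<in> topspace Q. snd (fst x) > 1/2}"
        using openin_continuous_map_preimage[OF t(1), of "{..<1/2}"]
          openin_continuous_map_preimage[OF t(1), of "{1/2<..}"] by simp_all
      ultimately show ?thesis
        unfolding T_def by (cases "i = 0"; cases "i = 1") simp_all
    qed
    show "continuous_map (subtopology Q (T i)) (suspension_plus X) (k i)" for i
    proof (cases "i = 0")
      case True
      then show ?thesis
        by (simp add: k_def None)
    next
      case False
      have "continuous_map Q euclideanreal
          (\<lambda>x. if i = 1 then snd (fst x) * snd x else 1 - (1 - snd (fst x)) * snd x)"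
        using t by (cases "i = 1") (auto intro!: continuous_intros)
      moreover have "(if i = 1 then snd (fst x) * snd x else 1 - (1 - snd (fst x)) * snd x) \<in> {0..1}"
        if "x \<in> topspace Q" for x
        using unit[OF top(2,3)[OF that]] by simp
      ultimately have "continuous_map Q ?P (\<lambda>x. (fst (fst x),
          if i = 1 then snd (fst x) * snd x else 1 - (1 - snd (fst x)) * snd x))"
        using t(3) unfolding continuous_map_paired continuous_map_in_subtopology by (simp add: Pi_iff)
      from continuous_map_compose[OF this quotient_imp_continuous_map[OF quotient_map_susp_proj]]
      have "continuous_map Q (suspension_plus X) (k i)"
        using False by (simp add: o_def k_def)
      then show ?thesis
        by (rule continuous_map_from_subtopology)
    qed
    show "k i x = k j x" if "i \<in> UNIV" "j \<in> UNIV" "x \<in> topspace Q \<inter> T i \<inter> T j" for i j x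
      using that h by (metis IntD1 IntD2)
    show "\<exists>j. j \<in> UNIV \<and> x \<in> T j \<and> ?h x = k j x" if x: "x \<in> topspace Q" for x
    proof -
      obtain p u where xo: "x = (p, u)" by (cases x)
      have p: "p \<in> topspace ?P" "susp_proj X p \<in> susp_chart X True"
        using x by (simp_all add: Q_def W_def xo)
      obtain o' s where ps: "p = (o', s)" by (cases p)
      have "x \<in> T 0 \<or> x \<in> T 1 \<or> x \<in> T 2"
      proof (cases o')
        case (Some y)
        then have "s \<noteq> 1/2"
          using p susp_pt_in_chart(2)[of y X s] by (auto simp: ps)
        then show ?thesis
          using x by (auto simp: T_def xo ps)
      qed (use x in \<open>simp add: T_def xo ps\<close>)
      then show ?thesis
        using h by blast
    qed
  qed
  then show ?thesis
    by (rule continuous_compose_quotient_map[OF q])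
qed

section \<open>Lifting paths to words\<close>

text \<open>In place of a covering space: passing from the chart \<open>True\<close> to the chart \<open>False\<close> above level \<open>1/2\<close>
  at \<open>x\<close> multiplies by the path component of \<open>x\<close>, a transition function that is locally constant only
  along paths. A lift of a path is a family of reduced words that is locally constant in both charts,
  the word \<open>l k\<close> being the label in the chart \<open>True\<close>. (At the basepoint, which is not in the chart
  \<open>False\<close>, the coordinates \<open>susp_x\<close> and \<open>susp_t\<close> are junk values.)\<close>

definition lift_label :: "'a topology \<Rightarrow> (real \<Rightarrow> ('a option \<times> real) set) \<Rightarrow> (real \<Rightarrow> 'a set word) \<Rightarrow>
    bool \<Rightarrow> real \<Rightarrow> 'a set word" where
  "lift_label X f l c k = (if c \<or> susp_t (f k) \<le> 1/2 then l k
     else push_letter (True, path_component_of_set X (susp_x (f k))) (l k))"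

definition susp_lift :: "'a topology \<Rightarrow> (real \<Rightarrow> ('a option \<times> real) set) \<Rightarrow> (real \<Rightarrow> 'a set word) \<Rightarrow>
    real set \<Rightarrow> bool" where
  "susp_lift X f l S \<longleftrightarrow> (\<forall>k\<in>S. reduced (l k) \<and> (\<forall>c. f k \<in> susp_chart X c \<longrightarrow>
     (\<exists>e>0. \<forall>k'\<in>S. dist k' k < e \<longrightarrow> lift_label X f l c k' = lift_label X f l c k)))"

lemma lift_label_True [simp]: "lift_label X f l True k = l k"
  by (simp add: lift_label_def)

lemma susp_lift_subset: "susp_lift X f l S \<Longrightarrow> T \<subseteq> S \<Longrightarrow> susp_lift X f l T"
  unfolding susp_lift_def by (meson subsetD)

text \<open>Cuts a lift of a concatenated loop into lifts of its two factors.\<close>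

lemma susp_lift_compose:
  assumes l: "susp_lift X f l S" and p: "continuous_on T p" "p \<in> T \<rightarrow> S"
    and g: "\<And>k. k \<in> T \<Longrightarrow> g k = f (p k)"
  shows "susp_lift X g (l \<circ> p) T"
  unfolding susp_lift_def
proof (intro ballI conjI allI impI)
  fix k assume k: "k \<in> T"
  then have pk: "p k \<in> S" using p by auto
  then show "reduced ((l \<circ> p) k)"
    using l by (simp add: susp_lift_def)
  fix c assume "g k \<in> susp_chart X c"
  then have "f (p k) \<in> susp_chart X c"
    using g[OF k] by simp
  with l pk obtain e where e: "e > 0" "\<And>k'. k' \<in> S \<Longrightarrow> dist k' (p k) < e \<Longrightarrow>
      lift_label X f l c k' = lift_label X f l c (p k)"
    unfolding susp_lift_def by blast
  obtain d where d: "d > 0" "\<And>k'. k' \<in> T \<Longrightarrow> dist k' k < d \<Longrightarrow> dist (p k') (p k) < e"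
    using p(1) k e(1) unfolding continuous_on_iff by blast
  have "lift_label X g (l \<circ> p) c k' = lift_label X f l c (p k')" if "k' \<in> T" for k'
    using g[OF that] by (simp add: lift_label_def)
  then show "\<exists>e>0. \<forall>k'\<in>T. dist k' k < e \<longrightarrow> lift_label X g (l \<circ> p) c k' = lift_label X g (l \<circ> p) c k"
    using d e(2) p(2) k by (intro exI[of _ d]) (auto simp: Pi_iff)
qed

lemma lift_label_const:
  assumes l: "susp_lift X f l S" and f: "f ` S \<subseteq> susp_chart X c" and S: "connected S"
    and "a \<in> S" "b \<in> S"
  shows "lift_label X f l c a = lift_label X f l c b"
proof (rule connected_local_const[OF S \<open>a \<in> S\<close> \<open>b \<in> S\<close>], rule ballI)
  fix k assume "k \<in> S"
  moreover have "f k \<in> susp_chart X c"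
    using f \<open>k \<in> S\<close> by blast
  ultimately obtain e where "e > 0" "\<forall>k'\<in>S. dist k' k < e \<longrightarrow> lift_label X f l c k' = lift_label X f l c k"
    using l unfolding susp_lift_def by blast
  then show "\<forall>\<^sub>F k' in at k within S. lift_label X f l c k = lift_label X f l c k'"
    unfolding eventually_at by (intro exI[of _ e]) auto
qed

lemma path_component_of_convex_image:
  fixes S :: "real set"
  assumes g: "continuous_map (top_of_set S) X g" and S: "convex S" and ab: "a \<in> S" "b \<in> S"
  shows "path_component_of_set X (g a) = path_component_of_set X (g b)"
proof -
  let ?p = "\<lambda>t::real. (1 - t) * a + t * b"
  have im: "?p \<in> {0..1} \<rightarrow> S"
    using S ab by (auto simp: convex_alt)
  have "continuous_on {0..1} ?p"
    by (intro continuous_intros)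
  then have "continuous_map unit_interval (top_of_set S) ?p"
    using im by (simp add: image_subset_iff_funcset)
  from continuous_map_compose[OF this g] have "pathin X (\<lambda>t. g (?p t))"
    by (simp add: pathin_def o_def)
  then have "path_component_of X (g a) (g b)"
    unfolding path_component_of_def by (intro exI[of _ "\<lambda>t. g (?p t)"]) simp
  then show ?thesis
    by (simp add: path_component_of_equiv)
qed

lemma path_component_susp_x_eq:
  fixes S :: "real set"
  assumes f: "continuous_map (top_of_set S) (suspension_plus X) f" and S: "convex S"
    and chart: "f ` S \<subseteq> susp_chart X False" and "a \<in> S" "b \<in> S"
  shows "path_component_of_set X (susp_x (f a)) = path_component_of_set X (susp_x (f b))"
proof -
  have "continuous_map (top_of_set S) (subtopology (suspension_plus X) (susp_chart X False)) f"
    using f chart by (simp add: continuous_map_in_subtopology image_subset_iff_funcset)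
  from path_component_of_convex_image[OF continuous_map_compose[OF this continuous_map_susp_coords(1)] S assms(4,5)]
  show ?thesis
    by simp
qed

text \<open>On the overlap of the charts the level is different from 1/2, so nearby times stay on
  the same side; the \<open>X\<close>-coordinates at these times lie on a path in \<open>X\<close>,
  hence in one path component. So the transition function is locally constant along
  \<open>f\<close>.\<close>

lemma crossing_locally_const:
  fixes S :: "real set"
  assumes f: "continuous_map (top_of_set S) (suspension_plus X) f" and S: "convex S"
    and k: "k \<in> S" "f k \<in> susp_chart X True" "f k \<in> susp_chart X False"
  obtains e where "e > 0" "\<And>k'. k' \<in> S \<Longrightarrow> dist k' k < e \<Longrightarrow>
    (susp_t (f k') \<le> 1/2 \<longleftrightarrow> susp_t (f k) \<le> 1/2) \<and>
    path_component_of_set X (susp_x (f k')) = path_component_of_set X (susp_x (f k))"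
proof -
  have "susp_t (f k) \<noteq> 1/2"
    using susp_chart_interiorD[OF k(3)] k(2) susp_pt_in_chart(2) by metis
  define T :: "real set" where "T = (if susp_t (f k) \<le> 1/2 then {..<1/2} else {1/2<..})"
  let ?U = "{z \<in> susp_chart X False. susp_x z \<in> topspace X \<and> susp_t z \<in> T}"
  have T: "open T" "susp_t (f k) \<in> T"
    using \<open>susp_t (f k) \<noteq> 1/2\<close> by (auto simp: T_def)
  have "openin (top_of_set S) {k' \<in> topspace (top_of_set S). f k' \<in> ?U}"
    using openin_continuous_map_preimage[OF f openin_susp_interior[OF openin_topspace T(1)]] .
  moreover have "f k \<in> ?U"
    using k(3) T susp_chart_interiorD(1) by blast
  ultimately have "\<exists>e>0. \<forall>k'\<in>S. dist k' k < e \<longrightarrow> k' \<in> {k' \<in> topspace (top_of_set S). f k' \<in> ?U}"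
    using k(1) unfolding openin_euclidean_subtopology_iff by simp
  then obtain e where e: "e > 0" "\<And>k'. k' \<in> S \<Longrightarrow> dist k' k < e \<Longrightarrow> f k' \<in> ?U"
    by auto
  have "path_component_of_set X (susp_x (f k')) = path_component_of_set X (susp_x (f k))"
    if "k' \<in> S" "dist k' k < e" for k'
  proof (rule path_component_susp_x_eq)
    show "continuous_map (top_of_set (S \<inter> ball k e)) (suspension_plus X) f"
      using continuous_map_from_subtopology[OF f, of "ball k e"] by (simp add: subtopology_subtopology)
    show "f ` (S \<inter> ball k e) \<subseteq> susp_chart X False"
      using e(2) by (force simp: dist_commute)
  qed (use that k S e(1) in \<open>simp_all add: dist_commute convex_Int\<close>)
  moreover have "susp_t (f k') \<le> 1/2 \<longleftrightarrow> susp_t (f k) \<le> 1/2" if "k' \<in> S" "dist k' k < e" for k'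
  proof -
    have "susp_t (f k') \<in> T"
      using e(2)[OF that] by simp
    then show ?thesis
      by (auto simp: T_def split: if_splits)
  qed
  ultimately show thesis
    using that e(1) by blast
qed

text \<open>Constancy in one chart containing the image is enough: where the other chart is met, the
  transition function is locally constant by \<open>crossing_locally_const\<close>, and
  multiplication by a letter is invertible.\<close>

lemma susp_lift_one_chart:
  assumes f: "continuous_map (top_of_set S) (suspension_plus X) f" and S: "convex S"
    and chart: "f ` S \<subseteq> susp_chart X c"
    and l: "\<And>k. k \<in> S \<Longrightarrow> reduced (l k)" "\<And>k. k \<in> S \<Longrightarrow> lift_label X f l c k = u"
  shows "susp_lift X f l S"
  unfolding susp_lift_def
proof (intro ballI conjI allI impI)
  fix k c' assume k: "k \<in> S" and c': "f k \<in> susp_chart X c'"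
  show "\<exists>e>0. \<forall>k'\<in>S. dist k' k < e \<longrightarrow> lift_label X f l c' k' = lift_label X f l c' k"
  proof (cases "c' = c")
    case True
    then show ?thesis
      using l(2) k by (intro exI[of _ 1]) simp
  next
    case False
    have c: "f k \<in> susp_chart X c"
      using chart k by blast
    have both: "f k \<in> susp_chart X True" "f k \<in> susp_chart X False"
      using c c' False by (cases c; cases c'; simp)+
    obtain e where e: "e > 0" "\<And>k'. k' \<in> S \<Longrightarrow> dist k' k < e \<Longrightarrow>
        (susp_t (f k') \<le> 1/2 \<longleftrightarrow> susp_t (f k) \<le> 1/2) \<and>
        path_component_of_set X (susp_x (f k')) = path_component_of_set X (susp_x (f k))"
      using crossing_locally_const[OF f S k both] by blast
    have "lift_label X f l c' k' = lift_label X f l c' k" if k': "k' \<in> S" "dist k' k < e" for k'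
    proof (cases c)
      case True
      then show ?thesis
        using e(2)[OF k'] l(2)[OF k'(1)] l(2)[OF k] by (simp add: lift_label_def)
    next
      case c: False
      then have "c'"
        using \<open>c' \<noteq> c\<close> by simp
      have "l k' = l k"
      proof (cases "susp_t (f k) \<le> 1/2")
        case True
        then show ?thesis
          using e(2)[OF k'] l(2)[OF k'(1)] l(2)[OF k] c by (simp add: lift_label_def)
      next
        case False
        let ?x = "path_component_of_set X (susp_x (f k))"
        have "push_letter (True, ?x) (l k') = push_letter (True, ?x) (l k)"
          using False e(2)[OF k'] l(2)[OF k'(1)] l(2)[OF k] c by (simp add: lift_label_def)
        then have "push_letter (inv_letter (True, ?x)) (push_letter (True, ?x) (l k')) =
            push_letter (inv_letter (True, ?x)) (push_letter (True, ?x) (l k))"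
          by simp
        then show ?thesis
          using push_push_inv[OF l(1)[OF k'(1)], of "inv_letter (True, ?x)"]
            push_push_inv[OF l(1)[OF k], of "inv_letter (True, ?x)"] by simp
      qed
      then show ?thesis
        using \<open>c'\<close> by simp
    qed
    then show ?thesis
      using e(1) by blast
  qed
qed (rule l(1))

lemma susp_lift_glue:
  assumes l: "susp_lift X f l {a..b}" and m: "susp_lift X f m {b..c}" and "l b = m b"
    and "a \<le> b" "b \<le> c"
  shows "susp_lift X f (\<lambda>k. if k \<le> b then l k else m k) {a..c}"
  unfolding susp_lift_def
proof (intro ballI conjI allI impI)
  let ?l = "\<lambda>k. if k \<le> b then l k else m k"
  fix k assume k: "k \<in> {a..c}"
  show "reduced (?l k)"
    using l m k by (auto simp: susp_lift_def)
  fix i assume i: "f k \<in> susp_chart X i"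
  have L: "lift_label X f ?l i k' = lift_label X f l i k'" if "k' \<le> b" for k'
    using that by (simp add: lift_label_def)
  have M: "lift_label X f ?l i k' = lift_label X f m i k'" if "b \<le> k'" for k'
    using that \<open>l b = m b\<close> by (cases "k' = b") (simp_all add: lift_label_def)
  have "\<exists>e>0. \<forall>k'\<in>{a..b}. dist k' k < e \<longrightarrow> lift_label X f ?l i k' = lift_label X f ?l i k"
  proof (cases "k \<le> b")
    case True
    then have "k \<in> {a..b}" using k by simp
    with l i obtain e where "e > 0"
      "\<forall>k'\<in>{a..b}. dist k' k < e \<longrightarrow> lift_label X f l i k' = lift_label X f l i k"
      unfolding susp_lift_def by blast
    then show ?thesis
      using L[OF True] L by (intro exI[of _ e]) simp
  next
    \<comment> \<open>Here \<open>b < k\<close>, so the radius \<open>k - b\<close> excludes every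
      point of \<open>{a..b}\<close>.\<close>
    case False
    then show ?thesis
      by (intro exI[of _ "k - b"]) (auto simp: dist_real_def)
  qed
  then obtain e where e: "e > 0" "\<forall>k'\<in>{a..b}. dist k' k < e \<longrightarrow> lift_label X f ?l i k' = lift_label X f ?l i k"
    by blast
  have "\<exists>e>0. \<forall>k'\<in>{b..c}. dist k' k < e \<longrightarrow> lift_label X f ?l i k' = lift_label X f ?l i k"
  proof (cases "b \<le> k")
    case True
    then have "k \<in> {b..c}" using k by simp
    with m i obtain e where "e > 0"
      "\<forall>k'\<in>{b..c}. dist k' k < e \<longrightarrow> lift_label X f m i k' = lift_label X f m i k"
      unfolding susp_lift_def by blast
    then show ?thesis
      using M[OF True] M by (intro exI[of _ e]) simp
  next
    case False
    then show ?thesis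
      by (intro exI[of _ "b - k"]) (auto simp: dist_real_def)
  qed
  then obtain d where d: "d > 0" "\<forall>k'\<in>{b..c}. dist k' k < d \<longrightarrow> lift_label X f ?l i k' = lift_label X f ?l i k"
    by blast
  have "lift_label X f ?l i k' = lift_label X f ?l i k" if "k' \<in> {a..c}" "dist k' k < min d e" for k'
    using that d(2) e(2) by (cases "k' \<le> b") auto
  then show "\<exists>e>0. \<forall>k'\<in>{a..c}. dist k' k < e \<longrightarrow> lift_label X f ?l i k' = lift_label X f ?l i k"
    using d(1) e(1) by (intro exI[of _ "min d e"]) auto
qed

lemma path_locally_in_chart:
  assumes f: "pathin (suspension_plus X) f" and x: "x \<in> {0..1}"
  obtains d c where "d > 0" "\<And>k. k \<in> {0..1} \<Longrightarrow> dist k x < d \<Longrightarrow> f k \<in> susp_chart X c"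
proof -
  have "f x \<in> topspace (suspension_plus X)"
    using f x by (auto simp: pathin_def continuous_map_def)
  then obtain c where c: "f x \<in> susp_chart X c"
    using susp_chart_cover by blast
  have "openin unit_interval {k \<in> topspace unit_interval. f k \<in> susp_chart X c}"
    using openin_continuous_map_preimage[OF f[unfolded pathin_def] openin_susp_chart] .
  then have "\<exists>e>0. \<forall>k\<in>{0..1}. dist k x < e \<longrightarrow> f k \<in> susp_chart X c"
    using x c unfolding openin_euclidean_subtopology_iff by simp
  then show thesis
    using that by blast
qed

text \<open>Subdivision is done by \<open>Bolzano\<close>; the value at the right end is left
  arbitrary so that lifts on adjacent intervals can be matched. The right end is the prescribed one
  because letters act from the left: the left label is then the word of the path times the right
  label.\<close>

lemma susp_lift_exists:
  assumes f: "pathin (suspension_plus X) f" and v: "reduced v"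
  obtains l where "susp_lift X f l {0..1}" "l 1 = v"
proof -
  have "0 \<le> (0::real) \<longrightarrow> 1 \<le> (1::real) \<longrightarrow> (\<forall>v. reduced v \<longrightarrow> (\<exists>l. susp_lift X f l {0..1} \<and> l 1 = v))"
  proof (rule Bolzano[where P = "\<lambda>a b. 0 \<le> a \<longrightarrow> b \<le> 1 \<longrightarrow>
        (\<forall>v. reduced v \<longrightarrow> (\<exists>l. susp_lift X f l {a..b} \<and> l b = v))"])
    fix a b c :: real
    assume ab: "0 \<le> a \<longrightarrow> b \<le> 1 \<longrightarrow> (\<forall>v. reduced v \<longrightarrow> (\<exists>l. susp_lift X f l {a..b} \<and> l b = v))"
      and bc: "0 \<le> b \<longrightarrow> c \<le> 1 \<longrightarrow> (\<forall>v. reduced v \<longrightarrow> (\<exists>l. susp_lift X f l {b..c} \<and> l c = v))"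
      and le: "a \<le> b" "b \<le> c"
    show "0 \<le> a \<longrightarrow> c \<le> 1 \<longrightarrow> (\<forall>v. reduced v \<longrightarrow> (\<exists>l. susp_lift X f l {a..c} \<and> l c = v))"
    proof (intro impI allI)
      fix v :: "'a set word" assume "0 \<le> a" "c \<le> 1" "reduced v"
      then obtain m where m: "susp_lift X f m {b..c}" "m c = v"
        using bc le by auto
      then have "reduced (m b)"
        using le by (simp add: susp_lift_def)
      then obtain l where l: "susp_lift X f l {a..b}" "l b = m b"
        using ab le \<open>0 \<le> a\<close> \<open>c \<le> 1\<close> by auto
      show "\<exists>l. susp_lift X f l {a..c} \<and> l c = v"
        using susp_lift_glue[OF l(1) m(1) l(2) le] le l(2) m(2)
        by (intro exI[of _ "\<lambda>k. if k \<le> b then l k else m k"]) (auto simp: antisym)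
    qed
  next
    fix x :: real assume x: "0 \<le> x" "x \<le> 1"
    then obtain d c where d: "d > 0" "\<And>k. k \<in> {0..1} \<Longrightarrow> dist k x < d \<Longrightarrow> f k \<in> susp_chart X c"
      using path_locally_in_chart[OF f, of x] by auto
    have "\<exists>l. susp_lift X f l {a..b} \<and> l b = v"
      if ab: "a \<le> x" "x \<le> b" "b - a < d" "0 \<le> a" "b \<le> 1" and v: "reduced v" for a b and v :: "'a set word"
    proof -
      have chart: "f ` {a..b} \<subseteq> susp_chart X c"
        using d(2) ab by (auto simp: dist_real_def)
      have fab: "continuous_map (top_of_set {a..b}) (suspension_plus X) f"
        using f ab(4,5) unfolding pathin_def
        by (metis atLeastatMost_subset_iff continuous_map_from_subtopology_mono)
      show ?thesis
      proof (cases c)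
        case True
        have "susp_lift X f (\<lambda>_. v) {a..b}"
          by (rule susp_lift_one_chart[OF fab _ chart, where u = v]) (use v True in simp_all)
        then show ?thesis by blast
      next
        case False
        \<comment> \<open>\<open>u\<close> is the label in the chart \<open>False\<close> forced by
          the value \<open>v\<close> at the right end; \<open>l\<close> translates this constant
          label back to the chart \<open>True\<close>.\<close>
        define u where "u = (if susp_t (f b) \<le> 1/2 then v
          else push_letter (True, path_component_of_set X (susp_x (f b))) v)"
        define l where "l k = (if susp_t (f k) \<le> 1/2 then u
          else push_letter (inv_letter (True, path_component_of_set X (susp_x (f k)))) u)" for k
        have u: "reduced u"
          using v by (simp add: u_def reduced_push)
        have "susp_lift X f l {a..b}"
        proof (rule susp_lift_one_chart[OF fab _ chart, where u = u])
          show "reduced (l k)" for k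
            using u by (simp add: l_def reduced_push)
          show "lift_label X f l c k = u" for k
            using False by (simp add: lift_label_def l_def push_push_inv[OF u])
        qed simp
        moreover have "l b = v"
          using push_push_inv[OF v, of "inv_letter (True, path_component_of_set X (susp_x (f b)))"]
          by (simp add: l_def u_def)
        ultimately show ?thesis by blast
      qed
    qed
    then show "\<exists>d>0. \<forall>a b. a \<le> x \<and> x \<le> b \<and> b - a < d \<longrightarrow> 0 \<le> a \<longrightarrow> b \<le> 1 \<longrightarrow>
        (\<forall>v. reduced v \<longrightarrow> (\<exists>l. susp_lift X f l {a..b} \<and> l b = v))"
      using d(1) by (intro exI[of _ d]) blast
  qed simp
  then show thesis
    using v that by auto
qed

section \<open>Words read off from loops\<close>

lemma topspace_letter_space [simp]: "topspace (letter_space X) = UNIV \<times> topspace X"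
  by (auto simp: letter_space_def)

lemma openin_letter_space:
  "openin (letter_space X) U \<longleftrightarrow> U \<subseteq> UNIV \<times> topspace X \<and> (\<forall>b. openin X {x. (b, x) \<in> U})"
  by (auto simp: letter_space_def openin_sum_topology)

lemma continuous_map_letter: "continuous_map X (letter_space X) (Pair b)"
  unfolding letter_space_def by (rule continuous_map_component_injection) simp

lemma continuous_map_from_letter_space:
  "continuous_map (letter_space X) Y f \<longleftrightarrow> (\<forall>b. continuous_map X Y (\<lambda>x. f (b, x)))"
proof
  assume f: "continuous_map (letter_space X) Y f"
  show "\<forall>b. continuous_map X Y (\<lambda>x. f (b, x))"
    using continuous_map_compose[OF continuous_map_letter f] by (simp add: o_def)
next
  assume f: "\<forall>b. continuous_map X Y (\<lambda>x. f (b, x))"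
  have "openin (letter_space X) {l \<in> topspace (letter_space X). f l \<in> U}" if U: "openin Y U" for U
  proof -
    have "{x. (b, x) \<in> {l \<in> topspace (letter_space X). f l \<in> U}} = {x \<in> topspace X. f (b, x) \<in> U}" for b
      by auto
    then show ?thesis
      using f openin_continuous_map_preimage[OF _ U] unfolding openin_letter_space by auto
  qed
  moreover have "f \<in> topspace (letter_space X) \<rightarrow> topspace Y"
    using f by (auto simp: continuous_map_def)
  ultimately show "continuous_map (letter_space X) Y f"
    by (simp add: continuous_map_def)
qed

lemma continuous_map_snd_letter: "continuous_map (letter_space X) X snd"
  by (simp add: continuous_map_from_letter_space)

lemma openin_fst_letter: "openin (letter_space X) {l \<in> topspace (letter_space X). fst l \<in> B}"
proof -
  have "openin X {x. (b, x) \<in> {l \<in> topspace (letter_space X). fst l \<in> B}}" for b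
    by (cases "b \<in> B") simp_all
  then show ?thesis
    unfolding openin_letter_space by (simp add: subset_iff)
qed

lemma continuous_map_coordinatewise:
  assumes "\<And>i. i \<in> I \<Longrightarrow> continuous_map X Y (f i)"
  shows "continuous_map (product_topology (\<lambda>_. X) I) (product_topology (\<lambda>_. Y) I) (\<lambda>x. \<lambda>i\<in>I. f i (x i))"
  unfolding continuous_map_componentwise
proof (intro conjI ballI)
  fix i assume "i \<in> I"
  then show "continuous_map (product_topology (\<lambda>_. X) I) Y (\<lambda>x. (\<lambda>i\<in>I. f i (x i)) i)"
    using continuous_map_compose[OF continuous_map_product_projection[of i I "\<lambda>_. X"] assms] by (simp add: o_def)
qed auto

definition class_letter :: "'a topology \<Rightarrow> bool \<times> 'a \<Rightarrow> bool \<times> 'a set" where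
  "class_letter X = map_prod id (path_component_of_set X)"

abbreviation class_word :: "'a topology \<Rightarrow> 'a word \<Rightarrow> 'a set word" where
  "class_word X \<equiv> map (class_letter X)"

text \<open>Along the convex set the sign is locally constant, hence constant by connectedness, and
  the underlying point moves on a path.\<close>

lemma class_letter_path_eq:
  fixes S :: "real set"
  assumes g: "continuous_map (top_of_set S) (letter_space X) g" and S: "convex S"
    and ab: "a \<in> S" "b \<in> S"
  shows "class_letter X (g a) = class_letter X (g b)"
proof -
  have "path_component_of_set X (snd (g a)) = path_component_of_set X (snd (g b))"
    using path_component_of_convex_image[OF continuous_map_compose[OF g continuous_map_snd_letter] S ab] by simp
  moreover have "fst (g b) = fst (g a)"
  proof -
    have top: "g s \<in> topspace (letter_space X)" if "s \<in> S" for s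
      using continuous_map_image_subset_topspace[OF g] that by (simp add: image_subset_iff)
    have op: "openin (top_of_set S) {s \<in> S. fst (g s) \<in> B}" for B
    proof -
      have *: "{s \<in> S. fst (g s) \<in> B} =
          {s \<in> topspace (top_of_set S). g s \<in> {l \<in> topspace (letter_space X). fst l \<in> B}}"
        unfolding topspace_euclidean_subtopology
        by (intro Collect_cong conj_cong refl) (simp only: mem_Collect_eq top simp_thms)
      show ?thesis
        unfolding * by (rule openin_continuous_map_preimage[OF g openin_fst_letter])
    qed
    define C where "C = {s \<in> S. fst (g s) \<in> {fst (g a)}}"
    have "S - C = {s \<in> S. fst (g s) \<in> - {fst (g a)}}"
      by (auto simp: C_def)
    then have "openin (top_of_set S) C" "closedin (top_of_set S) C"
      using op[of "{fst (g a)}"] op[of "- {fst (g a)}"] by (auto simp: closedin_def C_def)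
    then have "C = {} \<or> C = S"
      using convex_connected[OF S] by (simp add: connected_clopen)
    moreover have "a \<in> C"
      using ab by (simp add: C_def)
    ultimately have "b \<in> C"
      using ab by blast
    then show ?thesis
      by (simp add: C_def)
  qed
  ultimately show ?thesis
    by (simp add: class_letter_def map_prod_def case_prod_unfold)
qed

abbreviation susp_loops :: "'a topology \<Rightarrow> (real \<Rightarrow> ('a option \<times> real) set) set" where
  "susp_loops X \<equiv> loops (suspension_plus X) (suspension_base X)"

abbreviation susp_loop_space :: "'a topology \<Rightarrow> (real \<Rightarrow> ('a option \<times> real) set) topology" where
  "susp_loop_space X \<equiv> loop_space (suspension_plus X) (suspension_base X)"

text \<open>Near a given loop, the word read off from a loop has constant length and letters that depend
  continuously on the loop. This makes the word both a homotopy invariant and a quotient map.\<close>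

definition near_word :: "'a topology \<Rightarrow> (real \<Rightarrow> ('a option \<times> real) set) \<Rightarrow>
    ((real \<Rightarrow> ('a option \<times> real) set) \<Rightarrow> 'a word \<Rightarrow> bool) \<Rightarrow> bool" where
  "near_word X f R \<longleftrightarrow> (\<exists>N ws. openin (susp_loop_space X) N \<and> f \<in> N \<and>
     (\<forall>w\<in>set ws. continuous_map (subtopology (susp_loop_space X) N) (letter_space X) w) \<and>
     (\<forall>g\<in>N. R g (map (\<lambda>w. w g) ws)))"

lemma near_wordE:
  assumes "near_word X f R"
  obtains N ws where "openin (susp_loop_space X) N" "f \<in> N"
    "\<And>w. w \<in> set ws \<Longrightarrow> continuous_map (subtopology (susp_loop_space X) N) (letter_space X) w"
    "\<And>g. g \<in> N \<Longrightarrow> R g (map (\<lambda>w. w g) ws)"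
  using assms unfolding near_word_def by blast

lemma near_word_append:
  assumes "near_word X f R1" "near_word X f R2"
    and R: "\<And>g u v. g \<in> susp_loops X \<Longrightarrow> R1 g u \<Longrightarrow> R2 g v \<Longrightarrow> R g (u @ v)"
  shows "near_word X f R"
proof -
  obtain N us where N: "openin (susp_loop_space X) N" "f \<in> N"
      "\<And>w. w \<in> set us \<Longrightarrow> continuous_map (subtopology (susp_loop_space X) N) (letter_space X) w"
      "\<And>g. g \<in> N \<Longrightarrow> R1 g (map (\<lambda>w. w g) us)"
    using assms(1) unfolding near_word_def by blast
  obtain M vs where M: "openin (susp_loop_space X) M" "f \<in> M"
      "\<And>w. w \<in> set vs \<Longrightarrow> continuous_map (subtopology (susp_loop_space X) M) (letter_space X) w"
      "\<And>g. g \<in> M \<Longrightarrow> R2 g (map (\<lambda>w. w g) vs)"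
    using assms(2) unfolding near_word_def by blast
  have "continuous_map (subtopology (susp_loop_space X) (N \<inter> M)) (letter_space X) w" if "w \<in> set (us @ vs)" for w
    using that N(3)[of w] M(3)[of w] by (auto intro: continuous_map_from_subtopology_mono)
  moreover have "R g (map (\<lambda>w. w g) (us @ vs))" if "g \<in> N \<inter> M" for g
    using that N M openin_subset[OF N(1)] by (auto intro!: R)
  ultimately show ?thesis
    unfolding near_word_def using openin_Int[OF N(1) M(1)] N(2) M(2) by blast
qed

text \<open>A relation and not a function, since many words in \<open>X\<close> describe the same
  transport: letters may be moved within their path component and cancelling pairs may be inserted.
  One word has to serve all lifts.\<close>

definition transport_word :: "'a topology \<Rightarrow> real \<Rightarrow> bool \<Rightarrow> real \<Rightarrow> bool \<Rightarrow>
    (real \<Rightarrow> ('a option \<times> real) set) \<Rightarrow> 'a word \<Rightarrow> bool" where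
  "transport_word X a c b d f w \<longleftrightarrow> (\<forall>l. susp_lift X f l {a..b} \<longrightarrow>
     lift_label X f l c a = foldr push_letter (class_word X w) (lift_label X f l d b))"

lemma near_word_transport_trans:
  assumes "near_word X f (transport_word X a i b j)" "near_word X f (transport_word X b j c k)"
    and "a \<le> b" "b \<le> c"
  shows "near_word X f (transport_word X a i c k)"
proof (rule near_word_append[OF assms(1,2)])
  fix g u v assume uv: "transport_word X a i b j g u" "transport_word X b j c k g v"
  have "susp_lift X g l {a..b}" "susp_lift X g l {b..c}" if "susp_lift X g l {a..c}" for l
    using that assms(3,4) by (auto elim: susp_lift_subset)
  then show "transport_word X a i c k g (u @ v)"
    using uv unfolding transport_word_def by simp
qed

lemma loops_subset_chart_open:
  assumes "0 \<le> a" "b \<le> 1"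
  shows "openin (susp_loop_space X) {g \<in> susp_loops X. g ` {a..b} \<subseteq> susp_chart X c}"
  using assms by (intro openin_loop_space openin_susp_chart)
    (auto simp: compactin_subtopology)

text \<open>Loops near \<open>f\<close> stay in the chart over the compact interval, so the empty
  word serves all of them.\<close>

lemma near_word_transport_const:
  assumes f: "f \<in> susp_loops X" "f ` {a..b} \<subseteq> susp_chart X c" and ab: "0 \<le> a" "a \<le> b" "b \<le> 1"
  shows "near_word X f (transport_word X a c b c)"
  unfolding near_word_def
proof (intro exI conjI ballI)
  let ?N = "{g \<in> susp_loops X. g ` {a..b} \<subseteq> susp_chart X c}"
  show "openin (susp_loop_space X) ?N"
    using ab by (intro loops_subset_chart_open)
  show "f \<in> ?N" using f by simp
  fix g assume "g \<in> ?N"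
  then show "transport_word X a c b c g (map (\<lambda>w. w g) [])"
    using lift_label_const[where S = "{a..b}" and f = g and c = c and X = X and a = a and b = b] ab
    unfolding transport_word_def by auto
qed simp

text \<open>The labels of the two charts differ only above level 1/2, and there by the letter given
  by the \<open>X\<close>-coordinate at time \<open>t\<close>. This coordinate is continuous in the
  loop, as evaluation at \<open>t\<close> is continuous for the compact-open topology.\<close>

lemma near_word_transport_change:
  assumes f: "f \<in> susp_loops X" "f t \<in> susp_chart X c" "f t \<in> susp_chart X d" and t: "0 \<le> t" "t \<le> 1"
  shows "near_word X f (transport_word X t c t d)"
proof (cases "c = d")
  case True
  then show ?thesis
    using near_word_transport_const[of f X t t c] assms by simp
next
  case False
  have both: "f t \<in> susp_chart X True" "f t \<in> susp_chart X False"
    using f False by (cases c; cases d; simp)+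
  have ft: "susp_t (f t) \<noteq> 1/2"
    using susp_chart_interiorD[OF both(2)] both(1) susp_pt_in_chart(2) by metis
  have red: "reduced (l t)" if "susp_lift X g l {t..t}" for g l
    using that by (simp add: susp_lift_def)
  define U where "U T = {z \<in> susp_chart X False. susp_x z \<in> topspace X \<and> susp_t z \<in> T}" for T
  define N where "N T = {g \<in> susp_loops X. g ` {t} \<subseteq> U T}" for T
  have N: "openin (susp_loop_space X) (N T)" if "open T" for T
    unfolding N_def U_def using t that by (intro openin_loop_space openin_susp_interior) auto
  have fN: "f \<in> N T" if "susp_t (f t) \<in> T" for T
    using f both that susp_chart_interiorD(1)[OF both(2)] by (simp add: N_def U_def)
  have Nd: "g \<in> susp_loops X" "g t \<in> susp_chart X False" "susp_t (g t) \<in> T" if "g \<in> N T" for g T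
    using that by (auto simp: N_def U_def)
  have cont: "continuous_map (subtopology (susp_loop_space X) (N T)) (letter_space X) (\<lambda>g. (e, susp_x (g t)))" for T e
  proof -
    have "continuous_map (subtopology (susp_loop_space X) (N T))
        (subtopology (suspension_plus X) (susp_chart X False)) (\<lambda>g. g t)"
      using continuous_map_from_subtopology[OF continuous_map_loop_eval, of t] t Nd(2)
      by (auto simp: continuous_map_in_subtopology)
    from continuous_map_compose[OF continuous_map_compose[OF this continuous_map_susp_coords(1)] continuous_map_letter]
    show ?thesis
      by (simp add: o_def)
  qed
  show ?thesis
  proof (cases "susp_t (f t) \<le> 1/2")
    case True
    show ?thesis
      unfolding near_word_def
    proof (intro exI conjI ballI)
      show "openin (susp_loop_space X) (N {..<1/2})" "f \<in> N {..<1/2}"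
        using N fN True ft by auto
      fix g assume "g \<in> N {..<1/2}"
      then show "transport_word X t c t d g (map (\<lambda>w. w g) [])"
        using Nd(3)[OF \<open>g \<in> N {..<1/2}\<close>] unfolding transport_word_def by (simp add: lift_label_def)
    qed simp
  next
    case gt: False
    show ?thesis
      unfolding near_word_def
    proof (intro exI conjI ballI)
      show "openin (susp_loop_space X) (N {1/2<..})" "f \<in> N {1/2<..}"
        using N fN gt by auto
      fix g assume g: "g \<in> N {1/2<..}"
      \<comment> \<open>The sign is the chart \<open>d\<close> at the far end: the label in the
        chart \<open>False\<close> arises from the one in the chart \<open>True\<close> by a
        positive letter, and conversely by the inverse letter.\<close>
      show "transport_word X t c t d g (map (\<lambda>w. w g) [\<lambda>g. (d, susp_x (g t))])"
        unfolding transport_word_def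
      proof (intro allI impI)
        fix l assume "susp_lift X g l {t..t}"
        from red[OF this] show "lift_label X g l c t =
            foldr push_letter (class_word X (map (\<lambda>w. w g) [\<lambda>g. (d, susp_x (g t))])) (lift_label X g l d t)"
          using Nd(3)[OF g] \<open>c \<noteq> d\<close> push_push_inv[of "l t" "(False, path_component_of_set X (susp_x (g t)))"]
          by (cases c; cases d) (simp_all add: lift_label_def class_letter_def inv_letter_def)
      qed
    qed (use cont in simp)
  qed
qed

lemma near_word_transport:
  assumes f: "f \<in> susp_loops X"
  shows "near_word X f (transport_word X 0 True 1 True)"
proof -
  have f': "pathin (suspension_plus X) f" "f 0 = suspension_base X" "f 1 = suspension_base X"
    using f by (auto simp: loops_def)
  have ftop: "f k \<in> topspace (suspension_plus X)" if "k \<in> {0..1}" for k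
    using f'(1) that by (auto simp: pathin_def continuous_map_def)
  have "0 \<le> (0::real) \<longrightarrow> 1 \<le> (1::real) \<longrightarrow> (\<forall>c d. f 0 \<in> susp_chart X c \<longrightarrow> f 1 \<in> susp_chart X d \<longrightarrow>
      near_word X f (transport_word X 0 c 1 d))"
  \<comment> \<open>Quantifying over the charts at both ends makes the property additive: at the
    common point of two intervals any chart containing it will do. The basepoint lies in the chart
    \<open>True\<close> only, so the ends of the loop leave no choice.\<close>
  proof (rule Bolzano[where P = "\<lambda>a b. 0 \<le> a \<longrightarrow> b \<le> 1 \<longrightarrow> (\<forall>c d. f a \<in> susp_chart X c \<longrightarrow>
        f b \<in> susp_chart X d \<longrightarrow> near_word X f (transport_word X a c b d))"])
    fix a b c :: real
    assume ab: "0 \<le> a \<longrightarrow> b \<le> 1 \<longrightarrow> (\<forall>c d. f a \<in> susp_chart X c \<longrightarrow>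
        f b \<in> susp_chart X d \<longrightarrow> near_word X f (transport_word X a c b d))"
      and bc: "0 \<le> b \<longrightarrow> c \<le> 1 \<longrightarrow> (\<forall>i d. f b \<in> susp_chart X i \<longrightarrow>
        f c \<in> susp_chart X d \<longrightarrow> near_word X f (transport_word X b i c d))"
      and le: "a \<le> b" "b \<le> c"
    show "0 \<le> a \<longrightarrow> c \<le> 1 \<longrightarrow> (\<forall>i d. f a \<in> susp_chart X i \<longrightarrow>
        f c \<in> susp_chart X d \<longrightarrow> near_word X f (transport_word X a i c d))"
    proof (intro impI allI)
      fix i d assume *: "0 \<le> a" "c \<le> 1" "f a \<in> susp_chart X i" "f c \<in> susp_chart X d"
      obtain j where "f b \<in> susp_chart X j"
        using susp_chart_cover[OF ftop[of b]] * le by auto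
      with * le ab bc show "near_word X f (transport_word X a i c d)"
        by (intro near_word_transport_trans[of X f a i b j c d]) auto
    qed
  next
    fix x :: real assume x: "0 \<le> x" "x \<le> 1"
    then obtain e c where e: "e > 0" "\<And>k. k \<in> {0..1} \<Longrightarrow> dist k x < e \<Longrightarrow> f k \<in> susp_chart X c"
      using path_locally_in_chart[OF f'(1), of x] by auto
    have "near_word X f (transport_word X a i b d)"
      if ab: "a \<le> x" "x \<le> b" "b - a < e" "0 \<le> a" "b \<le> 1"
        and i: "f a \<in> susp_chart X i" and d: "f b \<in> susp_chart X d" for a b i d
    proof -
      have chart: "f ` {a..b} \<subseteq> susp_chart X c"
        using e(2) ab by (auto simp: dist_real_def)
      then have "f a \<in> susp_chart X c" "f b \<in> susp_chart X c"
        using ab by auto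
      then have "near_word X f (transport_word X a i a c)" "near_word X f (transport_word X b c b d)"
        using near_word_transport_change[OF f] i d ab by auto
      moreover have "near_word X f (transport_word X a c b c)"
        using near_word_transport_const[OF f chart] ab by simp
      ultimately show ?thesis
        using ab by (meson near_word_transport_trans order.refl order.trans)
    qed
    then show "\<exists>d>0. \<forall>a b. a \<le> x \<and> x \<le> b \<and> b - a < d \<longrightarrow> 0 \<le> a \<longrightarrow> b \<le> 1 \<longrightarrow>
        (\<forall>c d. f a \<in> susp_chart X c \<longrightarrow> f b \<in> susp_chart X d \<longrightarrow> near_word X f (transport_word X a c b d))"
      using e(1) by (intro exI[of _ e]) blast
  qed simp
  then show ?thesis
    using f' by simp
qed

text \<open>The left label of some lift with right label \<open>[]\<close>. Independence of the
  choice is contained in \<open>susp_word_transport\<close>, because one transport word is valid for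
  all lifts.\<close>

definition susp_word :: "'a topology \<Rightarrow> (real \<Rightarrow> ('a option \<times> real) set) \<Rightarrow> 'a set word" where
  "susp_word X f = (SOME l. susp_lift X f l {0..1} \<and> l 1 = []) 0"

lemma susp_word_transport:
  assumes f: "f \<in> susp_loops X" and w: "transport_word X 0 True 1 True f w"
  shows "susp_word X f = reduce (class_word X w)"
proof -
  have "pathin (suspension_plus X) f"
    using f by (simp add: loops_def)
  then have "\<exists>l. susp_lift X f l {0..1} \<and> l 1 = []"
    using susp_lift_exists[of X f "[]"] by (metis reduced.simps(2))
  then have l: "susp_lift X f (SOME l. susp_lift X f l {0..1} \<and> l 1 = []) {0..1} \<and>
      (SOME l. susp_lift X f l {0..1} \<and> l 1 = []) 1 = []"
    by (rule someI_ex)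
  define m where "m = (SOME l. susp_lift X f l {0..1} \<and> l 1 = [])"
  have "lift_label X f m True 0 = foldr push_letter (class_word X w) (lift_label X f m True 1)"
    using w l[folded m_def] unfolding transport_word_def by blast
  then show ?thesis
    using l[folded m_def] unfolding susp_word_def m_def[symmetric] by (simp add: reduce_def)
qed

lemma near_word_susp_word:
  assumes "f \<in> susp_loops X"
  shows "near_word X f (\<lambda>g w. susp_word X g = reduce (class_word X w))"
proof -
  obtain N ws where N: "openin (susp_loop_space X) N" "f \<in> N"
      "\<forall>w\<in>set ws. continuous_map (subtopology (susp_loop_space X) N) (letter_space X) w"
      "\<forall>g\<in>N. transport_word X 0 True 1 True g (map (\<lambda>w. w g) ws)"
    using near_word_transport[OF assms] unfolding near_word_def by blast
  moreover have "susp_word X g = reduce (class_word X (map (\<lambda>w. w g) ws))" if "g \<in> N" for g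
    using susp_word_transport[OF _ bspec[OF N(4) that]] that openin_subset[OF N(1)] by auto
  ultimately show ?thesis
    unfolding near_word_def by blast
qed

text \<open>The right label \<open>[]\<close> in \<open>susp_word\<close> is only a normalization:
  the same left multiplication relates the end labels of every lift. This is what computes the word
  of a concatenation.\<close>

lemma susp_word_lift:
  assumes f: "f \<in> susp_loops X" and l: "susp_lift X f l {0..1}"
  shows "l 0 = reduce (susp_word X f @ l 1)"
proof -
  obtain w where w: "transport_word X 0 True 1 True f w"
    using near_word_transport[OF f] unfolding near_word_def by blast
  have "reduced (l 1)"
    using l by (simp add: susp_lift_def)
  moreover have "lift_label X f l True 0 = foldr push_letter (class_word X w) (lift_label X f l True 1)"
    using w l unfolding transport_word_def by blast
  ultimately show ?thesis
    using susp_word_transport[OF f w] by (simp add: reduce_append foldr_push_reduce)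
qed

lemma susp_word_in_carrier:
  assumes f: "f \<in> susp_loops X"
  shows "susp_word X f \<in> carrier (free_group (topspace (pi0_top X)))"
proof -
  obtain N ws where N: "openin (susp_loop_space X) N" "f \<in> N"
      "\<forall>w\<in>set ws. continuous_map (subtopology (susp_loop_space X) N) (letter_space X) w"
      "\<forall>g\<in>N. susp_word X g = reduce (class_word X (map (\<lambda>w. w g) ws))"
    using near_word_susp_word[OF f] unfolding near_word_def by blast
  have "w f \<in> UNIV \<times> topspace X" if "w \<in> set ws" for w
  proof -
    have "w ` topspace (subtopology (susp_loop_space X) N) \<subseteq> topspace (letter_space X)"
      using N(3) that by (intro continuous_map_image_subset_topspace) blast
    moreover have "f \<in> topspace (subtopology (susp_loop_space X) N)"
      using N(2) f by simp
    ultimately show ?thesis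
      by (metis image_subset_iff topspace_letter_space)
  qed
  then have "set (class_word X (map (\<lambda>w. w f) ws)) \<subseteq> UNIV \<times> topspace (pi0_top X)"
    by (force simp: class_letter_def pi0_top_def)
  then have "set (susp_word X f) \<subseteq> UNIV \<times> topspace (pi0_top X)" "reduced (susp_word X f)"
    using N(2,4) set_reduce[of "class_word X (map (\<lambda>w. w f) ws)"] by auto
  then show ?thesis
    by (simp add: free_group_def)
qed

text \<open>A homotopy is a path in the loop space. Near each of its times the word is given by
  finitely many letters continuous in that time, and the classes of such letters are constant by
  \<open>class_letter_path_eq\<close>. So the word is locally constant on a connected
  interval.\<close>

lemma susp_word_homotopic:
  assumes fg: "f \<in> susp_loops X" "g \<in> susp_loops X" and h: "path_homotopic (suspension_plus X) f g"
  shows "susp_word X f = susp_word X g"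
proof -
  obtain h where h: "continuous_map (prod_topology (top_of_set {0..1::real}) unit_interval) (suspension_plus X) h"
      "\<forall>t. h (0, t) = f t" "\<forall>t. h (1, t) = g t"
      "\<forall>s\<in>{0..1}. h (s, 0) = f 0 \<and> h (s, 1) = f 1"
    using h by (rule path_homotopicE)
  define H where "H s = (\<lambda>t\<in>{0..1}. h (s, t))" for s :: real
  have H: "continuous_map unit_interval (susp_loop_space X) H"
    unfolding H_def[abs_def]
    by (rule continuous_map_curry_loop[OF h(1)]) (use h(4) fg in \<open>simp add: loops_def\<close>)
  have "susp_word X (H 0) = susp_word X (H 1)"
  proof (rule connected_local_const[of "{0..1::real}"])
    show "\<forall>s\<in>{0..1}. \<forall>\<^sub>F s' in at s within {0..1}. susp_word X (H s) = susp_word X (H s')"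
    proof
      fix s :: real assume s: "s \<in> {0..1}"
      have "H s \<in> topspace (susp_loop_space X)"
        by (rule funcset_mem[OF continuous_map_funspace[OF H]]) (use s in simp)
      then have "H s \<in> susp_loops X"
        by simp
      from near_word_susp_word[OF this] obtain N ws where
        N: "openin (susp_loop_space X) N" "H s \<in> N"
        "\<And>w. w \<in> set ws \<Longrightarrow> continuous_map (subtopology (susp_loop_space X) N) (letter_space X) w"
        "\<And>g. g \<in> N \<Longrightarrow> susp_word X g = reduce (class_word X (map (\<lambda>w. w g) ws))"
        by (rule near_wordE) blast
      have "openin unit_interval {s \<in> topspace unit_interval. H s \<in> N}"
        using openin_continuous_map_preimage[OF H N(1)] .
      then have "\<exists>e>0. \<forall>s'\<in>{0..1}. dist s' s < e \<longrightarrow> H s' \<in> N"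
        using s N(2) unfolding openin_euclidean_subtopology_iff by simp
      then obtain e where e: "e > 0" "\<And>s'. s' \<in> {0..1} \<Longrightarrow> dist s' s < e \<Longrightarrow> H s' \<in> N"
        by blast
      have "susp_word X (H s) = susp_word X (H s')" if s': "s' \<in> {0..1}" "dist s' s < e" for s'
      proof -
        let ?S = "{0..1} \<inter> ball s e"
        have "continuous_map (top_of_set ?S) (susp_loop_space X) H"
          using continuous_map_from_subtopology[OF H, of "ball s e"] by (simp add: subtopology_subtopology)
        then have *: "continuous_map (top_of_set ?S) (subtopology (susp_loop_space X) N) H"
          using e(2) by (simp add: continuous_map_in_subtopology Pi_iff dist_commute)
        have "class_letter X (w (H s)) = class_letter X (w (H s'))" if "w \<in> set ws" for w
        proof -
          have "continuous_map (top_of_set ?S) (letter_space X) (w \<circ> H)"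
            by (rule continuous_map_compose[OF * N(3)[OF that]])
          from class_letter_path_eq[OF this, of s s'] show ?thesis
            using s s' e(1) by (simp add: convex_Int dist_commute)
        qed
        then have "class_word X (map (\<lambda>w. w (H s)) ws) = class_word X (map (\<lambda>w. w (H s')) ws)"
          by simp
        then show ?thesis
          unfolding N(4)[OF N(2)] N(4)[OF e(2)[OF s']] by (rule arg_cong)
      qed
      then show "\<forall>\<^sub>F s' in at s within {0..1}. susp_word X (H s) = susp_word X (H s')"
        unfolding eventually_at by (intro exI[of _ e] conjI e(1) ballI impI) blast
    qed
  qed simp_all
  moreover have "H 0 = f" "H 1 = g"
    using fg h(2,3) by (simp_all add: H_def loops_def extensional_restrict)
  ultimately show ?thesis
    by simp
qed

text \<open>A single lift of the concatenation, cut at 1/2, gives lifts of both factors; the label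
  at 1/2 links their words.\<close>

lemma susp_word_concat:
  assumes f: "f \<in> susp_loops X" and g: "g \<in> susp_loops X"
  shows "susp_word X (loop_concat f g) = reduce (susp_word X f @ susp_word X g)"
proof -
  let ?h = "loop_concat f g"
  have h: "?h \<in> susp_loops X"
    using loop_concat_in_loops[OF f g] .
  then obtain l where l: "susp_lift X ?h l {0..1}" "l 1 = []"
    using susp_lift_exists[of X ?h "[]"] by (auto simp: loops_def)
  have "f 1 = g 0"
    using f g by (simp add: loops_def)
  have "susp_lift X f (l \<circ> (\<lambda>t. t / 2)) {0..1}"
    by (rule susp_lift_compose[OF l(1)]) (auto intro!: continuous_intros simp: loop_concat_def)
  moreover have "susp_lift X g (l \<circ> (\<lambda>t. (t + 1) / 2)) {0..1}"
  proof (rule susp_lift_compose[OF l(1)])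
    fix k :: real assume "k \<in> {0..1}"
    moreover have "2 * ((k + 1) / 2) - 1 = k"
      by (simp add: field_simps)
    \<comment> \<open>For \<open>k = 0\<close> the midpoint falls into the branch of
      \<open>f\<close>, whose end is the start of \<open>g\<close>.\<close>
    ultimately show "g k = loop_concat f g ((k + 1) / 2)"
      using \<open>f 1 = g 0\<close> by (cases "k = 0") (simp_all add: loop_concat_def)
  qed (auto intro!: continuous_intros)
  ultimately have "l 0 = reduce (susp_word X f @ l (1/2))" "l (1/2) = reduce (susp_word X g)"
    "l 0 = reduce (susp_word X ?h)"
    using susp_word_lift[OF f] susp_word_lift[OF g] susp_word_lift[OF h l(1)] l(2) by fastforce+
  moreover have "reduced (susp_word X ?h)"
    using susp_word_in_carrier[OF h] by (simp add: free_group_def)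
  ultimately show ?thesis
    by simp
qed

section \<open>Loops of words\<close>

definition susp_letter :: "'a topology \<Rightarrow> bool \<times> 'a \<Rightarrow> real \<Rightarrow> ('a option \<times> real) set" where
  "susp_letter X l t = susp_pt X (snd l) (if fst l then t else 1 - t)"

fun word_path :: "'a topology \<Rightarrow> 'a word \<Rightarrow> real \<Rightarrow> ('a option \<times> real) set" where
  "word_path X [] = (\<lambda>t. suspension_base X)"
| "word_path X (l # w) = path_join (susp_letter X l) (word_path X w)"

definition word_loop :: "'a topology \<Rightarrow> 'a word \<Rightarrow> real \<Rightarrow> ('a option \<times> real) set" where
  "word_loop X w = restrict (word_path X w) {0..1}"

lemma susp_letter_ends:
  assumes "snd l \<in> topspace X"
  shows "susp_letter X l 0 = suspension_base X" "susp_letter X l 1 = suspension_base X"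
  using assms by (simp_all add: susp_letter_def)

lemma word_path_ends:
  assumes "set w \<subseteq> UNIV \<times> topspace X"
  shows "word_path X w 0 = suspension_base X \<and> word_path X w 1 = suspension_base X"
  using assms
proof (induction w)
  case (Cons l w)
  then have "snd l \<in> topspace X" by (cases l) simp
  with Cons show ?case by (simp add: susp_letter_ends)
qed simp

lemma continuous_map_susp_letter:
  "continuous_map (prod_topology (letter_space X) unit_interval) (suspension_plus X)
     (\<lambda>p. susp_letter X (fst p) (snd p))"
proof -
  let ?A = "prod_topology (letter_space X) unit_interval"
  \<comment> \<open>The indicator of the positive copy is continuous because the two copies are
    disjoint open sets; it turns the case distinction on the sign into a polynomial
    expression.\<close>
  define u where "u l = (if fst l then 1 else 0 :: real)" for l :: "bool \<times> 'a"
  have "continuous_map (letter_space X) euclideanreal u"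
    by (simp add: continuous_map_from_letter_space u_def)
  from continuous_map_compose[OF continuous_map_fst this]
  have u: "continuous_map ?A euclideanreal (\<lambda>p. u (fst p))"
    by (simp add: o_def)
  have t: "continuous_map ?A euclideanreal snd"
    using continuous_map_snd continuous_map_into_fulltopology by blast
  have eq: "u (fst p) * snd p + (1 - u (fst p)) * (1 - snd p) = (if fst (fst p) then snd p else 1 - snd p)" for p
    by (simp add: u_def)
  have "continuous_map ?A euclideanreal (\<lambda>p. u (fst p) * snd p + (1 - u (fst p)) * (1 - snd p))"
    by (intro continuous_intros u t)
  then have g: "continuous_map ?A euclideanreal (\<lambda>p. if fst (fst p) then snd p else 1 - snd p)"
    unfolding eq .
  have "continuous_map ?A X (\<lambda>p. snd (fst p))"
    using continuous_map_compose[OF continuous_map_fst continuous_map_snd_letter] by (simp add: o_def)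
  from continuous_map_susp_pt_compose[OF this g] show ?thesis
    unfolding susp_letter_def by (auto simp: mem_Times_iff)
qed

lemma pathin_susp_letter:
  assumes "snd l \<in> topspace X"
  shows "pathin (suspension_plus X) (susp_letter X l)"
proof -
  have "continuous_map unit_interval (prod_topology (letter_space X) unit_interval) (\<lambda>t. (l, t))"
    using assms by (simp add: continuous_map_pairedI mem_Times_iff)
  from continuous_map_compose[OF this continuous_map_susp_letter] show ?thesis
    by (simp add: pathin_def o_def)
qed

lemma pathin_word_path:
  assumes "set w \<subseteq> UNIV \<times> topspace X"
  shows "pathin (suspension_plus X) (word_path X w)"
  using assms
proof (induction w)
  case (Cons l w)
  then have l: "snd l \<in> topspace X" by (cases l) simp
  have w: "set w \<subseteq> UNIV \<times> topspace X" using Cons.prems by simp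
  show ?case
    unfolding word_path.simps
    by (rule pathin_path_join[OF pathin_susp_letter[OF l] Cons.IH[OF w]])
      (simp add: susp_letter_ends[OF l] word_path_ends[OF w])
qed (simp add: pathin_def)

lemma restrict_in_loops:
  assumes "pathin Z f" "f 0 = z" "f 1 = z"
  shows "restrict f {0..1} \<in> loops Z z"
proof -
  have "pathin Z (restrict f {0..1})"
    using assms(1) unfolding pathin_def by (rule continuous_map_eq) simp
  then show ?thesis
    using assms(2,3) by (simp add: loops_def)
qed

lemma word_loop_in_loops:
  "set w \<subseteq> UNIV \<times> topspace X \<Longrightarrow> word_loop X w \<in> susp_loops X"
  unfolding word_loop_def by (simp add: restrict_in_loops pathin_word_path word_path_ends)

lemma loop_concat_restrict:
  "loop_concat (restrict f {0..1}) (restrict g {0..1}) = restrict (path_join f g) {0..1}"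
  unfolding loop_concat_def path_join_def by (rule restrict_ext) simp

lemma susp_word_eqI:
  assumes "f \<in> susp_loops X" "susp_lift X f l {0..1}" "l 1 = []"
  shows "susp_word X f = l 0"
proof -
  have "reduced (susp_word X f)"
    using susp_word_in_carrier[OF assms(1)] by (simp add: free_group_def)
  then show ?thesis
    using susp_word_lift[OF assms(1,2)] assms(3) by simp
qed

lemma susp_word_const: "susp_word X (\<lambda>t\<in>{0..1}. suspension_base X) = []"
proof -
  have loop: "(\<lambda>t\<in>{0..1}. suspension_base X) \<in> susp_loops X"
    using word_loop_in_loops[of "[]" X] by (simp add: word_loop_def)
  have "susp_lift X (\<lambda>t\<in>{0..1}. suspension_base X) (\<lambda>_. []) {0..1}"
  proof (rule susp_lift_one_chart)
    show "continuous_map unit_interval (suspension_plus X) (\<lambda>t\<in>{0..1}. suspension_base X)"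
      using loop by (simp add: loops_def pathin_def)
    show "(\<lambda>t\<in>{0..1}. suspension_base X) ` {0..1} \<subseteq> susp_chart X True"
      by (simp add: image_subset_iff)
  qed simp_all
  from susp_word_eqI[OF loop this] show ?thesis
    by simp
qed

text \<open>The lift can be written down: it jumps once, when the vertical line crosses level
  1/2.\<close>

lemma susp_word_letter:
  assumes x: "x \<in> topspace X"
  shows "susp_word X (restrict (susp_letter X (b, x)) {0..1}) = [(b, path_component_of_set X x)]"
proof -
  let ?f = "restrict (susp_letter X (b, x)) {0..1}"
  let ?c = "path_component_of_set X x"
  \<comment> \<open>The value at the jump is dictated by the chart \<open>False\<close>, where the
    label must be constant. Level 1/2 counts as lower half, so at \<open>k = 1/2\<close> an upward
    line still carries its letter and a downward line no longer does.\<close>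
  define l where "l k = (if k < 1/2 \<or> b \<and> k = 1/2 then [(b, ?c)] else [])" for k :: real
  have loop: "?f \<in> susp_loops X"
    using x by (intro restrict_in_loops pathin_susp_letter) (simp_all add: susp_letter_ends)
  have f: "?f k = susp_pt X x (if b then k else 1 - k)" if "k \<in> {0..1}" for k
    using that by (simp add: susp_letter_def)
  have lab: "lift_label X ?f l False k = (if b then [(True, ?c)] else [])" if "0 < k" "k < 1" for k
  proof -
    have "susp_t (?f k) = (if b then k else 1 - k)" "susp_x (?f k) = x"
      unfolding f[OF atLeastAtMost_iff[THEN iffD2, OF conjI[OF less_imp_le[OF that(1)] less_imp_le[OF that(2)]]]]
      using that by (cases b; simp)+
    then have *: "lift_label X ?f l False k = (if (if b then k else 1 - k) \<le> 1/2 then l k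
        else push_letter (True, ?c) (l k))"
      unfolding lift_label_def by (simp only: simp_thms)
    consider "k < 1/2" | "k = 1/2" | "1/2 < k" by linarith
    then show ?thesis
    proof cases
      case 1
      then have "l k = [(b, ?c)]" "(if b then k else 1 - k) \<le> 1/2 \<longleftrightarrow> b"
        by (simp_all add: l_def)
      then show ?thesis
        unfolding * by (cases b) (simp_all add: inv_letter_def)
    next
      case 2
      then have "l k = (if b then [(True, ?c)] else [])" "(if b then k else 1 - k) \<le> 1/2"
        by (simp_all add: l_def)
      then show ?thesis
        unfolding * by (simp only: if_True)
    next
      case 3
      then have "l k = []" "(if b then k else 1 - k) \<le> 1/2 \<longleftrightarrow> \<not> b"
        by (simp_all add: l_def)
      then show ?thesis
        unfolding * by (cases b) simp_all
    qed
  qed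
  have "susp_lift X ?f l {0..1}"
    unfolding susp_lift_def
  proof (intro ballI conjI allI impI)
    fix k :: real assume k: "k \<in> {0..1}"
    show "reduced (l k)"
      by (simp add: l_def)
    fix i assume i: "?f k \<in> susp_chart X i"
    show "\<exists>e>0. \<forall>k'\<in>{0..1}. dist k' k < e \<longrightarrow> lift_label X ?f l i k' = lift_label X ?f l i k"
    proof (cases i)
      case True
      have "k \<noteq> 1/2"
      proof
        assume "k = 1/2"
        then have r: "(if b then k else 1 - k) = 1/2"
          by (cases b) simp_all
        have "?f k = susp_pt X x (1/2)"
          unfolding f[OF k] r ..
        then show False
          using i True susp_pt_in_chart(2)[OF x, of "1/2"] by simp
      qed
      have l: "l k' = l k" if "dist k' k < \<bar>k - 1/2\<bar>" for k'
        using that by (auto simp: l_def dist_real_def)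
      have "i = True" using True by simp
      show ?thesis
        unfolding \<open>i = True\<close> lift_label_True
      proof (intro exI[of _ "\<bar>k - 1/2\<bar>"] conjI ballI impI l)
        show "0 < \<bar>k - 1/2\<bar>" using \<open>k \<noteq> 1/2\<close> by simp
      qed
    next
      case False
      have "?f 0 = suspension_base X" "?f 1 = suspension_base X"
        using susp_letter_ends[of "(b, x)" X] x by simp_all
      then have "k \<noteq> 0" "k \<noteq> 1"
        using i False susp_base_in_chart(2)[of X] by metis+
      then have k01: "0 < k" "k < 1"
        using k by auto
      have "0 < k'" "k' < 1" if "dist k' k < min k (1 - k)" for k'
        using that by (auto simp: dist_real_def)
      then have *: "lift_label X ?f l False k' = lift_label X ?f l False k" if "dist k' k < min k (1 - k)" for k'
        using that lab[OF k01] lab by metis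
      have "i = False" using False by simp
      have "0 < min k (1 - k)" using k01 by simp
      then show ?thesis
        unfolding \<open>i = False\<close> by (intro exI[of _ "min k (1 - k)"] conjI ballI impI *)
    qed
  qed
  from susp_word_eqI[OF loop this] show ?thesis
    by (simp add: l_def)
qed

lemma susp_word_word_loop:
  assumes "set w \<subseteq> UNIV \<times> topspace X"
  shows "susp_word X (word_loop X w) = reduce (class_word X w)"
  using assms
proof (induction w)
  case Nil
  then show ?case
    unfolding word_loop_def word_path.simps susp_word_const by (simp add: reduce_def)
next
  case (Cons l w)
  obtain b x where l: "l = (b, x)" by (cases l)
  have x: "x \<in> topspace X" and w: "set w \<subseteq> UNIV \<times> topspace X"
    using Cons.prems l by simp_all
  have loop: "restrict (susp_letter X (b, x)) {0..1} \<in> susp_loops X"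
    using x by (intro restrict_in_loops pathin_susp_letter) (simp_all add: susp_letter_ends)
  have "word_loop X (l # w) = loop_concat (restrict (susp_letter X (b, x)) {0..1}) (word_loop X w)"
    unfolding word_loop_def word_path.simps l by (rule loop_concat_restrict[symmetric])
  then have "susp_word X (word_loop X (l # w)) = reduce ([(b, path_component_of_set X x)] @ reduce (class_word X w))"
    using susp_word_concat[OF loop word_loop_in_loops[OF w]] susp_word_letter[OF x] Cons.IH[OF w] by metis
  also have "\<dots> = reduce ([(b, path_component_of_set X x)] @ class_word X w)"
    by (simp only: reduce_append_reduce_right)
  finally show ?case
    by (simp add: l class_letter_def)
qed

lemma continuous_map_word_path:
  assumes "\<And>w. w \<in> set ws \<Longrightarrow> continuous_map A (letter_space X) w"
  shows "continuous_map (prod_topology A unit_interval) (suspension_plus X)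
    (\<lambda>p. word_path X (map (\<lambda>w. w (fst p)) ws) (snd p))"
  using assms
proof (induction ws)
  case (Cons w ws)
  have w: "continuous_map A (letter_space X) w" and ws: "\<And>w. w \<in> set ws \<Longrightarrow> continuous_map A (letter_space X) w"
    using Cons.prems by simp_all
  have top: "w a \<in> UNIV \<times> topspace X" "set (map (\<lambda>w. w a) ws) \<subseteq> UNIV \<times> topspace X" if "a \<in> topspace A" for a
  proof -
    show "w a \<in> UNIV \<times> topspace X"
      using funcset_mem[OF continuous_map_funspace[OF w] that] by simp
    have "v a \<in> UNIV \<times> topspace X" if "v \<in> set ws" for v
      using funcset_mem[OF continuous_map_funspace[OF ws[OF that]] \<open>a \<in> topspace A\<close>] by simp
    then show "set (map (\<lambda>w. w a) ws) \<subseteq> UNIV \<times> topspace X"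
      unfolding set_map by (rule image_subsetI)
  qed
  have "continuous_map (prod_topology A unit_interval) (prod_topology (letter_space X) unit_interval)
      (\<lambda>p. (w (fst p), snd p))"
    using continuous_map_compose[OF continuous_map_fst w]
    by (simp add: continuous_map_paired continuous_map_snd o_def)
  from continuous_map_compose[OF this continuous_map_susp_letter]
  have F: "continuous_map (prod_topology A unit_interval) (suspension_plus X) (\<lambda>p. susp_letter X (w (fst p)) (snd p))"
    by (simp add: o_def)
  have "susp_letter X (w (fst (a, 1::real))) (snd (a, 1)) =
      word_path X (map (\<lambda>w. w (fst (a, 0::real))) ws) (snd (a, 0))" if "a \<in> topspace A" for a
    using word_path_ends[OF top(2)[OF that]] susp_letter_ends(2)[of "w a" X] top(1)[OF that]
    by (simp add: mem_Times_iff)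
  from continuous_map_path_join[OF F Cons.IH[OF ws] this] show ?case
    by (simp add: path_join_def case_prod_unfold cong: if_cong)
qed simp

lemma set_map_letters:
  assumes "x \<in> topspace (product_topology (\<lambda>_. letter_space X) {..<n})"
  shows "set (map x [0..<n]) \<subseteq> UNIV \<times> topspace X"
  unfolding set_map
proof (rule image_subsetI)
  fix i assume "i \<in> set [0..<n]"
  then show "x i \<in> UNIV \<times> topspace X"
    using assms PiE_mem[of x "{..<n}" "\<lambda>_. UNIV \<times> topspace X" i] by simp
qed

lemma continuous_map_word_loop:
  "continuous_map (product_topology (\<lambda>_. letter_space X) {..<n}) (susp_loop_space X)
     (\<lambda>x. word_loop X (map x [0..<n]))"
proof -
  let ?A = "product_topology (\<lambda>_. letter_space X) {..<n}"
  let ?ws = "map (\<lambda>i x. x i) [0..<n]"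
  have *: "continuous_map ?A (letter_space X) w" if "w \<in> set ?ws" for w
    using that continuous_map_product_projection[of _ "{..<n}" "\<lambda>_. letter_space X"] by auto
  have c: "continuous_map (prod_topology ?A unit_interval) (suspension_plus X)
      (\<lambda>p. word_path X (map (fst p) [0..<n]) (snd p))"
    using continuous_map_word_path[of ?ws ?A X, OF *] by (simp add: o_def)
  have "word_path X (map x [0..<n]) 0 = suspension_base X \<and> word_path X (map x [0..<n]) 1 = suspension_base X"
    if "x \<in> topspace ?A" for x
    using word_path_ends[OF set_map_letters[OF that]] .
  then show ?thesis
    unfolding word_loop_def restrict_def[of _ "{0..1}"]
    using continuous_map_curry_loop[OF c] by (simp add: restrict_def)
qed

section \<open>Every loop is homotopic to a loop of a word\<close>

lemma path_homotopic_word_path_append: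
  assumes "set u \<subseteq> UNIV \<times> topspace X" and v: "set v \<subseteq> UNIV \<times> topspace X"
  shows "path_homotopic (suspension_plus X) (path_join (word_path X u) (word_path X v)) (word_path X (u @ v))"
  using assms(1)
proof (induction u)
  case Nil
  show ?case
    using path_homotopic_const_join[OF pathin_word_path[OF v]] word_path_ends[OF v] by simp
next
  case (Cons l u)
  have l: "snd l \<in> topspace X" and u: "set u \<subseteq> UNIV \<times> topspace X"
    using Cons.prems by (cases l; simp)+
  have "path_homotopic (suspension_plus X) (path_join (path_join (susp_letter X l) (word_path X u)) (word_path X v))
      (path_join (susp_letter X l) (path_join (word_path X u) (word_path X v)))"
    by (rule path_homotopic_assoc)
      (simp_all add: pathin_susp_letter l pathin_word_path u v susp_letter_ends word_path_ends)
  also have "path_homotopic (suspension_plus X) \<dots> (path_join (susp_letter X l) (word_path X (u @ v)))"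
    by (rule path_homotopic_join[OF path_homotopic_refl Cons.IH[OF u]])
      (simp_all add: pathin_susp_letter l susp_letter_ends word_path_ends u)
  finally show ?case
    by simp
qed

text \<open>A path in \<open>X\<close> between the two points slides the vertical line sideways; its
  ends stay at the basepoint because the top and bottom levels are collapsed.\<close>

lemma path_homotopic_susp_letter:
  assumes "class_letter X l = class_letter X m" and l: "snd l \<in> topspace X"
  shows "path_homotopic (suspension_plus X) (susp_letter X l) (susp_letter X m)"
proof -
  have "path_component_of_set X (snd l) = path_component_of_set X (snd m)" and b: "fst l = fst m"
    using assms(1) by (simp_all add: class_letter_def map_prod_def case_prod_unfold)
  moreover have "snd l \<in> path_component_of_set X (snd l)"
    using l by (simp add: path_component_of_refl)
  ultimately have "path_component_of X (snd m) (snd l)"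
    by simp
  then obtain p where p: "pathin X p" "p 0 = snd l" "p 1 = snd m"
    using path_component_of_sym unfolding path_component_of_def by metis
  have ptop: "p s \<in> topspace X" if "s \<in> {0..1}" for s
    using funcset_mem[OF continuous_map_funspace[OF p(1)[unfolded pathin_def]]] that by simp
  have "continuous_map (prod_topology (top_of_set {0..1::real}) unit_interval) (letter_space X) (\<lambda>q. (fst l, p (fst q)))"
    using continuous_map_compose[OF continuous_map_compose[OF
          continuous_map_fst[of "top_of_set {0..1::real}" unit_interval] p(1)[unfolded pathin_def]]
        continuous_map_letter[of X "fst l"]] by (simp only: o_def)
  then have "continuous_map (prod_topology (top_of_set {0..1::real}) unit_interval)
      (prod_topology (letter_space X) unit_interval) (\<lambda>q. ((fst l, p (fst q)), snd q))"
    by (simp add: continuous_map_paired continuous_map_snd del: prod_topology_subtopology_eu)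
  from continuous_map_compose[OF this continuous_map_susp_letter]
  have "continuous_map (prod_topology (top_of_set {0..1::real}) unit_interval) (suspension_plus X)
      (\<lambda>q. susp_letter X (fst l, p (fst q)) (snd q))"
    by (simp add: o_def)
  moreover have "(fst l, p 0) = l" "(fst l, p 1) = m"
    using p(2,3) b by (simp_all add: prod_eq_iff)
  ultimately show ?thesis
    unfolding path_homotopic_def homotopic_with_def
    by (intro exI[of _ "\<lambda>q. susp_letter X (fst l, p (fst q)) (snd q)"])
      (simp add: susp_letter_ends ptop l del: prod_topology_subtopology_eu)
qed

lemma path_homotopic_word_path_class:
  assumes "class_word X u = class_word X v"
    "set u \<subseteq> UNIV \<times> topspace X" "set v \<subseteq> UNIV \<times> topspace X"
  shows "path_homotopic (suspension_plus X) (word_path X u) (word_path X v)"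
  using assms
proof (induction u arbitrary: v)
  case Nil
  then show ?case by (simp add: path_homotopic_refl pathin_def)
next
  case (Cons l u v')
  obtain m v where v': "v' = m # v" "class_letter X l = class_letter X m" "class_word X u = class_word X v"
    using Cons.prems(1) by (cases v') simp_all
  have l: "snd l \<in> topspace X" and u: "set u \<subseteq> UNIV \<times> topspace X" and v: "set v \<subseteq> UNIV \<times> topspace X"
    using Cons.prems(2,3) v'(1) by (cases l; simp)+
  show ?case
    unfolding v'(1) word_path.simps
    by (rule path_homotopic_join[OF path_homotopic_susp_letter[OF v'(2) l] Cons.IH[OF v'(3) u v]])
      (simp add: susp_letter_ends l word_path_ends u)
qed

lemma path_homotopic_word_path_cancel:
  assumes l: "snd l \<in> topspace X" and w: "set w \<subseteq> UNIV \<times> topspace X"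
  shows "path_homotopic (suspension_plus X) (word_path X (l # inv_letter l # w)) (word_path X w)"
proof -
  have inv: "susp_letter X (inv_letter l) = (\<lambda>t. susp_letter X l (1 - t))"
    by (simp add: susp_letter_def inv_letter_def fun_eq_iff)
  have l': "snd (inv_letter l) \<in> topspace X"
    using l by (simp add: inv_letter_def)
  note simps = pathin_susp_letter l l' pathin_word_path w susp_letter_ends word_path_ends
  have "path_homotopic (suspension_plus X) (word_path X (l # inv_letter l # w))
      (path_join (path_join (susp_letter X l) (susp_letter X (inv_letter l))) (word_path X w))"
    unfolding word_path.simps by (rule path_homotopic_sym, rule path_homotopic_assoc) (simp_all add: simps)
  also have "path_homotopic (suspension_plus X) \<dots> (path_join (\<lambda>_. suspension_base X) (word_path X w))"
    using path_homotopic_join_rev[OF pathin_susp_letter[OF l]]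
    by (intro path_homotopic_join path_homotopic_refl) (simp_all add: simps inv)
  also have "path_homotopic (suspension_plus X) \<dots> (word_path X w)"
    by (rule path_homotopic_const_join) (simp_all add: simps)
  finally show ?thesis .
qed

text \<open>Letters whose classes cancel need not be inverse letters over the same point of
  \<open>X\<close>. Replacing every point by a chosen representative of its path component removes
  this discrepancy, so that each cancellation of classes is realized by
  \<open>path_homotopic_word_path_cancel\<close>.\<close>

lemma path_homotopic_word_path_reduce:
  assumes "reduce (class_word X u) = reduce (class_word X v)"
    and uv: "set u \<subseteq> UNIV \<times> topspace X" "set v \<subseteq> UNIV \<times> topspace X"
  shows "path_homotopic (suspension_plus X) (word_path X u) (word_path X v)"
proof -
  \<comment> \<open>\<open>r\<close> chooses a point in each path component, and \<open>R\<close>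
    turns a word of classes into a word of chosen points.\<close>
  define r where "r c = (SOME x. x \<in> topspace X \<and> path_component_of_set X x = c)" for c
  define R where "R = map (map_prod id r :: bool \<times> 'a set \<Rightarrow> bool \<times> 'a)"
  let ?W = "UNIV \<times> path_component_of_set X ` topspace X :: (bool \<times> 'a set) set"
  have r: "r c \<in> topspace X \<and> path_component_of_set X (r c) = c" if "c \<in> path_component_of_set X ` topspace X" for c
  proof -
    have "\<exists>x. x \<in> topspace X \<and> path_component_of_set X x = c"
      using that by (metis imageE)
    then show ?thesis
      unfolding r_def by (rule someI_ex)
  qed
  have R: "set (R w) \<subseteq> UNIV \<times> topspace X" "class_word X (R w) = w" if "set w \<subseteq> ?W" for w
    using that by (induction w) (use r in \<open>simp_all add: R_def class_letter_def mem_Times_iff prod_eq_iff\<close>)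
  have W: "set (class_word X w) \<subseteq> ?W" if "set w \<subseteq> UNIV \<times> topspace X" for w
    using that by (induction w) (simp_all add: class_letter_def mem_Times_iff)
  have red: "path_homotopic (suspension_plus X) (word_path X (R w)) (word_path X (R (reduce w)))"
    if "set w \<subseteq> ?W" for w
    using that
  proof (induction w)
    case Nil
    show ?case by (simp add: R_def reduce_def path_homotopic_refl pathin_def)
  next
    case (Cons l w)
    let ?l = "map_prod id r l"
    have l: "snd ?l \<in> topspace X" and w: "set w \<subseteq> ?W"
      using Cons.prems r[of "snd l"] by (simp_all add: mem_Times_iff)
    have rw: "set (reduce w) \<subseteq> ?W"
      using w set_reduce by blast
    have RC: "R (m # v) = map_prod id r m # R v" for m v
      by (simp add: R_def)
    have "path_homotopic (suspension_plus X) (word_path X (R (l # w)))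
        (path_join (susp_letter X ?l) (word_path X (R (reduce w))))"
      unfolding RC word_path.simps
      by (rule path_homotopic_join[OF path_homotopic_refl Cons.IH[OF w]])
        (simp_all add: pathin_susp_letter[OF l] susp_letter_ends[OF l] word_path_ends R(1)[OF w])
    also have "path_homotopic (suspension_plus X) \<dots> (word_path X (R (push_letter l (reduce w))))"
    proof (cases "\<exists>v. reduce w = inv_letter l # v")
      case True
      then obtain v where v: "reduce w = inv_letter l # v" by blast
      have "set v \<subseteq> ?W"
        using rw by (simp add: v)
      moreover have "map_prod id r (inv_letter l) = inv_letter ?l"
        by (simp add: inv_letter_def)
      ultimately show ?thesis
        using path_homotopic_word_path_cancel[OF l R(1)] by (simp add: v RC)
    next
      case False
      then have "push_letter l (reduce w) = l # reduce w"
        by (cases "reduce w") auto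
      moreover have "pathin (suspension_plus X) (word_path X (?l # R (reduce w)))"
        using l R(1)[OF rw] by (intro pathin_word_path) (simp add: mem_Times_iff)
      ultimately show ?thesis
        by (simp add: RC path_homotopic_refl)
    qed
    finally show ?case
      by (simp add: reduce_def)
  qed
  have "path_homotopic (suspension_plus X) (word_path X w) (word_path X (R (reduce (class_word X w))))"
    if w: "set w \<subseteq> UNIV \<times> topspace X" for w
  proof (rule path_homotopic_trans[OF _ red[OF W[OF w]]])
    show "path_homotopic (suspension_plus X) (word_path X w) (word_path X (R (class_word X w)))"
      by (rule path_homotopic_word_path_class) (simp_all only: R(2)[OF W[OF w]] R(1)[OF W[OF w]] w)
  qed
  from this[OF uv(1)] this[OF uv(2)] show ?thesis
    using assms(1) path_homotopic_sym path_homotopic_trans by metis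
qed

text \<open>Groupoid calculus for pinching: \<open>r\<close> will be the vertical path to the common
  end of two neighbouring segments, travelled back and forth.\<close>

lemma path_homotopic_cancel_middle:
  assumes "pathin Z q" "pathin Z f" "pathin Z r" "pathin Z g" "pathin Z s"
    and ends: "q 1 = f 0" "f 1 = r 1" "g 0 = r 1" "g 1 = s 0"
  shows "path_homotopic Z
    (path_join (path_join q (path_join f (\<lambda>t. r (1 - t)))) (path_join r (path_join g s)))
    (path_join q (path_join (path_join f g) s))"
proof -
  have r': "pathin Z (\<lambda>t. r (1 - t))"
    using pathin_rev assms(3) .
  note p = assms(1-5) r' pathin_path_join path_homotopic_refl ends
  have "path_homotopic Z (path_join (\<lambda>t. r (1 - t)) (path_join r (path_join g s)))
      (path_join (path_join (\<lambda>t. r (1 - t)) r) (path_join g s))"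
    by (rule path_homotopic_sym, rule path_homotopic_assoc) (simp_all add: p)
  also have "path_homotopic Z \<dots> (path_join (\<lambda>_. r 1) (path_join g s))"
    by (rule path_homotopic_join[OF path_homotopic_rev_join]) (simp_all add: p)
  also have "path_homotopic Z \<dots> (path_join g s)"
    by (rule path_homotopic_const_join) (simp_all add: p)
  finally have 1: "path_homotopic Z (path_join (\<lambda>t. r (1 - t)) (path_join r (path_join g s))) (path_join g s)" .
  have "path_homotopic Z (path_join (path_join f (\<lambda>t. r (1 - t))) (path_join r (path_join g s)))
      (path_join f (path_join (\<lambda>t. r (1 - t)) (path_join r (path_join g s))))"
    by (rule path_homotopic_assoc) (simp_all add: p)
  also have "path_homotopic Z \<dots> (path_join f (path_join g s))"
    by (rule path_homotopic_join[OF _ 1]) (simp_all add: p)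
  also have "path_homotopic Z \<dots> (path_join (path_join f g) s)"
    by (rule path_homotopic_sym, rule path_homotopic_assoc) (simp_all add: p)
  finally have 2: "path_homotopic Z (path_join (path_join f (\<lambda>t. r (1 - t))) (path_join r (path_join g s)))
      (path_join (path_join f g) s)" .
  have "path_homotopic Z (path_join (path_join q (path_join f (\<lambda>t. r (1 - t)))) (path_join r (path_join g s)))
      (path_join q (path_join (path_join f (\<lambda>t. r (1 - t))) (path_join r (path_join g s))))"
    by (rule path_homotopic_assoc) (simp_all add: p)
  also have "path_homotopic Z \<dots> (path_join q (path_join (path_join f g) s))"
    by (rule path_homotopic_join[OF _ 2]) (simp_all add: p)
  finally show ?thesis .
qed

lemma path_homotopic_convex_pathin:
  fixes K :: "'v::real_normed_vector set"
  assumes h: "continuous_map (top_of_set K) Z h" and K: "convex K"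
    and "pathin (top_of_set K) p" "pathin (top_of_set K) q" "p 0 = q 0" "p 1 = q 1"
  shows "path_homotopic Z (h \<circ> p) (h \<circ> q)"
  using assms unfolding pathin_def
  by (intro path_homotopic_convex[OF h K]) (simp_all add: image_subset_iff_funcset)

lemma path_join_compose: "h \<circ> path_join f g = path_join (h \<circ> f) (h \<circ> g)"
  by (auto simp: path_join_def fun_eq_iff)

lemma pathin_susp_contract:
  assumes "z \<in> topspace (suspension_plus X)"
  shows "pathin (suspension_plus X) (susp_contract X z)"
proof (cases "z = suspension_base X")
  case True
  then show ?thesis
    by (simp add: susp_contract_def[abs_def] pathin_def)
next
  case False
  then have z: "z \<in> susp_chart X False"
    using assms by (simp add: susp_chart_def)
  note d = susp_chart_interiorD[OF z]
  let ?g = "\<lambda>u. if susp_t z \<le> 1/2 then susp_t z * u else 1 - (1 - susp_t z) * u"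
  have "continuous_map unit_interval (suspension_plus X) (\<lambda>u. susp_pt X (susp_x z) (?g u))"
  proof (rule continuous_map_susp_pt_compose)
    show "continuous_map unit_interval euclideanreal ?g"
      by (cases "susp_t z \<le> 1/2") (auto intro!: continuous_intros)
    show "?g u \<in> {0..1}" if "u \<in> topspace unit_interval" for u
      using mult_mem_unit_interval[of "susp_t z" u] mult_mem_unit_interval[of "1 - susp_t z" u] that d(2,3)
      by simp
  qed (use d(1) in simp)
  then show ?thesis
    using False by (simp add: susp_contract_def[abs_def] pathin_def)
qed

text \<open>The segment of \<open>f\<close> between \<open>a\<close> and \<open>b\<close>, made into a loop by running vertically from the basepoint
  to \<open>f a\<close> and from \<open>f b\<close> back to the basepoint.\<close>

definition pinch :: "'a topology \<Rightarrow> (real \<Rightarrow> ('a option \<times> real) set) \<Rightarrow> real \<Rightarrow> real \<Rightarrow> real \<Rightarrow>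
    ('a option \<times> real) set" where
  "pinch X f a b = path_join (susp_contract X (f a))
     (path_join (\<lambda>t. f (a + t * (b - a))) (\<lambda>u. susp_contract X (f b) (1 - u)))"

lemma pinch_join:
  assumes f: "pathin (suspension_plus X) f" and abc: "0 \<le> a" "a \<le> b" "b \<le> c" "c \<le> 1"
  shows "path_homotopic (suspension_plus X) (path_join (pinch X f a b) (pinch X f b c)) (pinch X f a c)"
proof -
  have top: "f k \<in> topspace (suspension_plus X)" if "0 \<le> k" "k \<le> 1" for k
    using funcset_mem[OF continuous_map_funspace[OF f[unfolded pathin_def]], of k] that by simp
  note q = pathin_susp_contract[OF top]
  have seg: "pathin (suspension_plus X) (\<lambda>t. f (a + t * (b - a)))" "pathin (suspension_plus X) (\<lambda>t. f (b + t * (c - b)))"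
    using pathin_segment[OF f] abc by auto
  have s: "pathin (suspension_plus X) (\<lambda>u. susp_contract X (f c) (1 - u))"
    using pathin_rev[OF q[of c]] abc by simp
  have "path_homotopic (suspension_plus X) (path_join (pinch X f a b) (pinch X f b c))
      (path_join (susp_contract X (f a)) (path_join (path_join (\<lambda>t. f (a + t * (b - a)))
         (\<lambda>t. f (b + t * (c - b)))) (\<lambda>u. susp_contract X (f c) (1 - u))))"
    unfolding pinch_def
    by (rule path_homotopic_cancel_middle) (use abc top in \<open>simp_all add: q seg s\<close>)
  also have "path_homotopic (suspension_plus X) \<dots> (pinch X f a c)"
    unfolding pinch_def
    by (intro path_homotopic_join path_homotopic_refl path_homotopic_join_segments f)
      (use abc top in \<open>simp_all add: q s\<close>)
  finally show ?thesis .
qed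

lemma path_join_cong:
  assumes "\<And>t. t \<in> {0..1} \<Longrightarrow> f t = f' t" "\<And>t. t \<in> {0..1} \<Longrightarrow> g t = g' t" "t \<in> {0..1}"
  shows "path_join f g t = path_join f' g' t"
  using assms(1)[of "2 * t"] assms(2)[of "2 * t - 1"] assms(3) by (simp add: path_join_def)

lemma segment_mem:
  fixes a b k :: real
  assumes "k \<in> {0..1}" "a \<le> b"
  shows "a + k * (b - a) \<in> {a..b}"
  using assms mult_left_le_one_le[of "b - a" k] by simp

lemma continuous_map_segment_fst:
  fixes a b :: real
  assumes f: "continuous_map (top_of_set {a..b}) Z f" and ab: "a \<le> b"
  shows "continuous_map (top_of_set ({0..1} \<times> {0..1::real})) Z (\<lambda>p. f (a + fst p * (b - a)))"
proof -
  have "continuous_on ({0..1} \<times> {0..1::real}) (\<lambda>p. a + fst p * (b - a))"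
    by (intro continuous_intros)
  moreover have "a + fst p * (b - a) \<in> {a..b}" if "p \<in> {0..1} \<times> {0..1::real}" for p
    using segment_mem[of "fst p" a b] that ab by (simp add: mem_Times_iff)
  ultimately have "continuous_map (top_of_set ({0..1} \<times> {0..1::real})) (top_of_set {a..b}) (\<lambda>p. a + fst p * (b - a))"
    by (simp add: Pi_iff)
  from continuous_map_compose[OF this f] show ?thesis
    by (simp add: o_def)
qed

lemma pathin_square_lines:
  assumes "s \<in> {0..1::real}" "t \<in> {0..1}" "k \<in> {0..1::real}"
  shows "pathin (top_of_set ({0..1} \<times> {0..1})) (\<lambda>u. (k, s + (t - s) * u))"
proof -
  have "s + (t - s) * u \<in> {0..1}" if "u \<in> {0..1}" for u
    using convex_alt[of "{0..1::real}"] assms that by (force simp: algebra_simps)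
  then show ?thesis
    unfolding pathin_def using assms by (auto intro!: continuous_intros simp: image_subset_iff_funcset)
qed

text \<open>In either chart the pinched segment is the image of a path in the unit square, with time
  as first coordinate, under a continuous map into the suspension. The square is convex, so this
  path may be replaced by one along edges of the square, whose image is constant or a single
  letter.\<close>

lemma pinch_word:
  assumes f: "pathin (suspension_plus X) f" and ab: "0 \<le> a" "a \<le> b" "b \<le> 1"
    and chart: "f ` {a..b} \<subseteq> susp_chart X c"
  obtains w where "set w \<subseteq> UNIV \<times> topspace X" "path_homotopic (suspension_plus X) (pinch X f a b) (word_path X w)"
proof -
  let ?K = "{0..1} \<times> {0..1} :: (real \<times> real) set"
  let ?g = "\<lambda>k. f (a + k * (b - a))"
  have K: "convex ?K"
    by (intro convex_Times) auto
  have "continuous_map (top_of_set {a..b}) (suspension_plus X) f"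
    using f ab unfolding pathin_def by (metis atLeastatMost_subset_iff continuous_map_from_subtopology_mono)
  then have fc: "continuous_map (top_of_set {a..b}) (subtopology (suspension_plus X) (susp_chart X c)) f"
    using chart by (simp add: continuous_map_in_subtopology image_subset_iff_funcset)
  have g: "continuous_map (top_of_set ?K) (subtopology (suspension_plus X) (susp_chart X c)) (\<lambda>p. ?g (fst p))"
    using continuous_map_segment_fst[OF fc ab(2)] .
  have g0: "?g k \<in> susp_chart X c" if "k \<in> {0..1}" for k
    using segment_mem[OF that ab(2)] chart by blast
  show thesis
  proof (cases c)
    case True
    let ?h = "\<lambda>p. susp_contract X (?g (fst p)) (snd p)"
    have "continuous_map (top_of_set ?K)
        (prod_topology (subtopology (suspension_plus X) (susp_chart X True)) unit_interval) (\<lambda>p. (?g (fst p), snd p))"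
      using g True by (auto simp: continuous_map_paired intro!: continuous_intros)
    from continuous_map_compose[OF this continuous_map_susp_contract]
    have h: "continuous_map (top_of_set ?K) (suspension_plus X) ?h"
      by (simp add: o_def)
    \<comment> \<open>The second coordinate is the parameter of the contraction. The pinched segment
      runs along three sides of the square and is deformed into the fourth, which is mapped to the
      basepoint.\<close>
    define p where "p = path_join (\<lambda>t. (0, t)) (path_join (\<lambda>t. (t, 1)) (\<lambda>t. (1, 1 - t :: real)))"
    have line: "pathin (top_of_set ?K) (\<lambda>t. (0, t))" "pathin (top_of_set ?K) (\<lambda>t. (1, 1 - t))"
      "pathin (top_of_set ?K) (\<lambda>t. (t, 1))" "pathin (top_of_set ?K) (\<lambda>t. (t, 0))"
      unfolding pathin_def by (auto intro!: continuous_intros simp: image_subset_iff_funcset)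
    have p: "pathin (top_of_set ?K) p"
      unfolding p_def by (intro pathin_path_join line) simp_all
    have "path_homotopic (suspension_plus X) (?h \<circ> p) (?h \<circ> (\<lambda>t. (t, 0)))"
      by (rule path_homotopic_convex_pathin[OF h K p line(4)]) (simp_all add: p_def)
    moreover have gtop: "?g k \<in> topspace (suspension_plus X)" if "k \<in> {0..1}" for k
      using g0[OF that] susp_chart_subset by blast
    have "pinch X f a b t = (?h \<circ> p) t" if t: "t \<in> {0..1}" for t
      unfolding pinch_def p_def path_join_compose
    proof (intro path_join_cong t)
      fix s :: real assume s: "s \<in> {0..1}"
      show "?g s = (?h \<circ> (\<lambda>t. (t, 1))) s"
        unfolding o_def fst_conv snd_conv susp_contract_ends(2)[OF gtop[OF s]] ..
    qed simp_all
    moreover have "word_path X [] t = (?h \<circ> (\<lambda>t. (t, 0))) t" if "t \<in> {0..1}" for t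
      using gtop[OF that] by simp
    ultimately have "path_homotopic (suspension_plus X) (pinch X f a b) (word_path X [])"
      by (rule path_homotopic_cong)
    then show thesis
      using that[of "[]"] by simp
  next
    case False
    then have cF: "c = False" by simp
    let ?h = "\<lambda>p. susp_pt X (susp_x (?g (fst p))) (snd p)"
    define \<tau> where "\<tau> k = susp_t (?g k)" for k
    \<comment> \<open>The end of the interval from which \<open>susp_contract\<close> reaches the
      point at time \<open>k\<close>.\<close>
    define e where "e k = (if \<tau> k \<le> 1/2 then 0 else 1 :: real)" for k
    have d: "susp_x (?g k) \<in> topspace X" "0 < \<tau> k" "\<tau> k < 1" "susp_pt X (susp_x (?g k)) (\<tau> k) = ?g k" if "k \<in> {0..1}" for k
      using susp_chart_interiorD[of "?g k" X] g0[OF that] False by (simp_all add: \<tau>_def)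
    have h: "continuous_map (top_of_set ?K) (suspension_plus X) ?h"
    proof (rule continuous_map_susp_pt_compose)
      show "continuous_map (top_of_set ?K) X (\<lambda>p. susp_x (?g (fst p)))"
        using continuous_map_compose[OF g[unfolded cF] continuous_map_susp_coords(1)] by (simp add: o_def)
      show "continuous_map (top_of_set ?K) euclideanreal snd"
        by (auto intro!: continuous_intros)
    qed auto
    have contract: "susp_contract X (?g k) u = ?h (k, e k + (\<tau> k - e k) * u)" if "k \<in> {0..1}" for k u
    proof -
      have "?g k \<noteq> suspension_base X"
        using g0[OF that] False susp_base_in_chart(2) by metis
      then show ?thesis
        by (simp add: susp_contract_def \<tau>_def e_def algebra_simps)
    qed
    define p where "p = path_join (\<lambda>u. (0, e 0 + (\<tau> 0 - e 0) * u))
      (path_join (\<lambda>k. (k, \<tau> k)) (\<lambda>u. (1, e 1 + (\<tau> 1 - e 1) * (1 - u))))"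
    \<comment> \<open>In this chart the second coordinate is the level, and the top and bottom edges
      are mapped to the basepoint. Only the vertical part of \<open>q\<close> at time 1 can
      contribute, namely if the segment starts and ends in different halves.\<close>
    define q where "q = path_join (\<lambda>k. (k, e 0)) (\<lambda>u. (1 :: real, e 0 + (e 1 - e 0) * u))"
    have e: "e k \<in> {0..1}" "\<tau> k \<in> {0..1}" if "k \<in> {0..1}" for k
      using d(2,3)[OF that] by (simp_all add: e_def)
    have \<tau>: "pathin (top_of_set ?K) (\<lambda>k. (k, \<tau> k))"
    proof -
      have "continuous_map unit_interval (top_of_set ?K) (\<lambda>k. (k, 0))"
        by (auto intro!: continuous_intros simp: image_subset_iff_funcset)
      from continuous_map_compose[OF continuous_map_compose[OF this g[unfolded cF]] continuous_map_susp_coords(2)]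
      have "continuous_on {0..1} \<tau>"
        by (simp add: o_def \<tau>_def[abs_def])
      then show ?thesis
        unfolding pathin_def using e(2) by (auto intro!: continuous_intros simp: image_subset_iff_funcset)
    qed
    have line: "pathin (top_of_set ?K) (\<lambda>k. (k, e 0))"
      unfolding pathin_def using e(1)[of 0] by (auto intro!: continuous_intros simp: image_subset_iff_funcset)
    have p: "pathin (top_of_set ?K) p"
      unfolding p_def using pathin_square_lines[of "e 0" "\<tau> 0" 0] \<tau>
        pathin_rev[OF pathin_square_lines[of "e 1" "\<tau> 1" 1]] e[of 0] e[of 1]
      by (intro pathin_path_join) (simp_all add: algebra_simps)
    have q: "pathin (top_of_set ?K) q"
      unfolding q_def using pathin_square_lines[of "e 0" "e 1" 1] line e[of 0] e[of 1]
      by (intro pathin_path_join) simp_all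
    have hq: "path_homotopic (suspension_plus X) (?h \<circ> p) (?h \<circ> q)"
      by (rule path_homotopic_convex_pathin[OF h K p q]) (simp_all add: p_def q_def)
    have hp: "pinch X f a b t = (?h \<circ> p) t" if t: "t \<in> {0..1}" for t
      unfolding pinch_def p_def path_join_compose
    proof (intro path_join_cong t)
      fix s :: real assume s: "s \<in> {0..1}"
      show "?g s = (?h \<circ> (\<lambda>k. (k, \<tau> k))) s"
        unfolding o_def fst_conv snd_conv d(4)[OF s] ..
      show "susp_contract X (f a) s = (?h \<circ> (\<lambda>u. (0, e 0 + (\<tau> 0 - e 0) * u))) s"
        using contract[of 0 s] by simp
      show "susp_contract X (f b) (1 - s) = (?h \<circ> (\<lambda>u. (1, e 1 + (\<tau> 1 - e 1) * (1 - u)))) s"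
        using contract[of 1 "1 - s"] by simp
    qed
    let ?x = "susp_x (?g 1)"
    \<comment> \<open>Starting from level 0 means traversing the vertical line upwards, the positive
      letter.\<close>
    define w where "w = (if e 0 = e 1 then [] else [(e 0 = 0, ?x)])"
    have "?x \<in> topspace X"
      using d(1)[of 1] by simp
    then have w: "set w \<subseteq> UNIV \<times> topspace X"
      by (simp add: w_def)
    have e01: "e k = 0 \<or> e k = 1" for k
      by (simp add: e_def)
    have side: "?h (k, e 0) = suspension_base X" if "k \<in> {0..1}" for k
      using e01[of 0] d(1)[OF that] by (elim disjE) simp_all
    have hw: "path_homotopic (suspension_plus X) (?h \<circ> q) (word_path X w)"
    proof (cases "e 0 = e 1")
      case True
      have "path_homotopic (suspension_plus X) (\<lambda>_. suspension_base X) (word_path X w)"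
        using True by (simp add: w_def path_homotopic_refl pathin_def)
      then show ?thesis
      proof (rule path_homotopic_cong)
        fix t :: real assume t: "t \<in> {0..1}"
        have "(?h \<circ> q) t = path_join (\<lambda>_. suspension_base X) (\<lambda>_. suspension_base X) t"
          unfolding q_def path_join_compose
        proof (intro path_join_cong t)
          fix s :: real assume s: "s \<in> {0..1}"
          show "(?h \<circ> (\<lambda>k. (k, e 0))) s = suspension_base X"
            using side[OF s] by simp
          show "(?h \<circ> (\<lambda>u. (1, e 0 + (e 1 - e 0) * u))) s = suspension_base X"
            using side[of 1] True by simp
        qed
        then show "(?h \<circ> q) t = suspension_base X"
          by (simp add: path_join_def)
      qed simp
    next
      case False
      let ?l = "(e 0 = 0, ?x)"
      have l: "snd ?l \<in> topspace X"
        using \<open>?x \<in> topspace X\<close> by simp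
      have e': "e 0 = 0 \<and> e 1 = 1 \<or> e 0 = 1 \<and> e 1 = 0"
        using e01[of 0] e01[of 1] False by auto
      \<comment> \<open>The image of \<open>q\<close> has its constant half before the letter,
        \<open>word_path\<close> has it after the letter.\<close>
      have "path_homotopic (suspension_plus X) (path_join (\<lambda>_. suspension_base X) (susp_letter X ?l)) (susp_letter X ?l)"
        by (rule path_homotopic_const_join[OF pathin_susp_letter[OF l]]) (simp only: susp_letter_ends[OF l])
      also have "path_homotopic (suspension_plus X) \<dots> (path_join (susp_letter X ?l) (\<lambda>_. suspension_base X))"
        by (rule path_homotopic_sym, rule path_homotopic_join_const[OF pathin_susp_letter[OF l]])
          (simp only: susp_letter_ends[OF l])
      finally show ?thesis
      proof (rule path_homotopic_cong)
        fix t :: real assume t: "t \<in> {0..1}"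
        show "(?h \<circ> q) t = path_join (\<lambda>_. suspension_base X) (susp_letter X ?l) t"
          unfolding q_def path_join_compose
        proof (intro path_join_cong t)
          fix s :: real assume s: "s \<in> {0..1}"
          show "(?h \<circ> (\<lambda>k. (k, e 0))) s = suspension_base X"
            using side[OF s] by simp
          have "e 0 + (e 1 - e 0) * s = (if e 0 = 0 then s else 1 - s)"
            using e' by (elim disjE) simp_all
          then show "(?h \<circ> (\<lambda>u. (1, e 0 + (e 1 - e 0) * u))) s = susp_letter X ?l s"
            unfolding susp_letter_def o_def fst_conv snd_conv by (simp only:)
        qed
        show "word_path X w t = path_join (susp_letter X ?l) (\<lambda>_. suspension_base X) t"
          using False by (simp add: w_def)
      qed
    qed
    show thesis
      by (rule that[OF w path_homotopic_trans[OF path_homotopic_cong[OF hq hp refl] hw]])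
  qed
qed

text \<open>A piece of a loop has no homotopy class relative to the basepoint. Pinching turns pieces
  into loops whose product over adjacent intervals is again a pinched piece by
  \<open>pinch_join\<close>, so subdivision applies.\<close>

lemma loop_homotopic_word_path:
  assumes f: "f \<in> susp_loops X"
  obtains w where "set w \<subseteq> UNIV \<times> topspace X" "path_homotopic (suspension_plus X) f (word_path X w)"
proof -
  have p: "pathin (suspension_plus X) f" "f 0 = suspension_base X" "f 1 = suspension_base X"
    using f by (simp_all add: loops_def)
  let ?P = "\<lambda>a b. 0 \<le> a \<longrightarrow> b \<le> 1 \<longrightarrow> (\<exists>w. set w \<subseteq> UNIV \<times> topspace X \<and>
      path_homotopic (suspension_plus X) (pinch X f a b) (word_path X w))"
  have "?P (0::real) 1"
  proof (rule Bolzano[where P = ?P])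
    fix a b c :: real assume ab: "?P a b" and bc: "?P b c" and le: "a \<le> b" "b \<le> c"
    show "?P a c"
    proof (intro impI)
      assume ac: "0 \<le> a" "c \<le> 1"
      have b: "0 \<le> b" "b \<le> 1"
        using ac le by linarith+
      from ab ac(1) b(2) have "\<exists>u. set u \<subseteq> UNIV \<times> topspace X \<and>
          path_homotopic (suspension_plus X) (pinch X f a b) (word_path X u)"
        by (elim impE)
      then obtain u where u: "set u \<subseteq> UNIV \<times> topspace X"
          "path_homotopic (suspension_plus X) (pinch X f a b) (word_path X u)"
        by (elim exE conjE)
      from bc ac(2) b(1) have "\<exists>v. set v \<subseteq> UNIV \<times> topspace X \<and>
          path_homotopic (suspension_plus X) (pinch X f b c) (word_path X v)"
        by (elim impE)
      then obtain v where v: "set v \<subseteq> UNIV \<times> topspace X"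
          "path_homotopic (suspension_plus X) (pinch X f b c) (word_path X v)"
        by (elim exE conjE)
      have "path_homotopic (suspension_plus X) (pinch X f a c) (path_join (pinch X f a b) (pinch X f b c))"
        using pinch_join[OF p(1)] ac le by (simp add: path_homotopic_sym)
      also have "path_homotopic (suspension_plus X) \<dots> (path_join (word_path X u) (word_path X v))"
        using path_homotopicD(3,4)[OF u(2)] path_homotopicD(3,4)[OF v(2)] word_path_ends[OF u(1)] word_path_ends[OF v(1)]
        by (intro path_homotopic_join u(2) v(2)) simp
      also have "path_homotopic (suspension_plus X) \<dots> (word_path X (u @ v))"
        by (rule path_homotopic_word_path_append[OF u(1) v(1)])
      finally show "\<exists>w. set w \<subseteq> UNIV \<times> topspace X \<and>
          path_homotopic (suspension_plus X) (pinch X f a c) (word_path X w)"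
        using u(1) v(1) by (intro exI[of _ "u @ v"]) simp
    qed
  next
    fix x :: real assume x: "0 \<le> x" "x \<le> 1"
    then obtain e c where e: "e > 0" "\<And>k. k \<in> {0..1} \<Longrightarrow> dist k x < e \<Longrightarrow> f k \<in> susp_chart X c"
      using path_locally_in_chart[OF p(1), of x] by auto
    have "\<exists>w. set w \<subseteq> UNIV \<times> topspace X \<and> path_homotopic (suspension_plus X) (pinch X f a b) (word_path X w)"
      if ab: "a \<le> x" "x \<le> b" "b - a < e" "0 \<le> a" "b \<le> 1" for a b
    proof -
      have chart: "f ` {a..b} \<subseteq> susp_chart X c"
        using e(2) ab by (auto simp: dist_real_def)
      have "a \<le> b" using ab by linarith
      from pinch_word[OF p(1) ab(4) this ab(5) chart] show ?thesis
        by metis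
    qed
    then show "\<exists>d>0. \<forall>a b. a \<le> x \<and> x \<le> b \<and> b - a < d \<longrightarrow> ?P a b"
      using e(1) by (intro exI[of _ e]) blast
  qed simp
  then obtain w where w: "set w \<subseteq> UNIV \<times> topspace X"
      "path_homotopic (suspension_plus X) (pinch X f 0 1) (word_path X w)"
    by auto
  have base: "susp_contract X (suspension_base X) = (\<lambda>u. suspension_base X)"
    by (simp add: susp_contract_def fun_eq_iff)
  \<comment> \<open>Both ends of \<open>f\<close> are at the basepoint, where the vertical paths of
    the pinching are constant.\<close>
  have "path_homotopic (suspension_plus X) (pinch X f 0 1) (path_join f (\<lambda>_. suspension_base X))"
    unfolding pinch_def p base
    using path_homotopic_const_join[OF pathin_path_join[OF p(1)], of "\<lambda>_. suspension_base X" "suspension_base X"] p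
    by (simp add: pathin_def)
  also have "path_homotopic (suspension_plus X) \<dots> f"
    by (rule path_homotopic_join_const) (simp_all add: p)
  finally have "path_homotopic (suspension_plus X) f (word_path X w)"
    using w(2) path_homotopic_sym path_homotopic_trans by blast
  with w(1) show thesis
    by (rule that)
qed

text \<open>Both loops are homotopic to loops of words; invariance of \<open>susp_word\<close> shows
  that these words have the same reduction over the path components, which makes their loops
  homotopic.\<close>

lemma susp_word_inj:
  assumes f: "f \<in> susp_loops X" and g: "g \<in> susp_loops X" and eq: "susp_word X f = susp_word X g"
  shows "path_homotopic (suspension_plus X) f g"
proof -
  have *: "susp_word X f = reduce (class_word X u)"
    if f: "f \<in> susp_loops X" and u: "set u \<subseteq> UNIV \<times> topspace X" "path_homotopic (suspension_plus X) f (word_path X u)" for f u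
  proof -
    have "path_homotopic (suspension_plus X) f (word_loop X u)"
      using u(2) by (rule path_homotopic_cong) (simp_all add: word_loop_def)
    from susp_word_homotopic[OF f word_loop_in_loops[OF u(1)] this] show ?thesis
      by (simp only: susp_word_word_loop[OF u(1)])
  qed
  obtain u where u: "set u \<subseteq> UNIV \<times> topspace X" "path_homotopic (suspension_plus X) f (word_path X u)"
    by (rule loop_homotopic_word_path[OF f])
  obtain v where v: "set v \<subseteq> UNIV \<times> topspace X" "path_homotopic (suspension_plus X) g (word_path X v)"
    by (rule loop_homotopic_word_path[OF g])
  have "path_homotopic (suspension_plus X) (word_path X u) (word_path X v)"
    using *[OF f u] *[OF g v] eq by (intro path_homotopic_word_path_reduce u(1) v(1)) simp
  then show ?thesis
    using u(2) v(2) path_homotopic_sym path_homotopic_trans by blast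
qed

section \<open>The topology of the fundamental group of the suspension\<close>

definition word_sum :: "'a topology \<Rightarrow> (nat \<times> (nat \<Rightarrow> bool \<times> 'a)) topology" where
  "word_sum X = sum_topology (\<lambda>n. product_topology (\<lambda>_. letter_space X) {..<n}) UNIV"

definition class_reduction :: "'a topology \<Rightarrow> nat \<times> (nat \<Rightarrow> bool \<times> 'a) \<Rightarrow> 'a set word" where
  "class_reduction X = (\<lambda>(n, x). reduce (class_word X (map x [0..<n])))"

text \<open>The topology \<open>Q\<close> of the overview.\<close>

definition word_quotient :: "'a topology \<Rightarrow> 'a set word topology" where
  "word_quotient X = quotient_topology (word_sum X) (class_reduction X)"

lemma set_class_word:
  assumes "set w \<subseteq> UNIV \<times> topspace X"
  shows "set (class_word X w) \<subseteq> UNIV \<times> topspace (pi0_top X)"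
  using assms by (induction w) (simp_all add: class_letter_def pi0_top_def mem_Times_iff)

lemma class_word_surj:
  assumes "set v \<subseteq> UNIV \<times> topspace (pi0_top X)"
  obtains w where "set w \<subseteq> UNIV \<times> topspace X" "class_word X w = v"
proof -
  have "\<exists>w. set w \<subseteq> UNIV \<times> topspace X \<and> class_word X w = v"
    using assms
  proof (induction v)
    case (Cons l v)
    then obtain w where w: "set w \<subseteq> UNIV \<times> topspace X" "class_word X w = v"
      by auto
    have "snd l \<in> path_component_of_set X ` topspace X"
      using Cons.prems by (simp add: pi0_top_def mem_Times_iff)
    then obtain x where x: "x \<in> topspace X" "snd l = path_component_of_set X x"
      by (rule imageE)
    have "set ((fst l, x) # w) \<subseteq> UNIV \<times> topspace X \<and> class_word X ((fst l, x) # w) = l # v"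
      using w x by (simp add: class_letter_def prod_eq_iff)
    then show ?case by (rule exI)
  qed simp
  then show thesis using that by blast
qed

lemma reduce_in_carrier:
  "set w \<subseteq> UNIV \<times> A \<Longrightarrow> reduce w \<in> carrier (free_group A)"
  using set_reduce[of w] by (auto simp: free_group_def)

lemma restrict_map_upt:
  assumes "length w = n"
  shows "map (\<lambda>i\<in>{..<n}. w ! i) [0..<n] = w"
  using assms by (auto intro: nth_equalityI)

lemma restrict_nth_in_product:
  assumes "set w \<subseteq> UNIV \<times> topspace X" "length w = n"
  shows "(\<lambda>i\<in>{..<n}. w ! i) \<in> topspace (product_topology (\<lambda>_. letter_space X) {..<n})"
proof -
  have "w ! i \<in> UNIV \<times> topspace X" if "i < n" for i
    using assms that nth_mem by blast
  then show ?thesis by simp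
qed

lemma topspace_word_quotient: "topspace (word_quotient X) = carrier (free_group (topspace (pi0_top X)))"
proof (intro equalityI subsetI)
  fix v assume "v \<in> topspace (word_quotient X)"
  then obtain n x where x: "x \<in> topspace (product_topology (\<lambda>_. letter_space X) {..<n})"
      "v = reduce (class_word X (map x [0..<n]))"
    unfolding word_quotient_def topspace_quotient_topology word_sum_def class_reduction_def by auto
  then show "v \<in> carrier (free_group (topspace (pi0_top X)))"
    by (simp only: x(2) reduce_in_carrier[OF set_class_word[OF set_map_letters[OF x(1)]]])
next
  fix v assume v: "v \<in> carrier (free_group (topspace (pi0_top X)))"
  then have "set v \<subseteq> UNIV \<times> topspace (pi0_top X)" and red: "reduced v"
    by (simp_all add: free_group_def)
  then obtain w where w: "set w \<subseteq> UNIV \<times> topspace X" "class_word X w = v"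
    by (rule_tac class_word_surj)
  let ?p = "(length w, \<lambda>i\<in>{..<length w}. w ! i)"
  have "?p \<in> topspace (word_sum X)"
    using restrict_nth_in_product[OF w(1) refl] by (simp add: word_sum_def)
  moreover have "class_reduction X ?p = v"
    by (simp only: class_reduction_def case_prod_conv restrict_map_upt[OF refl] w(2) reduce_reduced[OF red])
  ultimately show "v \<in> topspace (word_quotient X)"
    unfolding word_quotient_def topspace_quotient_topology by (metis image_eqI)
qed

lemma openin_word_quotient:
  "openin (word_quotient X) U \<longleftrightarrow> U \<subseteq> carrier (free_group (topspace (pi0_top X))) \<and>
     (\<forall>n. openin (product_topology (\<lambda>_. letter_space X) {..<n})
       {x \<in> topspace (product_topology (\<lambda>_. letter_space X) {..<n}). reduce (class_word X (map x [0..<n])) \<in> U})"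
proof -
  have "{x. (n, x) \<in> {p \<in> topspace (word_sum X). class_reduction X p \<in> U}} =
      {x \<in> topspace (product_topology (\<lambda>_. letter_space X) {..<n}). reduce (class_word X (map x [0..<n])) \<in> U}" for n
    by (simp add: word_sum_def class_reduction_def)
  moreover have "{p \<in> topspace (word_sum X). class_reduction X p \<in> U} \<subseteq> topspace (word_sum X)"
    by blast
  ultimately have "openin (word_sum X) {p \<in> topspace (word_sum X). class_reduction X p \<in> U} \<longleftrightarrow>
     (\<forall>n. openin (product_topology (\<lambda>_. letter_space X) {..<n})
       {x \<in> topspace (product_topology (\<lambda>_. letter_space X) {..<n}). reduce (class_word X (map x [0..<n])) \<in> U})"
    unfolding word_sum_def openin_sum_topology topspace_sum_topology by simp
  then show ?thesis
    using topspace_word_quotient[of X]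
    unfolding word_quotient_def openin_quotient_topology topspace_quotient_topology by simp
qed

lemma closedin_word_quotient:
  "closedin (word_quotient X) C \<longleftrightarrow> C \<subseteq> carrier (free_group (topspace (pi0_top X))) \<and>
     (\<forall>n. closedin (product_topology (\<lambda>_. letter_space X) {..<n})
       {x \<in> topspace (product_topology (\<lambda>_. letter_space X) {..<n}). reduce (class_word X (map x [0..<n])) \<in> C})"
proof -
  let ?L = "\<lambda>n. product_topology (\<lambda>_. letter_space X) {..<n}"
  let ?F = "carrier (free_group (topspace (pi0_top X)))"
  have "topspace (?L n) - {x \<in> topspace (?L n). reduce (class_word X (map x [0..<n])) \<in> C} =
      {x \<in> topspace (?L n). reduce (class_word X (map x [0..<n])) \<in> ?F - C}" for n
    using reduce_in_carrier[OF set_class_word[OF set_map_letters]] by blast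
  moreover have "{x \<in> topspace (?L n). reduce (class_word X (map x [0..<n])) \<in> C} \<subseteq> topspace (?L n)" for n
    by blast
  ultimately show ?thesis
    unfolding closedin_def openin_word_quotient topspace_word_quotient by simp
qed

text \<open>Along the continuous map \<open>word_loop\<close> the word of a loop becomes
  \<open>class_reduction\<close>, so a set with open preimage in the loop space is open in the
  quotient. The other direction is local: near a loop, \<open>susp_word\<close> factors through the
  words in \<open>X\<close> of one fixed length by \<open>near_word_susp_word\<close>.\<close>

lemma quotient_map_susp_word: "quotient_map (susp_loop_space X) (word_quotient X) (susp_word X)"
  unfolding quotient_map_def
proof (intro conjI allI impI)
  let ?F = "carrier (free_group (topspace (pi0_top X)))"
  show "susp_word X ` topspace (susp_loop_space X) = topspace (word_quotient X)"
    unfolding topspace_word_quotient topspace_loop_space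
  proof (intro equalityI image_subsetI subsetI)
    fix v assume v: "v \<in> ?F"
    then have "set v \<subseteq> UNIV \<times> topspace (pi0_top X)" and red: "reduced v"
      by (simp_all add: free_group_def)
    then obtain w where w: "set w \<subseteq> UNIV \<times> topspace X" "class_word X w = v"
      by (rule_tac class_word_surj)
    have "susp_word X (word_loop X w) = v"
      by (simp only: susp_word_word_loop[OF w(1)] w(2) reduce_reduced[OF red])
    then show "v \<in> susp_word X ` susp_loops X"
      using word_loop_in_loops[OF w(1)] by (metis image_eqI)
  qed (rule susp_word_in_carrier)
  fix U assume "U \<subseteq> topspace (word_quotient X)"
  then have U: "U \<subseteq> ?F"
    by (simp add: topspace_word_quotient)
  let ?L = "\<lambda>n. product_topology (\<lambda>_. letter_space X) {..<n}"
  let ?P = "{f \<in> topspace (susp_loop_space X). susp_word X f \<in> U}"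
  show "openin (susp_loop_space X) ?P = openin (word_quotient X) U"
  proof
    assume P: "openin (susp_loop_space X) ?P"
    have "openin (?L n) {x \<in> topspace (?L n). reduce (class_word X (map x [0..<n])) \<in> U}" for n
    proof -
      have "{x \<in> topspace (?L n). word_loop X (map x [0..<n]) \<in> ?P} =
          {x \<in> topspace (?L n). reduce (class_word X (map x [0..<n])) \<in> U}"
      proof (rule Collect_cong, rule conj_cong, rule refl)
        fix x assume "x \<in> topspace (?L n)"
        from set_map_letters[OF this]
        show "word_loop X (map x [0..<n]) \<in> ?P \<longleftrightarrow> reduce (class_word X (map x [0..<n])) \<in> U"
          unfolding mem_Collect_eq topspace_loop_space
          by (simp only: susp_word_word_loop word_loop_in_loops simp_thms)
      qed
      then show ?thesis
        using openin_continuous_map_preimage[OF continuous_map_word_loop P, of n] by (simp only:)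
    qed
    then show "openin (word_quotient X) U"
      using U by (simp only: openin_word_quotient simp_thms)
  next
    assume "openin (word_quotient X) U"
    then have L: "openin (?L n) {x \<in> topspace (?L n). reduce (class_word X (map x [0..<n])) \<in> U}" for n
      by (simp only: openin_word_quotient simp_thms)
    show "openin (susp_loop_space X) ?P"
    proof (subst openin_subopen, rule ballI)
      fix f assume f: "f \<in> ?P"
      then have "f \<in> susp_loops X" by simp
      from near_word_susp_word[OF this] obtain N ws where
        N: "openin (susp_loop_space X) N" "f \<in> N"
        "\<And>w. w \<in> set ws \<Longrightarrow> continuous_map (subtopology (susp_loop_space X) N) (letter_space X) w"
        "\<And>g. g \<in> N \<Longrightarrow> susp_word X g = reduce (class_word X (map (\<lambda>w. w g) ws))"
        by (rule near_wordE) blast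
      \<comment> \<open>Collects the letters valid near \<open>f\<close> into one continuous map to
        the words of length \<open>length ws\<close>.\<close>
      define W where "W g = (\<lambda>i\<in>{..<length ws}. (ws ! i) g)" for g
      let ?n = "length ws"
      have W: "continuous_map (subtopology (susp_loop_space X) N) (?L ?n) W"
        unfolding W_def[abs_def] continuous_map_componentwise using N(3) by auto
      have map: "map (W g) [0..<?n] = map (\<lambda>w. w g) ws" for g
        by (auto simp: W_def intro: nth_equalityI)
      define M where "M = {g \<in> topspace (subtopology (susp_loop_space X) N).
          W g \<in> {x \<in> topspace (?L ?n). reduce (class_word X (map x [0..<?n])) \<in> U}}"
      have "openin (subtopology (susp_loop_space X) N) M"
        unfolding M_def by (rule openin_continuous_map_preimage[OF W L])
      then have 1: "openin (susp_loop_space X) M"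
        using N(1) openin_trans_full by blast
      have mem: "g \<in> M \<longleftrightarrow> g \<in> N \<and> susp_word X g \<in> U" for g
      proof -
        have "W g \<in> topspace (?L ?n)" if "g \<in> N"
          using funcset_mem[OF continuous_map_funspace[OF W], of g] that openin_subset[OF N(1)] by auto
        then show ?thesis
          unfolding M_def mem_Collect_eq map using N(4)[of g] openin_subset[OF N(1)] by auto
      qed
      have "M \<subseteq> ?P"
        using mem openin_subset[OF 1] by blast
      moreover have "f \<in> M"
        using mem N(2) f by simp
      ultimately show "\<exists>T. openin (susp_loop_space X) T \<and> f \<in> T \<and> T \<subseteq> ?P"
        using 1 by blast
    qed
  qed
qed

section \<open>Transfer from loops to the fundamental group\<close>

lemma fundamental_group_mult:
  assumes f: "f \<in> loops Z z" and g: "g \<in> loops Z z"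
  shows "loop_homotopy Z z `` {f} \<otimes>\<^bsub>fundamental_group Z z\<^esub> loop_homotopy Z z `` {g} =
    loop_homotopy Z z `` {loop_concat f g}"
proof -
  have eq: "loop_homotopy Z z `` {loop_concat f' g'} = loop_homotopy Z z `` {loop_concat f g}"
    if "f' \<in> loop_homotopy Z z `` {f}" "g' \<in> loop_homotopy Z z `` {g}" for f' g'
  proof -
    have l: "f' \<in> loops Z z" "g' \<in> loops Z z" and h: "(f, f') \<in> loop_homotopy Z z" "(g, g') \<in> loop_homotopy Z z"
      using that by (auto simp: loop_homotopy_def)
    have "path_homotopic Z (path_join f g) (path_join f' g')"
      using h f g l by (intro path_homotopic_join) (simp_all add: loop_homotopy_iff, simp add: loops_def)
    then have "path_homotopic Z (loop_concat f g) (loop_concat f' g')"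
      by (rule path_homotopic_cong) (simp_all add: loop_concat_eq)
    then have "(loop_concat f g, loop_concat f' g') \<in> loop_homotopy Z z"
      by (simp add: loop_homotopy_iff loop_concat_in_loops f g l)
    then show ?thesis
      using equiv_class_eq[OF equiv_loop_homotopy] by metis
  qed
  have "f \<in> loop_homotopy Z z `` {f}" "g \<in> loop_homotopy Z z `` {g}"
    using equiv_class_self[OF equiv_loop_homotopy] f g by auto
  then have "(\<Union>f'\<in>loop_homotopy Z z `` {f}. \<Union>g'\<in>loop_homotopy Z z `` {g}.
      loop_homotopy Z z `` {loop_concat f' g'}) = loop_homotopy Z z `` {loop_concat f g}"
    using eq by blast
  then show ?thesis
    by (simp add: fundamental_group_def)
qed

definition class_susp_word :: "'a topology \<Rightarrow> (real \<Rightarrow> ('a option \<times> real) set) set \<Rightarrow> 'a set word" where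
  "class_susp_word X A = the_elem (susp_word X ` A)"

abbreviation susp_group :: "'a topology \<Rightarrow> (real \<Rightarrow> ('a option \<times> real) set) set monoid" where
  "susp_group X \<equiv> fundamental_group (suspension_plus X) (suspension_base X)"

abbreviation susp_class :: "'a topology \<Rightarrow> (real \<Rightarrow> ('a option \<times> real) set) \<Rightarrow> (real \<Rightarrow> ('a option \<times> real) set) set" where
  "susp_class X f \<equiv> loop_homotopy (suspension_plus X) (suspension_base X) `` {f}"

lemma class_susp_word_class:
  assumes f: "f \<in> susp_loops X"
  shows "class_susp_word X (susp_class X f) = susp_word X f"
proof -
  have "susp_word X g = susp_word X f" if "g \<in> susp_class X f" for g
  proof -
    have g: "g \<in> susp_loops X" "(f, g) \<in> loop_homotopy (suspension_plus X) (suspension_base X)"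
      using that by (auto simp: loop_homotopy_def)
    then show ?thesis
      using susp_word_homotopic[OF f g(1)] by (simp add: loop_homotopy_iff f)
  qed
  moreover have "f \<in> susp_class X f"
    using equiv_class_self[OF equiv_loop_homotopy f] .
  ultimately have "susp_word X ` susp_class X f = {susp_word X f}"
    by blast
  then show ?thesis
    by (simp add: class_susp_word_def)
qed

lemma carrier_susp_group: "carrier (susp_group X) = susp_class X ` susp_loops X"
  by (auto simp: fundamental_group_def quotient_def)

lemma class_susp_word_iso:
  "class_susp_word X \<in> iso (susp_group X) (free_group (topspace (pi0_top X)))"
proof (rule isoI)
  show "class_susp_word X \<in> hom (susp_group X) (free_group (topspace (pi0_top X)))"
  proof (rule homI)
    fix A B assume "A \<in> carrier (susp_group X)" "B \<in> carrier (susp_group X)"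
    then obtain f g where f: "f \<in> susp_loops X" "A = susp_class X f" and g: "g \<in> susp_loops X" "B = susp_class X g"
      unfolding carrier_susp_group by (elim imageE)
    show "class_susp_word X A \<in> carrier (free_group (topspace (pi0_top X)))"
      unfolding f(2) class_susp_word_class[OF f(1)] by (rule susp_word_in_carrier[OF f(1)])
    show "class_susp_word X (A \<otimes>\<^bsub>susp_group X\<^esub> B) =
        class_susp_word X A \<otimes>\<^bsub>free_group (topspace (pi0_top X))\<^esub> class_susp_word X B"
      unfolding f(2) g(2) fundamental_group_mult[OF f(1) g(1)]
        class_susp_word_class[OF loop_concat_in_loops[OF f(1) g(1)]] class_susp_word_class[OF f(1)]
        class_susp_word_class[OF g(1)] susp_word_concat[OF f(1) g(1)]
      by (simp add: free_group_def)
  qed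
  have "inj_on (class_susp_word X) (carrier (susp_group X))"
  proof (rule inj_onI)
    fix A B assume "A \<in> carrier (susp_group X)" "B \<in> carrier (susp_group X)"
      and eq: "class_susp_word X A = class_susp_word X B"
    then obtain f g where f: "f \<in> susp_loops X" "A = susp_class X f" and g: "g \<in> susp_loops X" "B = susp_class X g"
      unfolding carrier_susp_group by (elim imageE)
    have "susp_word X f = susp_word X g"
      using eq unfolding f(2) g(2) class_susp_word_class[OF f(1)] class_susp_word_class[OF g(1)] .
    then have "(f, g) \<in> loop_homotopy (suspension_plus X) (suspension_base X)"
      using susp_word_inj[OF f(1) g(1)] by (simp add: loop_homotopy_iff f(1) g(1))
    then show "A = B"
      unfolding f(2) g(2) by (rule equiv_class_eq[OF equiv_loop_homotopy])
  qed
  moreover have "class_susp_word X ` carrier (susp_group X) = carrier (free_group (topspace (pi0_top X)))"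
  proof -
    have "class_susp_word X ` carrier (susp_group X) = susp_word X ` susp_loops X"
      unfolding carrier_susp_group image_image by (rule image_cong[OF refl class_susp_word_class])
    also have "\<dots> = carrier (free_group (topspace (pi0_top X)))"
      using quotient_map_susp_word[of X] topspace_word_quotient[of X]
      unfolding quotient_map_def topspace_loop_space by (elim conjE) (simp only:)
    finally show ?thesis .
  qed
  ultimately show "bij_betw (class_susp_word X) (carrier (susp_group X)) (carrier (free_group (topspace (pi0_top X))))"
    by (simp add: bij_betw_def)
qed

text \<open>The loop space maps by quotient maps both to the fundamental group and to the words,
  with the same fibres, so the induced bijection is a homeomorphism.\<close>

lemma homeomorphic_map_class_susp_word:
  "homeomorphic_map (pi1_top (suspension_plus X) (suspension_base X)) (word_quotient X) (class_susp_word X)"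
proof -
  let ?T = "pi1_top (suspension_plus X) (suspension_base X)"
  have q: "quotient_map (susp_loop_space X) ?T (\<lambda>f. susp_class X f)"
    unfolding pi1_top_def by (rule quotient_map_quotient_topology)
  have "quotient_map (susp_loop_space X) (word_quotient X) (class_susp_word X \<circ> (\<lambda>f. susp_class X f))"
    by (rule quotient_map_eq[OF quotient_map_susp_word]) (simp add: class_susp_word_class)
  then have "quotient_map ?T (word_quotient X) (class_susp_word X)"
    by (simp only: quotient_map_compose_eq[OF q])
  moreover have "inj_on (class_susp_word X) (topspace ?T)"
    using class_susp_word_iso[of X] by (simp add: topspace_pi1_top iso_def bij_betw_def)
  ultimately show ?thesis
    by (simp add: homeomorphic_map_def)
qed

text \<open>Exhibits the given topology as a pullback, so that
  \<open>topological_group_pullback\<close> can transfer the group structure.\<close>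

lemma pullback_topology_homeomorphic:
  assumes h: "homeomorphic_map T Q h"
  shows "pullback_topology (topspace T) h Q = T"
  unfolding topology_eq openin_pullback_topology
proof (intro allI iffI)
  fix S assume "\<exists>U. openin Q U \<and> S = h -` U \<inter> topspace T"
  then obtain U where U: "openin Q U" "S = h -` U \<inter> topspace T" by blast
  have "S = {x \<in> topspace T. h x \<in> U}"
    using U(2) by blast
  then show "openin T S"
    using openin_continuous_map_preimage[OF homeomorphic_imp_continuous_map[OF h] U(1)] by simp
next
  fix S assume S: "openin T S"
  have "openin Q (h ` S)"
    using homeomorphic_imp_open_map[OF h] S by (simp add: open_map_def)
  moreover have "S = h -` (h ` S) \<inter> topspace T"
    using homeomorphic_imp_injective_map[OF h] openin_subset[OF S] by (auto simp: inj_on_def)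
  ultimately show "\<exists>U. openin Q U \<and> S = h -` U \<inter> topspace T"
    by blast
qed

lemma topological_group_iso_transfer:
  fixes G :: "'g monoid" and F :: "'f monoid"
  assumes Q: "topological_group F Q" and G: "group G" and h: "h \<in> hom G F"
    and T: "homeomorphic_map T Q h" "topspace T = carrier G"
  shows "topological_group G T"
  using topological_group_pullback[OF G Q h] pullback_topology_homeomorphic[OF T(1)] T(2) by simp

lemma pi1_top_suspension_iff:
  "topological_group (susp_group X) (pi1_top (suspension_plus X) (suspension_base X)) \<and>
     Hausdorff_space (pi1_top (suspension_plus X) (suspension_base X)) \<longleftrightarrow>
   topological_group (free_group (topspace (pi0_top X))) (word_quotient X) \<and> Hausdorff_space (word_quotient X)"
proof -
  let ?T = "pi1_top (suspension_plus X) (suspension_base X)"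
  let ?G = "susp_group X" and ?F = "free_group (topspace (pi0_top X))"
  let ?h = "class_susp_word X"
  note homeo = homeomorphic_map_class_susp_word[of X]
  have h: "?h \<in> hom ?G ?F" "bij_betw ?h (carrier ?G) (carrier ?F)"
    using class_susp_word_iso[of X] by (simp_all add: iso_def)
  obtain k where k: "homeomorphic_maps ?T (word_quotient X) ?h k"
    using homeo homeomorphic_map_maps by blast
  have kh: "k (?h A) = A" if "A \<in> carrier ?G" for A
    using k that by (simp add: homeomorphic_maps_def topspace_pi1_top)
  have hk: "?h (k v) = v" "k v \<in> carrier ?G" if "v \<in> carrier ?F" for v
  proof -
    show "?h (k v) = v"
      using k that by (simp add: homeomorphic_maps_def topspace_word_quotient)
    show "k v \<in> carrier ?G"
      using funcset_mem[OF continuous_map_funspace, of "word_quotient X" ?T k v] k that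
      by (simp add: homeomorphic_maps_def topspace_word_quotient topspace_pi1_top)
  qed
  have closed: "A \<otimes>\<^bsub>?G\<^esub> B \<in> carrier ?G" if "A \<in> carrier ?G" "B \<in> carrier ?G" for A B
  proof -
    from that obtain f g where f: "f \<in> susp_loops X" "A = susp_class X f" and g: "g \<in> susp_loops X" "B = susp_class X g"
      unfolding carrier_susp_group by (elim imageE)
    show ?thesis
      unfolding f(2) g(2) fundamental_group_mult[OF f(1) g(1)] carrier_susp_group
      by (rule imageI[OF loop_concat_in_loops[OF f(1) g(1)]])
  qed
  have khom: "k \<in> hom ?F ?G"
  proof (rule homI)
    fix u v assume u: "u \<in> carrier ?F" and v: "v \<in> carrier ?F"
    show "k u \<in> carrier ?G" using hk(2)[OF u] .
    have "?h (k u \<otimes>\<^bsub>?G\<^esub> k v) = u \<otimes>\<^bsub>?F\<^esub> v"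
      using hom_mult[OF h(1) hk(2)[OF u] hk(2)[OF v]] hk(1)[OF u] hk(1)[OF v] by simp
    then show "k (u \<otimes>\<^bsub>?F\<^esub> v) = k u \<otimes>\<^bsub>?G\<^esub> k v"
      using kh[OF closed[OF hk(2)[OF u] hk(2)[OF v]]] by simp
  qed
  have kbij: "bij_betw k (carrier ?F) (carrier ?G)"
    by (rule bij_betw_byWitness[where f' = ?h])
      (use hk kh bij_betwE[OF h(2)] in auto)
  have one: "k \<one>\<^bsub>?F\<^esub> = \<one>\<^bsub>?G\<^esub>"
  proof -
    have c: "(\<lambda>t\<in>{0..1}. suspension_base X) \<in> susp_loops X"
      using word_loop_in_loops[of "[]" X] by (simp add: word_loop_def)
    have 1: "\<one>\<^bsub>?G\<^esub> = susp_class X (\<lambda>t\<in>{0..1}. suspension_base X)"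
      by (simp add: fundamental_group_def)
    then have "?h \<one>\<^bsub>?G\<^esub> = \<one>\<^bsub>?F\<^esub>"
      using class_susp_word_class[OF c] susp_word_const[of X] by (simp add: free_group_def)
    moreover have "\<one>\<^bsub>?G\<^esub> \<in> carrier ?G"
      unfolding 1 carrier_susp_group by (rule imageI[OF c])
    ultimately show ?thesis
      using kh by metis
  qed
  have F: "group ?F" by (rule group_free_group)
  \<comment> \<open>The group axioms of the fundamental group are transported from the free group
    along the inverse bijection \<open>k\<close>. This gives a group whose unit is the image of the
    empty word, which \<open>one\<close> identifies with the class of the constant loop.\<close>
  have "group (?G \<lparr>one := k \<one>\<^bsub>?F\<^esub>\<rparr>)"
    using khom kbij by (intro group.iso_imp_img_group[OF F]) (simp add: iso_def)
  then have G: "group ?G"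
    unfolding one by simp
  have "topological_group ?G ?T \<longleftrightarrow> topological_group ?F (word_quotient X)"
  proof
    assume "topological_group ?F (word_quotient X)"
    then show "topological_group ?G ?T"
      using G h(1) homeo topspace_pi1_top by (rule topological_group_iso_transfer)
  next
    assume "topological_group ?G ?T"
    moreover have "homeomorphic_map (word_quotient X) ?T k"
      using k homeomorphic_maps_map by blast
    ultimately show "topological_group ?F (word_quotient X)"
      using F khom topspace_word_quotient by (rule_tac topological_group_iso_transfer)
  qed
  moreover have "Hausdorff_space ?T \<longleftrightarrow> Hausdorff_space (word_quotient X)"
    using homeomorphic_Hausdorff_space homeomorphic_map_imp_homeomorphic_space[OF homeo] by blast
  ultimately show ?thesis by blast
qed

section \<open>Comparison with the free topological group\<close>

abbreviation letters :: "'a topology \<Rightarrow> nat \<Rightarrow> (nat \<Rightarrow> bool \<times> 'a) topology" where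
  "letters X n \<equiv> product_topology (\<lambda>_. letter_space X) {..<n}"

lemma
  shows topological_group_free_markov: "topological_group (free_group (topspace Y)) (free_markov Y)"
    and continuous_map_free_gen: "continuous_map Y (free_markov Y) free_gen"
    and topspace_free_markov: "topspace (free_markov Y) = carrier (free_group (topspace Y))"
  using free_topological_group_free_markov[of Y, where 'g = "'a word"]
  by (simp_all add: free_topological_group_def topological_group_def)

lemma continuous_map_topological_group_mult:
  assumes "topological_group G T" "continuous_map A T f" "continuous_map A T g"
  shows "continuous_map A T (\<lambda>a. f a \<otimes>\<^bsub>G\<^esub> g a)"
proof -
  have "continuous_map A (prod_topology T T) (\<lambda>a. (f a, g a))"
    using assms(2,3) by (simp add: continuous_map_paired)
  moreover have "continuous_map (prod_topology T T) T (\<lambda>(x, y). x \<otimes>\<^bsub>G\<^esub> y)"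
    using assms(1) by (simp add: topological_group_def)
  ultimately show ?thesis
    by (auto dest: continuous_map_compose simp: o_def)
qed

lemma continuous_map_topological_group_inv:
  assumes "topological_group G T" "continuous_map A T f"
  shows "continuous_map A T (\<lambda>a. inv\<^bsub>G\<^esub> f a)"
proof -
  have "continuous_map T T (\<lambda>x. inv\<^bsub>G\<^esub> x)"
    using assms(1) by (simp add: topological_group_def)
  from continuous_map_compose[OF assms(2) this] show ?thesis
    by (simp add: o_def)
qed

lemma inv_free_gen:
  assumes "y \<in> A"
  shows "inv\<^bsub>free_group A\<^esub> free_gen y = [(False, y)]"
proof (rule group.inv_equality[OF group_free_group])
  show "[(False, y)] \<otimes>\<^bsub>free_group A\<^esub> free_gen y = \<one>\<^bsub>free_group A\<^esub>"
    by (simp add: free_group_def reduce_def inv_letter_def)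
qed (use assms in \<open>simp_all add: free_group_def\<close>)

lemma continuous_map_letter_free_markov: "continuous_map (letter_space Y) (free_markov Y) (\<lambda>l. [l])"
  unfolding continuous_map_from_letter_space
proof
  fix b
  show "continuous_map Y (free_markov Y) (\<lambda>x. [(b, x)])"
  proof (cases b)
    case True
    then show ?thesis
      using continuous_map_free_gen[of Y] by simp
  next
    case False
    have "continuous_map Y (free_markov Y) (\<lambda>y. inv\<^bsub>free_group (topspace Y)\<^esub> free_gen y)"
      by (rule continuous_map_topological_group_inv[OF topological_group_free_markov continuous_map_free_gen])
    then show ?thesis
      by (rule continuous_map_eq) (simp add: inv_free_gen False)
  qed
qed

text \<open>The reduction of a word is the product of its letters in the free group, and products
  are continuous in the free topological group.\<close>

lemma continuous_map_reduce_free_markov: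
  assumes "\<And>w. w \<in> set ws \<Longrightarrow> continuous_map A (letter_space Y) w"
  shows "continuous_map A (free_markov Y) (\<lambda>a. reduce (map (\<lambda>w. w a) ws))"
  using assms
proof (induction ws)
  case Nil
  have "reduce [] \<in> carrier (free_group (topspace Y))"
    by (rule reduce_in_carrier) simp
  then show ?case
    by (simp add: topspace_free_markov)
next
  case (Cons w ws)
  have w: "continuous_map A (free_markov Y) (\<lambda>a. [w a])"
    using continuous_map_compose[OF Cons.prems[of w] continuous_map_letter_free_markov] by (simp add: o_def)
  have "continuous_map A (free_markov Y)
      (\<lambda>a. [w a] \<otimes>\<^bsub>free_group (topspace Y)\<^esub> reduce (map (\<lambda>w. w a) ws))"
    by (rule continuous_map_topological_group_mult[OF topological_group_free_markov w Cons.IH])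
      (use Cons.prems in simp)
  moreover have "[w a] \<otimes>\<^bsub>free_group (topspace Y)\<^esub> reduce (map (\<lambda>w. w a) ws) = reduce (map (\<lambda>w. w a) (w # ws))" for a
    using reduce_append_reduce_right[of "[w a]" "map (\<lambda>w. w a) ws"]
    unfolding free_group_def monoid.simps by (simp del: reduce_append_reduce_right)
  ultimately show ?case
    by simp
qed

lemma continuous_map_reduce_letters:
  "continuous_map (letters Y n) (free_markov Y) (\<lambda>y. reduce (map y [0..<n]))"
proof -
  let ?ws = "map (\<lambda>i x. x i) [0..<n]"
  have *: "continuous_map (letters Y n) (letter_space Y) w" if "w \<in> set ?ws" for w
    using that continuous_map_product_projection[of _ "{..<n}" "\<lambda>_. letter_space Y"] by auto
  show ?thesis
    using continuous_map_reduce_free_markov[of ?ws "letters Y n" Y, OF *] by (simp add: o_def)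
qed

lemma quotient_map_path_component: "quotient_map X (pi0_top X) (path_component_of_set X)"
  unfolding pi0_top_def by (rule quotient_map_quotient_topology)

lemma continuous_map_class_letter: "continuous_map (letter_space X) (letter_space (pi0_top X)) (class_letter X)"
  unfolding continuous_map_from_letter_space
proof
  fix b
  show "continuous_map X (letter_space (pi0_top X)) (\<lambda>x. class_letter X (b, x))"
    using continuous_map_compose[OF quotient_imp_continuous_map[OF quotient_map_path_component] continuous_map_letter]
    by (simp add: o_def class_letter_def)
qed

definition class_letters :: "'a topology \<Rightarrow> nat \<Rightarrow> (nat \<Rightarrow> bool \<times> 'a) \<Rightarrow> nat \<Rightarrow> bool \<times> 'a set" where
  "class_letters X n x = (\<lambda>i\<in>{..<n}. class_letter X (x i))"

lemma map_class_letters: "map (class_letters X n x) [0..<n] = class_word X (map x [0..<n])"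
  by (auto simp: class_letters_def intro: nth_equalityI)

lemma continuous_map_class_letters: "continuous_map (letters X n) (letters (pi0_top X) n) (class_letters X n)"
  unfolding class_letters_def[abs_def]
  by (rule continuous_map_coordinatewise[OF continuous_map_class_letter])

lemma closedin_letters_preimage:
  assumes "closedin (letters (pi0_top X) n) {y \<in> topspace (letters (pi0_top X) n). reduce (map y [0..<n]) \<in> C}"
  shows "closedin (letters X n) {x \<in> topspace (letters X n). reduce (class_word X (map x [0..<n])) \<in> C}"
proof -
  have "{x \<in> topspace (letters X n). class_letters X n x \<in>
      {y \<in> topspace (letters (pi0_top X) n). reduce (map y [0..<n]) \<in> C}} =
      {x \<in> topspace (letters X n). reduce (class_word X (map x [0..<n])) \<in> C}"
  proof (rule Collect_cong, rule conj_cong, rule refl)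
    fix x assume "x \<in> topspace (letters X n)"
    then have "class_letters X n x \<in> topspace (letters (pi0_top X) n)"
      by (rule funcset_mem[OF continuous_map_funspace[OF continuous_map_class_letters]])
    then show "class_letters X n x \<in> {y \<in> topspace (letters (pi0_top X) n). reduce (map y [0..<n]) \<in> C} \<longleftrightarrow>
        reduce (class_word X (map x [0..<n])) \<in> C"
      unfolding mem_Collect_eq map_class_letters by (simp only: simp_thms)
  qed
  then show ?thesis
    using closedin_continuous_map_preimage[OF continuous_map_class_letters assms] by (simp only:)
qed

lemma closedin_free_markov_imp_letters:
  assumes "closedin (free_markov Y) C"
  shows "closedin (letters Y n) {y \<in> topspace (letters Y n). reduce (map y [0..<n]) \<in> C}"
  by (rule closedin_continuous_map_preimage[OF continuous_map_reduce_letters assms])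

text \<open>Reduction of words in \<open>X\<close> is continuous into the free topological group, so
  the quotient topology is always the finer one.\<close>

lemma closedin_free_markov_imp_word_quotient:
  assumes "closedin (free_markov (pi0_top X)) C"
  shows "closedin (word_quotient X) C"
  unfolding closedin_word_quotient
  using closedin_subset[OF assms] closedin_letters_preimage[OF closedin_free_markov_imp_letters[OF assms]]
  by (simp add: topspace_free_markov)

lemma word_quotient_eq_free_markovI:
  assumes "\<And>C. closedin (word_quotient X) C \<Longrightarrow> closedin (free_markov (pi0_top X)) C"
  shows "word_quotient X = free_markov (pi0_top X)"
  unfolding topology_eq
proof
  fix U
  have "openin (word_quotient X) U \<longleftrightarrow> U \<subseteq> carrier (free_group (topspace (pi0_top X))) \<and>
      closedin (word_quotient X) (carrier (free_group (topspace (pi0_top X))) - U)"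
    using openin_closedin_eq topspace_word_quotient by metis
  moreover have "openin (free_markov (pi0_top X)) U \<longleftrightarrow> U \<subseteq> carrier (free_group (topspace (pi0_top X))) \<and>
      closedin (free_markov (pi0_top X)) (carrier (free_group (topspace (pi0_top X))) - U)"
    using openin_closedin_eq topspace_free_markov by metis
  ultimately show "openin (word_quotient X) U \<longleftrightarrow> openin (free_markov (pi0_top X)) U"
    using assms closedin_free_markov_imp_word_quotient by blast
qed

text \<open>Words of length one make the generators continuous for the quotient topology. The
  universal property then extends them to a continuous homomorphism from the free topological group,
  and it fixes the generators, so it is the identity.\<close>

lemma word_quotient_eq_free_markov:
  assumes Q: "topological_group (free_group (topspace (pi0_top X))) (word_quotient X)"
  shows "word_quotient X = free_markov (pi0_top X)"
proof (rule word_quotient_eq_free_markovI)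
  let ?Y = "pi0_top X"
  let ?F = "free_group (topspace ?Y)"
  have "continuous_map X (word_quotient X) (\<lambda>x. free_gen (path_component_of_set X x))"
  proof -
    have "continuous_map X (letters X 1) (\<lambda>x. \<lambda>i\<in>{..<1}. (True, x))"
      unfolding continuous_map_componentwise using continuous_map_letter[of X True] by auto
    from continuous_map_compose[OF this continuous_map_component_injection[of 1 UNIV "letters X"]]
    have "continuous_map X (word_sum X) (\<lambda>x. (1, \<lambda>i\<in>{..<1}. (True, x)))"
      by (simp add: word_sum_def o_def)
    from continuous_map_compose[OF this quotient_imp_continuous_map[OF
          quotient_map_quotient_topology[of "word_sum X" "class_reduction X"]]]
    show ?thesis
      by (simp add: o_def class_reduction_def class_letter_def word_quotient_def reduce_def)
  qed
  then have \<sigma>: "continuous_map ?Y (word_quotient X) free_gen"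
    using continuous_compose_quotient_map[OF quotient_map_path_component, of X _ free_gen] by (simp add: o_def)
  have "\<exists>!h. h \<in> extensional (carrier ?F) \<and> h \<in> hom ?F ?F \<and> continuous_map (free_markov ?Y) (word_quotient X) h \<and>
      (\<forall>y\<in>topspace ?Y. h (free_gen y) = free_gen y)"
    using free_topological_group_free_markov[of ?Y, where 'g = "'a set word"] Q \<sigma>
    unfolding free_topological_group_def by blast
  then obtain h where h: "h \<in> hom ?F ?F" "continuous_map (free_markov ?Y) (word_quotient X) h"
      "\<forall>y\<in>topspace ?Y. h (free_gen y) = free_gen y"
    by blast
  have "(\<lambda>w. w) \<in> hom ?F ?F"
    by (simp add: hom_def)
  then have id: "h w = w" if "w \<in> carrier ?F" for w
    using free_group_hom_unique[OF group_free_group h(1) _ _ that] h(3) by blast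
  fix C assume C: "closedin (word_quotient X) C"
  have "{w \<in> topspace (free_markov ?Y). h w \<in> C} = C"
    using closedin_subset[OF C] id unfolding topspace_free_markov topspace_word_quotient by auto
  then show "closedin (free_markov ?Y) C"
    using closedin_continuous_map_preimage[OF h(2) C] by simp
qed

section \<open>Cancellation in words of bounded length\<close>

lemma not_reducedE:
  assumes "\<not> reduced w"
  obtains u l v where "w = u @ l # inv_letter l # v"
proof -
  have "\<exists>u l v. w = u @ l # inv_letter l # v"
    using assms
  proof (induction w rule: reduced.induct)
    case (1 l m w)
    show ?case
    proof (cases "m = inv_letter l")
      case True
      then show ?thesis by (metis append_Nil)
    next
      case False
      then obtain u k v where "m # w = u @ k # inv_letter k # v"
        using 1 by auto
      then show ?thesis by (metis append_Cons)
    qed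
  qed simp_all
  then show thesis using that by blast
qed

lemma reduce_cancel: "reduce (u @ l # inv_letter l # v) = reduce (u @ v)"
proof -
  have "reduce (l # inv_letter l # v) = reduce v"
    using push_push_inv[of "reduce v" l] by (simp add: reduce_def[of "l # _"] reduce_def[symmetric])
  then show ?thesis
    by (simp only: reduce_append)
qed

lemma Hausdorff_letter_space:
  assumes Y: "Hausdorff_space Y"
  shows "Hausdorff_space (letter_space Y)"
  unfolding Hausdorff_space_def
proof (intro allI impI)
  fix l m assume lm: "l \<in> topspace (letter_space Y) \<and> m \<in> topspace (letter_space Y) \<and> l \<noteq> m"
  show "\<exists>U V. openin (letter_space Y) U \<and> openin (letter_space Y) V \<and> l \<in> U \<and> m \<in> V \<and> disjnt U V"
  proof (cases "fst l = fst m")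
    case False
    then show ?thesis
      using lm openin_fst_letter[of Y "{fst l}"] openin_fst_letter[of Y "{fst m}"]
      by (intro exI[of _ "{k \<in> topspace (letter_space Y). fst k \<in> {fst l}}"]
          exI[of _ "{k \<in> topspace (letter_space Y). fst k \<in> {fst m}}"]) (auto simp: disjnt_def)
  next
    case True
    then have "snd l \<noteq> snd m" "snd l \<in> topspace Y" "snd m \<in> topspace Y"
      using lm by (auto simp: prod_eq_iff)
    then obtain U V where UV: "openin Y U" "openin Y V" "snd l \<in> U" "snd m \<in> V" "disjnt U V"
      using Y unfolding Hausdorff_space_def by blast
    have "openin (letter_space Y) {k \<in> topspace (letter_space Y). snd k \<in> W}" if "openin Y W" for W
      by (rule openin_continuous_map_preimage[OF continuous_map_snd_letter that])
    then show ?thesis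
      using UV lm by (intro exI[of _ "{k \<in> topspace (letter_space Y). snd k \<in> U}"]
          exI[of _ "{k \<in> topspace (letter_space Y). snd k \<in> V}"]) (auto simp: disjnt_def)
  qed
qed

lemma continuous_map_inv_letter: "continuous_map (letter_space Y) (letter_space Y) inv_letter"
  unfolding continuous_map_from_letter_space inv_letter_def
  by (simp add: continuous_map_letter)

text \<open>A word of length \<open>k > n\<close> whose reduction has length at most \<open>n\<close> contains two adjacent
  cancelling letters, and cancelling letters form a closed set as the path component space is Hausdorff.\<close>

lemma closedin_letters_of_short_words:
  assumes Y: "Hausdorff_space (pi0_top X)" and C: "\<And>v. v \<in> C \<Longrightarrow> length v \<le> n"
    and short: "\<And>i. i \<le> n \<Longrightarrow>
      closedin (letters X i) {x \<in> topspace (letters X i). reduce (class_word X (map x [0..<i])) \<in> C}"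
  shows "closedin (letters X k) {x \<in> topspace (letters X k). reduce (class_word X (map x [0..<k])) \<in> C}"
proof (induction k rule: less_induct)
  case (less k)
  show ?case
  proof (cases "k \<le> n")
    case True
    then show ?thesis by (rule short)
  next
    case False
    \<comment> \<open>\<open>del i\<close> deletes the letters \<open>i\<close> and
      \<open>i + 1\<close>. \<open>D i\<close> says that these two cancel, and \<open>E i\<close>
      that the remaining shorter word reduces into \<open>C\<close>, a closed condition by
      induction.\<close>
    define del where "del i x = (\<lambda>j\<in>{..<k - 2}. if j < i then x j else x (j + 2))"
      for i and x :: "nat \<Rightarrow> bool \<times> 'a"
    define D where "D i = {x \<in> topspace (letters X k). class_letter X (x (Suc i)) = inv_letter (class_letter X (x i))}" for i
    define E where "E i = {x \<in> topspace (letters X k). del i x \<in>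
      {y \<in> topspace (letters X (k - 2)). reduce (class_word X (map y [0..<k - 2])) \<in> C}}" for i
    have proj: "continuous_map (letters X k) (letter_space X) (\<lambda>x. x i)" if "i < k" for i
      using continuous_map_product_projection[of i "{..<k}" "\<lambda>_. letter_space X"] that by simp
    have D: "closedin (letters X k) (D i)" if "Suc i < k" for i
      unfolding D_def
    proof (rule closedin_continuous_maps_eq[OF Hausdorff_letter_space[OF Y]])
      show "continuous_map (letters X k) (letter_space (pi0_top X)) (\<lambda>x. class_letter X (x (Suc i)))"
        using continuous_map_compose[OF proj continuous_map_class_letter, of "Suc i"] that by (simp add: o_def)
      show "continuous_map (letters X k) (letter_space (pi0_top X)) (\<lambda>x. inv_letter (class_letter X (x i)))"
        using continuous_map_compose[OF continuous_map_compose[OF proj continuous_map_class_letter]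
            continuous_map_inv_letter, of i] that by (simp add: o_def)
    qed
    have del: "continuous_map (letters X k) (letters X (k - 2)) (del i)" if "Suc i < k" for i
      unfolding del_def[abs_def] continuous_map_componentwise
    proof (intro conjI ballI)
      fix j assume "j \<in> {..<k - 2}"
      then have "j < k - 2" "j < k" "j + 2 < k" by auto
      then show "continuous_map (letters X k) (letter_space X) (\<lambda>x. (\<lambda>j\<in>{..<k - 2}. if j < i then x j else x (j + 2)) j)"
        using proj[of j] proj[of "j + 2"] by simp
    qed auto
    have E: "closedin (letters X k) (E i)" if "Suc i < k" for i
      unfolding E_def using False
      by (intro closedin_continuous_map_preimage[OF del[OF that]] less.IH) simp
    have split: "map x [0..<k] = take i (map (del i x) [0..<k - 2]) @ x i # x (Suc i) # drop i (map (del i x) [0..<k - 2])"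
      if "Suc i < k" for i x
    proof (rule nth_equalityI)
      fix j assume "j < length (map x [0..<k])"
      then have "j < k" by simp
      consider "j < i" | "j = i" | "j = Suc i" | "Suc i < j" by linarith
      then show "map x [0..<k] ! j =
          (take i (map (del i x) [0..<k - 2]) @ x i # x (Suc i) # drop i (map (del i x) [0..<k - 2])) ! j"
      proof cases
        case 1
        then have "j < k - 2" using that by simp
        with 1 show ?thesis
          using \<open>j < k\<close> by (simp add: nth_append del_def)
      next
        case 4
        then obtain m where m: "j = Suc (Suc m)" "i \<le> m"
          by (metis Suc_leD Suc_less_eq less_imp_Suc_add less_eq_Suc_le le_add1)
        then have "m < k - 2" using \<open>j < k\<close> by simp
        with m that show ?thesis
          using \<open>j < k\<close> by (simp add: nth_append del_def)
      qed (use that in \<open>simp_all add: nth_append\<close>)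
    qed (use that in simp)
    have red: "reduce (class_word X (map x [0..<k])) = reduce (class_word X (map (del i x) [0..<k - 2]))"
      if "Suc i < k" "x \<in> D i" for i x
    proof -
      have c: "class_letter X (x (Suc i)) = inv_letter (class_letter X (x i))"
        using that(2) by (simp add: D_def)
      have "class_word X (map x [0..<k]) = class_word X (take i (map (del i x) [0..<k - 2])) @
          class_letter X (x i) # inv_letter (class_letter X (x i)) # class_word X (drop i (map (del i x) [0..<k - 2]))"
        unfolding split[OF that(1), of x] map_append list.map(2) c ..
      then have "reduce (class_word X (map x [0..<k])) =
          reduce (class_word X (take i (map (del i x) [0..<k - 2])) @ class_word X (drop i (map (del i x) [0..<k - 2])))"
        by (simp only: reduce_cancel)
      then show ?thesis
        by (simp only: map_append[symmetric] append_take_drop_id)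
    qed
    \<comment> \<open>A finite union of closed sets. Only the inclusion from left to right uses that
      words in \<open>C\<close> have length at most \<open>n < k\<close>: it forces some adjacent
      pair to cancel.\<close>
    have "{x \<in> topspace (letters X k). reduce (class_word X (map x [0..<k])) \<in> C} = (\<Union>i\<in>{..<k - 1}. D i \<inter> E i)"
    proof (intro equalityI subsetI)
      fix x assume "x \<in> {x \<in> topspace (letters X k). reduce (class_word X (map x [0..<k])) \<in> C}"
      then have x: "x \<in> topspace (letters X k)" and xC: "reduce (class_word X (map x [0..<k])) \<in> C"
        by blast+
      have "\<not> reduced (class_word X (map x [0..<k]))"
      proof
        assume "reduced (class_word X (map x [0..<k]))"
        then have "length (class_word X (map x [0..<k])) \<le> n"
          using C[OF xC] by (simp only: reduce_reduced)
        then show False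
          using False by simp
      qed
      then obtain u l v where ulv: "class_word X (map x [0..<k]) = u @ l # inv_letter l # v"
        by (rule not_reducedE)
      define i where "i = length u"
      have "length (class_word X (map x [0..<k])) = i + 2 + length v"
        unfolding ulv i_def by simp
      then have i: "Suc i < k" by simp
      have "class_word X (map x [0..<k]) ! i = l" "class_word X (map x [0..<k]) ! Suc i = inv_letter l"
        unfolding ulv i_def by (simp_all add: nth_append)
      then have "class_letter X (x (Suc i)) = inv_letter (class_letter X (x i))"
        using i by simp
      then have D: "x \<in> D i"
        using x by (simp add: D_def)
      have "del i x \<in> topspace (letters X (k - 2))"
        using funcset_mem[OF continuous_map_funspace[OF del[OF i]] x] .
      then have "x \<in> E i"
        using x xC unfolding red[OF i D] E_def by blast
      then show "x \<in> (\<Union>i\<in>{..<k - 1}. D i \<inter> E i)"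
        using D i by (intro UN_I[of i]) auto
    next
      fix x assume "x \<in> (\<Union>i\<in>{..<k - 1}. D i \<inter> E i)"
      then obtain i where "i < k - 1" and D: "x \<in> D i" and E: "x \<in> E i"
        by blast
      then have i: "Suc i < k" by simp
      show "x \<in> {x \<in> topspace (letters X k). reduce (class_word X (map x [0..<k])) \<in> C}"
        unfolding mem_Collect_eq red[OF i D] using E by (simp only: E_def mem_Collect_eq simp_thms)
    qed
    moreover have "closedin (letters X k) (\<Union>i\<in>{..<k - 1}. D i \<inter> E i)"
      by (intro closedin_Union finite_imageI) (auto intro!: closedin_Int D E)
    ultimately show ?thesis
      by simp
  qed
qed

section \<open>The characterization\<close>

lemma topspace_unreduced_words_upto:
  "topspace (unreduced_words_upto n Y) = Sigma {..n} (\<lambda>i. topspace (letters Y i))"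
  unfolding unreduced_words_upto_def topspace_sum_topology by (simp only: o_def)

lemma closedin_unreduced_words_upto:
  "closedin (unreduced_words_upto n Y) {p \<in> topspace (unreduced_words_upto n Y). reduction_map p \<in> C} \<longleftrightarrow>
     (\<forall>i\<le>n. closedin (letters Y i) {y \<in> topspace (letters Y i). reduce (map y [0..<i]) \<in> C})"
proof -
  define P where "P = {p \<in> topspace (unreduced_words_upto n Y). reduction_map p \<in> C}"
  have sub: "P \<subseteq> Sigma {..n} (topspace \<circ> letters Y)"
    unfolding P_def topspace_unreduced_words_upto o_def by (rule Collect_restrict)
  have eq: "{x. (i, x) \<in> P} = {y \<in> topspace (letters Y i). reduce (map y [0..<i]) \<in> C}" if "i \<le> n" for i
    unfolding P_def topspace_unreduced_words_upto reduction_map_def using that by simp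
  have "closedin (unreduced_words_upto n Y) P \<longleftrightarrow> (\<forall>i\<in>{..n}. closedin (letters Y i) {x. (i, x) \<in> P})"
    unfolding unreduced_words_upto_def closedin_sum_topology using sub by (simp only: simp_thms)
  also have "\<dots> \<longleftrightarrow> (\<forall>i\<le>n. closedin (letters Y i) {y \<in> topspace (letters Y i). reduce (map y [0..<i]) \<in> C})"
    unfolding Ball_def atMost_iff by (intro all_cong) (simp only: eq)
  finally show ?thesis
    unfolding P_def .
qed

lemma topspace_free_markov_upto: "topspace (free_markov_upto n Y) = words_upto n Y"
  by (auto simp: free_markov_upto_def topspace_free_markov words_upto_def)

lemma length_reduce: "length (reduce w) \<le> length w"
proof (induction w)
  case (Cons l w)
  have "length (push_letter l v) \<le> Suc (length v)" for v
    by (cases v) simp_all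
  from order_trans[OF this[of "reduce w"]] Cons show ?case
    by (simp add: reduce_def)
qed (simp add: reduce_def)

lemma reduce_map_in_words_upto:
  assumes "y \<in> topspace (letters Y i)" "i \<le> n"
  shows "reduce (map y [0..<i]) \<in> words_upto n Y"
  using reduce_in_carrier[OF set_map_letters[OF assms(1)]] length_reduce[of "map y [0..<i]"] assms(2)
  by (simp add: words_upto_def)

lemma reduction_map_image:
  "reduction_map ` topspace (unreduced_words_upto n Y) = topspace (free_markov_upto n Y)"
  unfolding topspace_free_markov_upto
proof (intro equalityI subsetI)
  fix v assume "v \<in> reduction_map ` topspace (unreduced_words_upto n Y)"
  then obtain i y where "i \<le> n" "y \<in> topspace (letters Y i)" "v = reduce (map y [0..<i])"
    unfolding topspace_unreduced_words_upto reduction_map_def by auto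
  then show "v \<in> words_upto n Y"
    using reduce_map_in_words_upto by blast
next
  fix v assume "v \<in> words_upto n Y"
  then have v: "set v \<subseteq> UNIV \<times> topspace Y" "reduced v" "length v \<le> n"
    by (simp_all add: words_upto_def free_group_def)
  let ?p = "(length v, \<lambda>i\<in>{..<length v}. v ! i)"
  have "?p \<in> topspace (unreduced_words_upto n Y)"
    unfolding topspace_unreduced_words_upto using restrict_nth_in_product[OF v(1) refl] v(3) by simp
  moreover have "reduction_map ?p = v"
    by (simp only: reduction_map_def case_prod_conv restrict_map_upt[OF refl] reduce_reduced[OF v(2)])
  ultimately show "v \<in> reduction_map ` topspace (unreduced_words_upto n Y)"
    by (metis image_eqI)
qed

lemma quotient_map_reduction_iff:
  "quotient_map (unreduced_words_upto n Y) (free_markov_upto n Y) reduction_map \<longleftrightarrow>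
     (\<forall>C \<subseteq> words_upto n Y. (\<forall>i\<le>n. closedin (letters Y i) {y \<in> topspace (letters Y i). reduce (map y [0..<i]) \<in> C})
        \<longleftrightarrow> closedin (free_markov_upto n Y) C)"
  unfolding quotient_map_closedin reduction_map_image closedin_unreduced_words_upto
  by (simp add: topspace_free_markov_upto)

lemma closedin_free_markov_uptoI:
  assumes "quotient_map (unreduced_words_upto n Y) (free_markov_upto n Y) reduction_map"
    and "C \<subseteq> words_upto n Y"
    and "\<And>i. i \<le> n \<Longrightarrow> closedin (letters Y i) {y \<in> topspace (letters Y i). reduce (map y [0..<i]) \<in> C}"
  shows "closedin (free_markov_upto n Y) C"
proof -
  have *: "(\<forall>i\<le>n. closedin (letters Y i) {y \<in> topspace (letters Y i). reduce (map y [0..<i]) \<in> C})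
      \<longleftrightarrow> closedin (free_markov_upto n Y) C"
    using assms(1,2) unfolding quotient_map_reduction_iff by (elim allE[of _ C]) (simp only: simp_thms)
  show ?thesis
    by (rule iffD1[OF *]) (intro allI impI assms(3))
qed

lemma closedin_free_markov_upto_imp_letters:
  assumes C: "closedin (free_markov_upto n Y) C" and i: "i \<le> n"
  shows "closedin (letters Y i) {y \<in> topspace (letters Y i). reduce (map y [0..<i]) \<in> C}"
proof -
  obtain K where K: "closedin (free_markov Y) K" "C = K \<inter> words_upto n Y"
    using C unfolding free_markov_upto_def closedin_subtopology by blast
  have "{y \<in> topspace (letters Y i). reduce (map y [0..<i]) \<in> C} =
      {y \<in> topspace (letters Y i). reduce (map y [0..<i]) \<in> K}"
    unfolding K(2) using reduce_map_in_words_upto[OF _ i] by blast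
  then show ?thesis
    using closedin_free_markov_imp_letters[OF K(1), of i] by simp
qed

text \<open>Words of length \<open>n\<close> form a disjoint union of open copies of the
  \<open>n\<close>-th power, one for each pattern of signs, so the quotient property of the power
  passes to words with signs.\<close>

lemma quotient_map_class_letters:
  assumes q: "quotient_map (product_topology (\<lambda>_. X) {..<n}) (product_topology (\<lambda>_. pi0_top X) {..<n})
      (power_map n (path_component_of_set X))"
  shows "quotient_map (letters X n) (letters (pi0_top X) n) (class_letters X n)"
  unfolding quotient_map_def
proof (intro conjI allI impI)
  let ?Y = "pi0_top X"
  show im: "class_letters X n ` topspace (letters X n) = topspace (letters ?Y n)"
  proof (intro equalityI subsetI)
    fix y assume "y \<in> class_letters X n ` topspace (letters X n)"
    then show "y \<in> topspace (letters ?Y n)"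
      using continuous_map_image_subset_topspace[OF continuous_map_class_letters] by blast
  next
    fix y assume y: "y \<in> topspace (letters ?Y n)"
    obtain w where w: "set w \<subseteq> UNIV \<times> topspace X" "class_word X w = map y [0..<n]"
      by (rule class_word_surj[OF set_map_letters[OF y]])
    have len: "length w = n"
      using arg_cong[OF w(2), of length] by simp
    have "class_letter X (w ! i) = y i" if "i < n" for i
      using arg_cong[OF w(2), of "\<lambda>v. v ! i"] that len by simp
    then have "class_letters X n (\<lambda>i\<in>{..<n}. w ! i) = y"
      using y by (auto simp: class_letters_def PiE_iff extensional_def fun_eq_iff)
    then show "y \<in> class_letters X n ` topspace (letters X n)"
      using restrict_nth_in_product[OF w(1) len] by (metis image_eqI)
  qed
  fix D assume D: "D \<subseteq> topspace (letters ?Y n)"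
  show "openin (letters X n) {x \<in> topspace (letters X n). class_letters X n x \<in> D} = openin (letters ?Y n) D"
  proof
    assume "openin (letters ?Y n) D"
    then show "openin (letters X n) {x \<in> topspace (letters X n). class_letters X n x \<in> D}"
      by (rule openin_continuous_map_preimage[OF continuous_map_class_letters])
  next
    assume pre: "openin (letters X n) {x \<in> topspace (letters X n). class_letters X n x \<in> D}"
    \<comment> \<open>Inserts the sign pattern \<open>s\<close>; openness of \<open>D\<close> will
      be checked separately for each pattern.\<close>
    define sg where "sg s z = (\<lambda>i\<in>{..<n}. (s i, z i))" for s :: "nat \<Rightarrow> bool" and z :: "nat \<Rightarrow> 'a"
    define sg' where "sg' s z = (\<lambda>i\<in>{..<n}. (s i, z i))" for s :: "nat \<Rightarrow> bool" and z :: "nat \<Rightarrow> 'a set"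
    have sg: "continuous_map (product_topology (\<lambda>_. X) {..<n}) (letters X n) (sg s)" for s
      unfolding sg_def[abs_def] by (rule continuous_map_coordinatewise[OF continuous_map_letter])
    have Ds: "openin (product_topology (\<lambda>_. ?Y) {..<n}) {z \<in> topspace (product_topology (\<lambda>_. ?Y) {..<n}). sg' s z \<in> D}" (is "openin _ (?D s)") for s
    proof -
      have eq: "class_letters X n (sg s z) = sg' s (power_map n (path_component_of_set X) z)" for z
        by (auto simp: class_letters_def sg_def sg'_def power_map_def class_letter_def fun_eq_iff)
      have "{z \<in> topspace (product_topology (\<lambda>_. X) {..<n}). power_map n (path_component_of_set X) z \<in> ?D s} =
          {z \<in> topspace (product_topology (\<lambda>_. X) {..<n}). sg s z \<in> {x \<in> topspace (letters X n). class_letters X n x \<in> D}}"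
      proof (rule Collect_cong, rule conj_cong, rule refl)
        fix z assume z: "z \<in> topspace (product_topology (\<lambda>_. X) {..<n})"
        have "power_map n (path_component_of_set X) z \<in> topspace (product_topology (\<lambda>_. ?Y) {..<n})"
          using funcset_mem[OF continuous_map_funspace[OF quotient_imp_continuous_map[OF q]] z] .
        moreover have "sg s z \<in> topspace (letters X n)"
          using funcset_mem[OF continuous_map_funspace[OF sg] z] .
        ultimately show "power_map n (path_component_of_set X) z \<in> ?D s \<longleftrightarrow>
            sg s z \<in> {x \<in> topspace (letters X n). class_letters X n x \<in> D}"
          unfolding mem_Collect_eq eq by (simp only: simp_thms)
      qed
      then have "openin (product_topology (\<lambda>_. X) {..<n})
          {z \<in> topspace (product_topology (\<lambda>_. X) {..<n}). power_map n (path_component_of_set X) z \<in> ?D s}"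
        using openin_continuous_map_preimage[OF sg pre, of s] by (simp only:)
      moreover have "?D s \<subseteq> topspace (product_topology (\<lambda>_. ?Y) {..<n})"
        by blast
      ultimately show ?thesis
        using q unfolding quotient_map_def by blast
    qed
    show "openin (letters ?Y n) D"
    proof (subst openin_subopen, rule ballI)
      fix y assume "y \<in> D"
      define s where "s i = fst (y i)" for i
      define U where "U = {y' \<in> topspace (letters ?Y n). (\<lambda>i\<in>{..<n}. snd (y' i)) \<in> ?D s}"
      \<comment> \<open>The open set of words with the sign pattern of \<open>y\<close>. The
        intersection with the whole space keeps this correct for \<open>n = 0\<close>, where the
        indexed intersection is empty.\<close>
      define V where "V = topspace (letters ?Y n) \<inter> (\<Inter>i\<in>{..<n}. {y' \<in> topspace (letters ?Y n).
          y' i \<in> {l \<in> topspace (letter_space ?Y). fst l \<in> {s i}}})"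
      have sndmap: "continuous_map (letters ?Y n) (product_topology (\<lambda>_. ?Y) {..<n}) (\<lambda>y'. \<lambda>i\<in>{..<n}. snd (y' i))"
        by (rule continuous_map_coordinatewise[OF continuous_map_snd_letter])
      have U: "openin (letters ?Y n) U"
        unfolding U_def by (rule openin_continuous_map_preimage[OF sndmap Ds])
      have V: "openin (letters ?Y n) V"
        unfolding V_def
      proof (rule openin_Int_Inter)
        fix T assume "T \<in> (\<lambda>i. {y' \<in> topspace (letters ?Y n).
          y' i \<in> {l \<in> topspace (letter_space ?Y). fst l \<in> {s i}}}) ` {..<n}"
        then obtain i where i: "i \<in> {..<n}" and T: "T = {y' \<in> topspace (letters ?Y n).
          y' i \<in> {l \<in> topspace (letter_space ?Y). fst l \<in> {s i}}}"
          by (rule imageE)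
        show "openin (letters ?Y n) T"
          unfolding T by (rule openin_continuous_map_preimage[OF
                continuous_map_product_projection[of i "{..<n}" "\<lambda>_. letter_space ?Y", OF i] openin_fst_letter])
      qed (simp_all only: finite_imageI finite_lessThan openin_topspace)
      have sg'y: "sg' s (\<lambda>i\<in>{..<n}. snd (y' i)) = y'"
        if "y' \<in> topspace (letters ?Y n)" "\<And>i. i < n \<Longrightarrow> fst (y' i) = s i" for y'
        using that by (auto simp: sg'_def PiE_iff extensional_def fun_eq_iff prod_eq_iff)
      have ytop: "y \<in> topspace (letters ?Y n)"
        using D \<open>y \<in> D\<close> by blast
      have yi: "y i \<in> topspace (letter_space ?Y)" if "i < n" for i
        using PiE_mem[of y "{..<n}" "\<lambda>_. topspace (letter_space ?Y)" i] ytop that by simp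
      have "y \<in> V"
        unfolding V_def using ytop yi by (auto simp: s_def)
      moreover have "y \<in> U"
        unfolding U_def using ytop sg'y[OF ytop] \<open>y \<in> D\<close> funcset_mem[OF continuous_map_funspace[OF sndmap] ytop]
        by (simp add: s_def)
      moreover have "y' \<in> D" if "y' \<in> U \<inter> V" for y'
      proof -
        have "y' \<in> topspace (letters ?Y n)" "fst (y' i) = s i" if "i < n" for i
          using \<open>y' \<in> U \<inter> V\<close> that unfolding V_def by auto
        moreover have "y' \<in> topspace (letters ?Y n)" "sg' s (\<lambda>i\<in>{..<n}. snd (y' i)) \<in> D"
          using that unfolding U_def by auto
        ultimately show ?thesis
          using sg'y[of y'] by simp
      qed
      ultimately show "\<exists>T. openin (letters ?Y n) T \<and> y \<in> T \<and> T \<subseteq> D"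
        using openin_Int[OF U V] by blast
    qed
  qed
qed

text \<open>Closedness is pushed from words in \<open>X\<close> to words in path components by the
  second condition, to reduced words of bounded length by the third, and to the whole free
  topological group by the fourth.\<close>

lemma conditions_imp_word_quotient_eq:
  assumes 2: "\<And>n. n \<ge> 1 \<Longrightarrow> quotient_map (product_topology (\<lambda>_. X) {..<n}) (product_topology (\<lambda>_. pi0_top X) {..<n})
      (power_map n (path_component_of_set X))"
    and 3: "\<And>n. n \<ge> 1 \<Longrightarrow> quotient_map (unreduced_words_upto n (pi0_top X)) (free_markov_upto n (pi0_top X)) reduction_map"
    and 4: "has_inductive_limit_topology (pi0_top X)"
  shows "word_quotient X = free_markov (pi0_top X)"
proof (rule word_quotient_eq_free_markovI)
  let ?Y = "pi0_top X"
  fix C assume C: "closedin (word_quotient X) C"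
  then have CF: "C \<subseteq> topspace (free_markov ?Y)"
    and CX: "closedin (letters X i) {x \<in> topspace (letters X i). reduce (class_word X (map x [0..<i])) \<in> C}" for i
    by (simp_all add: closedin_word_quotient topspace_free_markov)
  have CY: "closedin (letters ?Y i) {y \<in> topspace (letters ?Y i). reduce (map y [0..<i]) \<in> C}" for i
  proof (cases "i = 0")
    \<comment> \<open>The conditions are assumed for positive lengths only; for length 0 the space
      has one point and every subset is closed.\<close>
    case True
    have top: "topspace (letters ?Y 0) = {\<lambda>_. undefined}"
      by simp
    show ?thesis
    proof (cases "reduce [] \<in> C")
      case in_C: True
      then have "{y \<in> topspace (letters ?Y 0). reduce (map y [0..<0]) \<in> C} = topspace (letters ?Y 0)"
        by simp
      then show ?thesis
        unfolding True by (simp only: closedin_topspace)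
    next
      case False
      then have "{y \<in> topspace (letters ?Y 0). reduce (map y [0..<0]) \<in> C} = {}"
        by simp
      then show ?thesis
        unfolding True by (simp only: closedin_empty)
    qed
  next
    case False
    then have q: "quotient_map (letters X i) (letters ?Y i) (class_letters X i)"
      by (intro quotient_map_class_letters 2) simp
    let ?D = "{y \<in> topspace (letters ?Y i). reduce (map y [0..<i]) \<in> C}"
    have "{x \<in> topspace (letters X i). class_letters X i x \<in> ?D} =
        {x \<in> topspace (letters X i). reduce (class_word X (map x [0..<i])) \<in> C}"
    proof (rule Collect_cong, rule conj_cong, rule refl)
      fix x assume "x \<in> topspace (letters X i)"
      then have "class_letters X i x \<in> topspace (letters ?Y i)"
        by (rule funcset_mem[OF continuous_map_funspace[OF continuous_map_class_letters]])
      then show "class_letters X i x \<in> ?D \<longleftrightarrow> reduce (class_word X (map x [0..<i])) \<in> C"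
        unfolding mem_Collect_eq map_class_letters by (simp only: simp_thms)
    qed
    then have "closedin (letters X i) {x \<in> topspace (letters X i). class_letters X i x \<in> ?D}"
      using CX by (simp only:)
    moreover have "?D \<subseteq> topspace (letters ?Y i)" by blast
    ultimately show ?thesis
      using q unfolding quotient_map_closedin by (elim conjE allE[of _ ?D]) (simp only: simp_thms)
  qed
  have "closedin (free_markov_upto n ?Y) (C \<inter> words_upto n ?Y)" for n
  proof (cases "n = 0")
    case True
    have "words_upto 0 ?Y = {[]}"
      by (auto simp: words_upto_def free_group_def)
    then have "C \<inter> words_upto 0 ?Y = {} \<or> C \<inter> words_upto 0 ?Y = topspace (free_markov_upto 0 ?Y)"
      by (cases "[] \<in> C") (simp_all add: topspace_free_markov_upto)
    then show ?thesis
      unfolding True by (elim disjE) (simp_all only: closedin_empty closedin_topspace)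
  next
    case False
    show ?thesis
    proof (rule closedin_free_markov_uptoI)
      show "quotient_map (unreduced_words_upto n ?Y) (free_markov_upto n ?Y) reduction_map"
        using False by (intro 3) simp
      fix i assume i: "i \<le> n"
      have eq: "{y \<in> topspace (letters ?Y i). reduce (map y [0..<i]) \<in> C \<inter> words_upto n ?Y} =
          {y \<in> topspace (letters ?Y i). reduce (map y [0..<i]) \<in> C}"
        using reduce_map_in_words_upto[OF _ i] by blast
      show "closedin (letters ?Y i) {y \<in> topspace (letters ?Y i). reduce (map y [0..<i]) \<in> C \<inter> words_upto n ?Y}"
        unfolding eq by (rule CY)
    qed (rule Int_lower2)
  qed
  then show "closedin (free_markov ?Y) C"
    using 4[unfolded has_inductive_limit_topology_def, THEN spec, THEN mp, OF CF] by (simp only: simp_thms)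
qed

text \<open>The diagonal is the preimage of the unit under the continuous map sending a pair to the
  first entry times the inverse of the second.\<close>

lemma Hausdorff_topological_group:
  assumes G: "topological_group G T" and one: "closedin T {\<one>\<^bsub>G\<^esub>}"
  shows "Hausdorff_space T"
  unfolding Hausdorff_space_closedin_diagonal
proof -
  interpret group G using G by (simp add: topological_group_def)
  have T: "topspace T = carrier G" using G by (simp add: topological_group_def)
  have "continuous_map (prod_topology T T) T (\<lambda>p. fst p \<otimes>\<^bsub>G\<^esub> inv\<^bsub>G\<^esub> snd p)"
    by (intro continuous_map_topological_group_mult[OF G] continuous_map_topological_group_inv[OF G]
        continuous_map_fst continuous_map_snd)
  from closedin_continuous_map_preimage[OF this one]
  have "closedin (prod_topology T T) {p \<in> topspace (prod_topology T T). fst p \<otimes>\<^bsub>G\<^esub> inv\<^bsub>G\<^esub> snd p \<in> {\<one>\<^bsub>G\<^esub>}}" .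
  moreover have "{p \<in> topspace (prod_topology T T). fst p \<otimes>\<^bsub>G\<^esub> inv\<^bsub>G\<^esub> snd p \<in> {\<one>\<^bsub>G\<^esub>}} =
      (\<lambda>x. (x, x)) ` topspace T" (is "?A = ?B")
  proof (rule equalityI)
    show "?A \<subseteq> ?B"
    proof
      fix p assume p: "p \<in> ?A"
      obtain a b where ab: "p = (a, b)" by (cases p)
      have c: "a \<in> carrier G" "b \<in> carrier G" "a \<otimes>\<^bsub>G\<^esub> inv\<^bsub>G\<^esub> b = \<one>\<^bsub>G\<^esub>"
        using p unfolding ab topspace_prod_topology T by simp_all
      have "inv\<^bsub>G\<^esub> (inv\<^bsub>G\<^esub> b) = a"
        by (rule inv_equality) (use c in simp_all)
      then have "a = b"
        using c(2) by simp
      then show "p \<in> ?B"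
        unfolding ab T using c(1) by blast
    qed
    show "?B \<subseteq> ?A"
      unfolding topspace_prod_topology T by (rule image_subsetI) simp
  qed
  ultimately show "closedin (prod_topology T T) ((\<lambda>x. (x, x)) ` topspace T)"
    by simp
qed

lemma word_quotient_Hausdorff_group_iff:
  "topological_group (free_group (topspace (pi0_top X))) (word_quotient X) \<and> Hausdorff_space (word_quotient X) \<longleftrightarrow>
     Hausdorff_space (pi0_top X) \<and>
     (\<forall>n\<ge>1. quotient_map (product_topology (\<lambda>_. X) {..<n}) (product_topology (\<lambda>_. pi0_top X) {..<n})
        (power_map n (path_component_of_set X))) \<and>
     (\<forall>n\<ge>1. quotient_map (unreduced_words_upto n (pi0_top X)) (free_markov_upto n (pi0_top X)) reduction_map) \<and>
     has_inductive_limit_topology (pi0_top X)"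
  (is "?L \<longleftrightarrow> ?H \<and> ?c2 \<and> ?c3 \<and> ?c4")
proof
  let ?Y = "pi0_top X"
  assume "?H \<and> ?c2 \<and> ?c3 \<and> ?c4"
  then have H: ?H and eq: "word_quotient X = free_markov ?Y"
    by (blast intro: conditions_imp_word_quotient_eq)+
  have G: "topological_group (free_group (topspace ?Y)) (word_quotient X)"
    unfolding eq by (rule topological_group_free_markov)
  \<comment> \<open>The empty word is the only word of length 0, so
    \<open>closedin_letters_of_short_words\<close> with \<open>n = 0\<close> makes the unit
    closed.\<close>
  have "closedin (letters X k) {x \<in> topspace (letters X k). reduce (class_word X (map x [0..<k])) \<in> {[]}}" for k
  proof (rule closedin_letters_of_short_words[OF H, where n = 0])
    fix i :: nat assume "i \<le> 0"
    then have "{x \<in> topspace (letters X i). reduce (class_word X (map x [0..<i])) \<in> {[]}} = topspace (letters X i)"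
      by (simp add: reduce_def)
    then show "closedin (letters X i) {x \<in> topspace (letters X i). reduce (class_word X (map x [0..<i])) \<in> {[]}}"
      by (simp only: closedin_topspace)
  qed simp
  then have "closedin (word_quotient X) {\<one>\<^bsub>free_group (topspace ?Y)\<^esub>}"
    unfolding closedin_word_quotient by (simp add: free_group_def)
  with G show ?L
    by (blast intro: Hausdorff_topological_group)
next
  let ?Y = "pi0_top X"
  assume L: ?L
  then have eq: "word_quotient X = free_markov ?Y"
    by (blast intro: word_quotient_eq_free_markov)
  have HM: "Hausdorff_space (free_markov ?Y)"
    using L unfolding eq by blast
  \<comment> \<open>The generators map the path component space continuously and injectively into a
    Hausdorff space.\<close>
  have H: ?H
    by (rule Hausdorff_space_injective_preimage[OF HM continuous_map_free_gen]) (simp add: inj_on_def)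
  \<comment> \<open>The hypothesis is about words in \<open>X\<close>, not in path components. This
    makes the fact usable for the second condition as well, where closedness over \<open>X\<close>
    is all that is known.\<close>
  have short: "closedin (free_markov ?Y) C"
    if C: "C \<subseteq> words_upto n ?Y"
      and "\<And>i. i \<le> n \<Longrightarrow> closedin (letters X i) {x \<in> topspace (letters X i). reduce (class_word X (map x [0..<i])) \<in> C}" for C n
  proof -
    have "length v \<le> n" if "v \<in> C" for v
      using C that by (auto simp: words_upto_def)
    from closedin_letters_of_short_words[OF H this that(2)]
    have "closedin (word_quotient X) C"
      unfolding closedin_word_quotient using C by (auto simp: words_upto_def)
    then show ?thesis
      unfolding eq .
  qed
  have ?c3
    unfolding quotient_map_reduction_iff
  proof (intro allI impI iffI)
    fix n C assume C: "C \<subseteq> words_upto n ?Y"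
      and cl: "\<forall>i\<le>n. closedin (letters ?Y i) {y \<in> topspace (letters ?Y i). reduce (map y [0..<i]) \<in> C}"
    have "closedin (free_markov ?Y) C"
      by (rule short[OF C closedin_letters_preimage]) (use cl in blast)
    then show "closedin (free_markov_upto n ?Y) C"
      unfolding free_markov_upto_def closedin_subtopology using C by blast
  next
    fix n C i assume "closedin (free_markov_upto n ?Y) C" "i \<le> n"
    then show "closedin (letters ?Y i) {y \<in> topspace (letters ?Y i). reduce (map y [0..<i]) \<in> C}"
      by (rule closedin_free_markov_upto_imp_letters)
  qed
  moreover have ?c4
    unfolding has_inductive_limit_topology_def
  proof (intro allI impI iffI)
    fix C n assume "closedin (free_markov ?Y) C"
    then show "closedin (free_markov_upto n ?Y) (C \<inter> words_upto n ?Y)"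
      unfolding free_markov_upto_def closedin_subtopology by blast
  next
    fix C assume C: "C \<subseteq> topspace (free_markov ?Y)"
      and cl: "\<forall>n. closedin (free_markov_upto n ?Y) (C \<inter> words_upto n ?Y)"
    have "closedin (letters X n) {x \<in> topspace (letters X n). reduce (class_word X (map x [0..<n])) \<in> C}" for n
    proof -
      \<comment> \<open>Words of \<open>n\<close> letters reduce to length at most \<open>n\<close>,
        so on them \<open>C\<close> may be cut down to words of length at most \<open>n\<close>,
        where closedness is given.\<close>
      have "{y \<in> topspace (letters ?Y n). reduce (map y [0..<n]) \<in> C \<inter> words_upto n ?Y} =
          {y \<in> topspace (letters ?Y n). reduce (map y [0..<n]) \<in> C}"
        using reduce_map_in_words_upto by blast
      then have "closedin (letters ?Y n) {y \<in> topspace (letters ?Y n). reduce (map y [0..<n]) \<in> C}"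
        using closedin_free_markov_upto_imp_letters[of n ?Y "C \<inter> words_upto n ?Y" n] cl by simp
      then show ?thesis
        by (rule closedin_letters_preimage)
    qed
    then have "closedin (word_quotient X) C"
      unfolding closedin_word_quotient using C by (simp add: topspace_free_markov)
    then show "closedin (free_markov ?Y) C"
      unfolding eq .
  qed
  \<comment> \<open>The positive words \<open>w y\<close> map the \<open>n\<close>-th power of the
    path component space continuously and injectively into the free topological group. If the
    preimage of \<open>D\<close> over \<open>X\<close> is closed, \<open>short\<close> makes
    \<open>w\<close> applied to all of \<open>D\<close> a closed set, and \<open>D\<close> is its
    preimage under \<open>w\<close>.\<close>
  moreover have ?c2
    unfolding quotient_map_closedin
  proof (intro allI impI conjI)
    fix n :: nat
    let ?XN = "product_topology (\<lambda>_. X) {..<n}" and ?YN = "product_topology (\<lambda>_. ?Y) {..<n}"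
    let ?P = "power_map n (path_component_of_set X)"
    have P: "continuous_map ?XN ?YN ?P"
      unfolding power_map_def
      by (rule continuous_map_coordinatewise[OF quotient_imp_continuous_map[OF quotient_map_path_component]])
    show "?P ` topspace ?XN = topspace ?YN"
    proof (intro equalityI subsetI)
      fix y assume "y \<in> ?P ` topspace ?XN"
      then show "y \<in> topspace ?YN"
        using continuous_map_image_subset_topspace[OF P] by blast
    next
      fix y assume y: "y \<in> topspace ?YN"
      have "\<exists>x. x \<in> topspace X \<and> path_component_of_set X x = y i" if "i < n" for i
        using PiE_mem[of y "{..<n}" "\<lambda>_. topspace ?Y" i] y that by (simp add: pi0_top_def) (metis imageE)
      then obtain r where r: "\<And>i. i < n \<Longrightarrow> r i \<in> topspace X \<and> path_component_of_set X (r i) = y i"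
        by metis
      have "?P (restrict r {..<n}) = y"
        using r y by (auto simp: power_map_def PiE_iff extensional_def fun_eq_iff)
      moreover have "restrict r {..<n} \<in> topspace ?XN"
        using r by simp
      ultimately show "y \<in> ?P ` topspace ?XN"
        by (metis image_eqI)
    qed
    fix D assume D: "D \<subseteq> topspace ?YN"
    show "closedin ?XN {x \<in> topspace ?XN. ?P x \<in> D} = closedin ?YN D"
    proof
      assume "closedin ?YN D"
      then show "closedin ?XN {x \<in> topspace ?XN. ?P x \<in> D}"
        by (rule closedin_continuous_map_preimage[OF P])
    next
      assume pre: "closedin ?XN {x \<in> topspace ?XN. ?P x \<in> D}"
      define w where "w y = map (\<lambda>i. (True, y i)) [0..<n]" for y :: "nat \<Rightarrow> 'a set"
      have red: "reduced (map (\<lambda>i. (True, z i)) is)" for z :: "nat \<Rightarrow> 'a set" and "is"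
        by (induction "is" rule: induct_list012) (auto simp: inv_letter_def)
      have wn: "w y = map (\<lambda>i. (True, y i)) [0..<n]" "reduced (w y)" "length (w y) = n" for y
        using red by (simp_all add: w_def)
      have wc: "continuous_map ?YN (free_markov ?Y) w"
      proof -
        have "continuous_map ?YN (letters ?Y n) (\<lambda>y. \<lambda>i\<in>{..<n}. (True, y i))"
          by (rule continuous_map_coordinatewise[OF continuous_map_letter])
        from continuous_map_compose[OF this continuous_map_reduce_letters]
        have "continuous_map ?YN (free_markov ?Y) (\<lambda>y. reduce (map (\<lambda>i\<in>{..<n}. (True, y i)) [0..<n]))"
          by (simp only: o_def)
        moreover have "reduce (map (\<lambda>i\<in>{..<n}. (True, y i)) [0..<n]) = w y" for y
        proof -
          have "map (\<lambda>i\<in>{..<n}. (True, y i)) [0..<n] = w y"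
            by (simp add: w_def)
          then show ?thesis
            using wn(2) by simp
        qed
        ultimately show ?thesis
          by simp
      qed
      have winj: "y = z" if "y \<in> topspace ?YN" "z \<in> topspace ?YN" "w y = w z" for y z
        using that by (auto simp: w_def PiE_iff extensional_def fun_eq_iff)
      have "closedin (free_markov ?Y) (w ` D)"
      proof (rule short[where n = n])
        show "w ` D \<subseteq> words_upto n ?Y"
        proof (rule image_subsetI)
          fix y assume "y \<in> D"
          then have "w y \<in> topspace (free_markov ?Y)"
            using funcset_mem[OF continuous_map_funspace[OF wc]] D by blast
          then show "w y \<in> words_upto n ?Y"
            using wn(3) by (simp add: words_upto_def topspace_free_markov)
        qed
        fix i assume i: "i \<le> n"
        show "closedin (letters X i) {x \<in> topspace (letters X i). reduce (class_word X (map x [0..<i])) \<in> w ` D}"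
        proof (cases "i = n")
          case False
          \<comment> \<open>Fewer than \<open>n\<close> letters cannot reduce to a word of length
            \<open>n\<close>.\<close>
          have "reduce (class_word X (map x [0..<i])) \<notin> w ` D" for x
          proof
            assume "reduce (class_word X (map x [0..<i])) \<in> w ` D"
            then have "length (reduce (class_word X (map x [0..<i]))) = n"
              using wn(3) by (elim imageE) simp
            then show False
              using length_reduce[of "class_word X (map x [0..<i])"] i False by simp
          qed
          then have "{x \<in> topspace (letters X i). reduce (class_word X (map x [0..<i])) \<in> w ` D} = {}"
            by blast
          then show ?thesis
            by (simp only: closedin_empty)
        next
          case True
          let ?A = "{x \<in> topspace ?XN. ?P x \<in> D}"
          \<comment> \<open>The open set of words with some negative letter; the words in question
            are the positive ones whose underlying points lie over \<open>D\<close>.\<close>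
          let ?N = "\<Union>i\<in>{..<n}. {x \<in> topspace (letters X n). x i \<in> {l \<in> topspace (letter_space X). fst l \<in> {False}}}"
          have "openin (letters X n) ?N"
          proof (rule openin_Union)
            fix T assume "T \<in> (\<lambda>i. {x \<in> topspace (letters X n). x i \<in> {l \<in> topspace (letter_space X). fst l \<in> {False}}}) ` {..<n}"
            then obtain i where i: "i \<in> {..<n}" and T: "T = {x \<in> topspace (letters X n). x i \<in> {l \<in> topspace (letter_space X). fst l \<in> {False}}}"
              by (rule imageE)
            show "openin (letters X n) T"
              unfolding T by (rule openin_continuous_map_preimage[OF
                continuous_map_product_projection[of i "{..<n}" "\<lambda>_. letter_space X", OF i] openin_fst_letter])
          qed
          then have N: "closedin (letters X n) (topspace (letters X n) - ?N)"
            by (rule openin_closedin_eq[THEN iffD1, THEN conjunct2])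
          have sndmap: "continuous_map (letters X n) ?XN (\<lambda>x. \<lambda>i\<in>{..<n}. snd (x i))"
            by (rule continuous_map_coordinatewise[OF continuous_map_snd_letter])
          have "{x \<in> topspace (letters X n). reduce (class_word X (map x [0..<n])) \<in> w ` D} =
              (topspace (letters X n) - ?N) \<inter> {x \<in> topspace (letters X n). (\<lambda>i\<in>{..<n}. snd (x i)) \<in> ?A}"
          proof (intro equalityI subsetI)
            fix x assume "x \<in> {x \<in> topspace (letters X n). reduce (class_word X (map x [0..<n])) \<in> w ` D}"
            then obtain y where x: "x \<in> topspace (letters X n)" and y: "y \<in> D"
              and xy: "reduce (class_word X (map x [0..<n])) = w y"
              by blast
            \<comment> \<open>A word of \<open>n\<close> letters whose reduction still has length
              \<open>n\<close> admits no cancellation, as each cancellation would cost two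
              letters.\<close>
            have "class_word X (map x [0..<n]) = w y"
            proof (cases "reduced (class_word X (map x [0..<n]))")
              case True
              then show ?thesis using xy by (simp only: reduce_reduced)
            next
              case False
              then obtain u l v where ulv: "class_word X (map x [0..<n]) = u @ l # inv_letter l # v"
                by (rule not_reducedE)
              have "length (reduce (class_word X (map x [0..<n]))) \<le> length (u @ v)"
                unfolding ulv reduce_cancel by (rule length_reduce)
              moreover have "length (class_word X (map x [0..<n])) = length (u @ v) + 2"
                unfolding ulv by simp
              ultimately show ?thesis
                unfolding xy wn(3) by simp
            qed
            then have "class_letter X (x i) = (True, y i)" if "i < n" for i
              using that arg_cong[of _ _ "\<lambda>v. v ! i"] by (fastforce simp: w_def)
            then have xi: "fst (x i)" "path_component_of_set X (snd (x i)) = y i" if "i < n" for i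
              using that by (auto simp: class_letter_def prod_eq_iff)
            have "?P (\<lambda>i\<in>{..<n}. snd (x i)) = y"
              using xi y D by (auto simp: power_map_def PiE_iff extensional_def fun_eq_iff)
            then show "x \<in> (topspace (letters X n) - ?N) \<inter> {x \<in> topspace (letters X n). (\<lambda>i\<in>{..<n}. snd (x i)) \<in> ?A}"
              using x xi(1) y funcset_mem[OF continuous_map_funspace[OF sndmap] x] by auto
          next
            fix x assume x: "x \<in> (topspace (letters X n) - ?N) \<inter> {x \<in> topspace (letters X n). (\<lambda>i\<in>{..<n}. snd (x i)) \<in> ?A}"
            then have xt: "x \<in> topspace (letters X n)" and PD: "?P (\<lambda>i\<in>{..<n}. snd (x i)) \<in> D"
              by blast+
            have "fst (x i)" if "i < n" for i
              using x that PiE_mem[of x "{..<n}" "\<lambda>_. topspace (letter_space X)" i] xt by auto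
            then have "class_word X (map x [0..<n]) = w (?P (\<lambda>i\<in>{..<n}. snd (x i)))"
              by (auto simp: w_def power_map_def class_letter_def prod_eq_iff)
            then show "x \<in> {x \<in> topspace (letters X n). reduce (class_word X (map x [0..<n])) \<in> w ` D}"
              using xt PD wn(2) by simp
          qed
          moreover have "closedin (letters X n) {x \<in> topspace (letters X n). (\<lambda>i\<in>{..<n}. snd (x i)) \<in> ?A}"
            by (rule closedin_continuous_map_preimage[OF sndmap pre])
          ultimately show ?thesis
            unfolding True using closedin_Int[OF N] by (simp only:)
        qed
      qed
      from closedin_continuous_map_preimage[OF wc this]
      have "closedin ?YN {y \<in> topspace ?YN. w y \<in> w ` D}" .
      moreover have "{y \<in> topspace ?YN. w y \<in> w ` D} = D"
        using D winj by blast
      ultimately show "closedin ?YN D"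
        by simp
    qed
  qed
  ultimately show "?H \<and> ?c2 \<and> ?c3 \<and> ?c4"
    using H by blast
qed

section \<open>Topological groups are completely regular\<close>

text \<open>Two successive square roots of \<open>U\<close> are intersected and made symmetric.
  Products of three factors are wanted because the Birkhoff-Kakutani argument splits a factorization
  into a left part, one middle factor and a right part.\<close>

lemma topological_group_nbhd_cube:
  assumes G: "topological_group G T" and U: "openin T U" "\<one>\<^bsub>G\<^esub> \<in> U"
  obtains V where "openin T V" "\<one>\<^bsub>G\<^esub> \<in> V" "\<And>x. x \<in> V \<Longrightarrow> inv\<^bsub>G\<^esub> x \<in> V"
    "\<And>x y z. x \<in> V \<Longrightarrow> y \<in> V \<Longrightarrow> z \<in> V \<Longrightarrow> x \<otimes>\<^bsub>G\<^esub> y \<otimes>\<^bsub>G\<^esub> z \<in> U"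
proof -
  interpret group G using G by (simp add: topological_group_def)
  have T: "topspace T = carrier G" using G by (simp add: topological_group_def)
  have mult: "continuous_map (prod_topology T T) T (\<lambda>p. fst p \<otimes>\<^bsub>G\<^esub> snd p)"
    by (intro continuous_map_topological_group_mult[OF G] continuous_map_fst continuous_map_snd)
  have square: "\<exists>V. openin T V \<and> \<one>\<^bsub>G\<^esub> \<in> V \<and> (\<forall>x\<in>V. \<forall>y\<in>V. x \<otimes>\<^bsub>G\<^esub> y \<in> U)"
    if U: "openin T U" "\<one>\<^bsub>G\<^esub> \<in> U" for U
  proof -
    let ?W = "{p \<in> topspace (prod_topology T T). fst p \<otimes>\<^bsub>G\<^esub> snd p \<in> U}"
    have "openin (prod_topology T T) ?W"
      by (rule openin_continuous_map_preimage[OF mult U(1)])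
    moreover have "(\<one>\<^bsub>G\<^esub>, \<one>\<^bsub>G\<^esub>) \<in> ?W"
      using U(2) by (simp add: T)
    ultimately obtain A B where AB: "openin T A" "openin T B" "\<one>\<^bsub>G\<^esub> \<in> A" "\<one>\<^bsub>G\<^esub> \<in> B" "A \<times> B \<subseteq> ?W"
      unfolding openin_prod_topology_alt by meson
    then have "x \<otimes>\<^bsub>G\<^esub> y \<in> U" if "x \<in> A \<inter> B" "y \<in> A \<inter> B" for x y
      using that by auto
    then show ?thesis
      using openin_Int[OF AB(1,2)] AB(3,4) by blast
  qed
  obtain V1 where V1: "openin T V1" "\<one>\<^bsub>G\<^esub> \<in> V1" "\<And>x y. x \<in> V1 \<Longrightarrow> y \<in> V1 \<Longrightarrow> x \<otimes>\<^bsub>G\<^esub> y \<in> U"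
    using square[OF U] by blast
  obtain V2 where V2: "openin T V2" "\<one>\<^bsub>G\<^esub> \<in> V2" "\<And>x y. x \<in> V2 \<Longrightarrow> y \<in> V2 \<Longrightarrow> x \<otimes>\<^bsub>G\<^esub> y \<in> V1"
    using square[OF V1(1,2)] by blast
  define V where "V = (V1 \<inter> V2) \<inter> {x \<in> topspace T. inv\<^bsub>G\<^esub> x \<in> V1 \<inter> V2}"
  show thesis
  proof
    have inv: "continuous_map T T (\<lambda>x. inv\<^bsub>G\<^esub> x)"
      using G by (simp add: topological_group_def)
    have V12: "openin T (V1 \<inter> V2)"
      by (rule openin_Int[OF V1(1) V2(1)])
    show "openin T V"
      unfolding V_def by (rule openin_Int[OF V12 openin_continuous_map_preimage[OF inv V12]])
    show "\<one>\<^bsub>G\<^esub> \<in> V"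
      using V1(2) V2(2) by (simp add: V_def T)
    show "inv\<^bsub>G\<^esub> x \<in> V" if "x \<in> V" for x
      using that by (simp add: V_def T)
    show "x \<otimes>\<^bsub>G\<^esub> y \<otimes>\<^bsub>G\<^esub> z \<in> U" if "x \<in> V" "y \<in> V" "z \<in> V" for x y z
      using that V1(3) V2(3) by (simp add: V_def)
  qed
qed

text \<open>\<open>m\<close> is the first entry after which less than \<open>c\<close> remains. If
  \<open>as\<close> is nonempty, \<open>m\<close> and its successors together weigh at least
  \<open>c\<close>, which leaves less than \<open>c\<close> for \<open>as\<close>. In the induction
  \<open>d\<close> is the weight already passed.\<close>

lemma sum_list_split:
  fixes w :: "'b \<Rightarrow> real"
  assumes "\<And>x. 0 \<le> w x" "0 < c" "sum_list (map w L) < 2 * c" "L \<noteq> []"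
  obtains as m bs where "L = as @ m # bs" "sum_list (map w as) < c" "sum_list (map w bs) < c"
proof -
  have "\<exists>as m bs. L = as @ m # bs \<and> d + sum_list (map w as) < c \<and> sum_list (map w bs) < c"
    if "0 \<le> d" "d < c" "d + sum_list (map w L) < 2 * c" "L \<noteq> []" for d
    using that
  proof (induction L arbitrary: d)
    case (Cons m L)
    show ?case
    proof (cases "sum_list (map w L) < c")
      case True
      then show ?thesis
        using Cons.prems by (intro exI[of _ "[]"] exI[of _ m] exI[of _ L]) simp
    next
      case False
      then have "d + w m < c" "L \<noteq> []"
        using Cons.prems assms(2) by auto
      moreover have "0 \<le> d + w m"
        using Cons.prems(1) assms(1)[of m] by simp
      ultimately obtain as k bs where "L = as @ k # bs" "d + w m + sum_list (map w as) < c" "sum_list (map w bs) < c"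
        using Cons.IH[of "d + w m"] Cons.prems(3) by (auto simp: add.assoc)
      then show ?thesis
        by (intro exI[of _ "m # as"] exI[of _ k] exI[of _ bs]) simp
    qed
  qed simp
  from this[of 0] assms that show thesis
    by auto
qed

text \<open>The length function of Birkhoff and Kakutani: the infimum of the weights \<open>\<Sum> 2 ^ (- n)\<close> of all
  factorizations into elements of the neighbourhoods \<open>V n\<close>, truncated at \<open>1\<close>.\<close>

definition bk_weight :: "(nat \<times> 'g) list \<Rightarrow> real" where
  "bk_weight L = sum_list (map (\<lambda>p. (1/2) ^ fst p) L)"

definition bk_prod :: "'g monoid \<Rightarrow> (nat \<times> 'g) list \<Rightarrow> 'g" where
  "bk_prod G L = foldr (\<lambda>p x. snd p \<otimes>\<^bsub>G\<^esub> x) L \<one>\<^bsub>G\<^esub>"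

definition bk_norm :: "'g monoid \<Rightarrow> (nat \<Rightarrow> 'g set) \<Rightarrow> 'g \<Rightarrow> real" where
  "bk_norm G V x = Inf (insert 1 {bk_weight L | L. (\<forall>p\<in>set L. snd p \<in> V (fst p)) \<and> bk_prod G L = x})"

lemma bk_weight_nonneg: "0 \<le> bk_weight L"
  unfolding bk_weight_def by (rule sum_list_nonneg) auto

locale bk_nbhds = group G for G :: "'g monoid" (structure) +
  fixes V :: "nat \<Rightarrow> 'g set"
  assumes sub: "V n \<subseteq> carrier G"
    and one: "\<one> \<in> V n"
    and cube: "x \<in> V (Suc n) \<Longrightarrow> y \<in> V (Suc n) \<Longrightarrow> z \<in> V (Suc n) \<Longrightarrow> x \<otimes> y \<otimes> z \<in> V n"
begin

lemma V_decseq: "m \<le> n \<Longrightarrow> V n \<subseteq> V m"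
proof (induction rule: dec_induct)
  case (step n)
  have "V (Suc n) \<subseteq> V n"
  proof
    fix x assume x: "x \<in> V (Suc n)"
    then have "x \<in> carrier G" by (rule subsetD[OF sub])
    then show "x \<in> V n"
      using cube[OF x one one] by simp
  qed
  then show ?case using step.IH by blast
qed simp

lemma bk_prod_closed:
  assumes "\<forall>p\<in>set L. snd p \<in> V (fst p)"
  shows "bk_prod G L \<in> carrier G"
  using assms
proof (induction L)
  case (Cons p L)
  then have "snd p \<in> carrier G" "bk_prod G L \<in> carrier G"
    using subsetD[OF sub, of "snd p" "fst p"] by simp_all
  then show ?case by (simp add: bk_prod_def)
qed (simp add: bk_prod_def)

lemma bk_prod_append:
  assumes "\<forall>p\<in>set L. snd p \<in> V (fst p)" "\<forall>p\<in>set M. snd p \<in> V (fst p)"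
  shows "bk_prod G (L @ M) = bk_prod G L \<otimes> bk_prod G M"
  using assms(1)
proof (induction L)
  case Nil
  show ?case using bk_prod_closed[OF assms(2)] by (simp add: bk_prod_def)
next
  case (Cons p L)
  then have "snd p \<in> carrier G" "bk_prod G L \<in> carrier G"
    using subsetD[OF sub, of "snd p" "fst p"] bk_prod_closed[of L] by simp_all
  with Cons bk_prod_closed[OF assms(2)] show ?case
    by (simp add: bk_prod_def m_assoc)
qed

text \<open>The core of the Birkhoff-Kakutani argument, by induction on the number of factors. A
  factorization of weight below \<open>(1/2) ^ n\<close> is split into two parts of weight below
  half of this and one middle factor, whose own weight forces its index to be at least
  \<open>Suc n\<close>. All three products lie in \<open>V (Suc n)\<close>, and \<open>cube\<close>
  applies.\<close>

lemma bk_prod_in_V: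
  assumes "\<forall>p\<in>set L. snd p \<in> V (fst p)" "bk_weight L < (1/2) ^ n"
  shows "bk_prod G L \<in> V n"
  using assms
proof (induction "length L" arbitrary: L n rule: less_induct)
  case less
  show ?case
  proof (cases "L = []")
    case True
    then show ?thesis by (simp add: bk_prod_def one)
  next
    case False
    have nn: "0 \<le> (1/2::real) ^ fst p" for p :: "nat \<times> 'g"
      by simp
    have "(0::real) < (1/2) ^ Suc n" "sum_list (map (\<lambda>p. (1/2) ^ fst p) L) < 2 * (1/2::real) ^ Suc n"
      using less.prems(2) by (simp_all add: bk_weight_def)
    then obtain as m bs where L: "L = as @ m # bs" and w: "bk_weight as < (1/2) ^ Suc n" "bk_weight bs < (1/2) ^ Suc n"
      using sum_list_split[of "\<lambda>p. (1/2) ^ fst p" "(1/2) ^ Suc n" L, OF nn _ _ False] unfolding bk_weight_def by blast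
    have mem: "\<forall>p\<in>set as. snd p \<in> V (fst p)" "\<forall>p\<in>set bs. snd p \<in> V (fst p)" "snd m \<in> V (fst m)"
      using less.prems(1) by (simp_all add: L)
    have ab: "bk_prod G as \<in> V (Suc n)" "bk_prod G bs \<in> V (Suc n)"
      using less.hyps[of as "Suc n", OF _ mem(1) w(1)] less.hyps[of bs "Suc n", OF _ mem(2) w(2)] by (simp_all add: L)
    have "(1/2) ^ fst m \<le> bk_weight L"
      using bk_weight_nonneg[of as] bk_weight_nonneg[of bs] by (simp add: L bk_weight_def)
    then have lt: "(1/2::real) ^ fst m < (1/2) ^ n"
      using less.prems(2) by (rule le_less_trans)
    have "Suc n \<le> fst m"
    proof (rule ccontr)
      assume "\<not> Suc n \<le> fst m"
      then have "(1/2::real) ^ n \<le> (1/2) ^ fst m"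
        by (intro power_decreasing) simp_all
      then show False
        using lt by linarith
    qed
    then have m: "snd m \<in> V (Suc n)"
      using V_decseq mem(3) by blast
    have "bk_prod G L = bk_prod G as \<otimes> bk_prod G (m # bs)"
      unfolding L by (rule bk_prod_append) (use mem in auto)
    also have "\<dots> = bk_prod G as \<otimes> snd m \<otimes> bk_prod G bs"
      using ab m sub by (simp add: bk_prod_def m_assoc subset_iff)
    finally show ?thesis
      using cube[OF ab(1) m ab(2)] by simp
  qed
qed

lemma bk_norm_bdd: "bdd_below (insert 1 {bk_weight L | L. (\<forall>p\<in>set L. snd p \<in> V (fst p)) \<and> bk_prod G L = x})"
  by (rule bdd_belowI[of _ 0]) (use bk_weight_nonneg in auto)

lemma bk_norm_le_weight:
  assumes "\<forall>p\<in>set L. snd p \<in> V (fst p)"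
  shows "bk_norm G V (bk_prod G L) \<le> bk_weight L"
  unfolding bk_norm_def by (rule cInf_lower[OF _ bk_norm_bdd]) (use assms in blast)

lemma bk_norm_le_1: "bk_norm G V x \<le> 1"
  unfolding bk_norm_def by (rule cInf_lower[OF _ bk_norm_bdd]) blast

lemma bk_norm_one: "bk_norm G V \<one> = 0"
proof (rule antisym)
  show "bk_norm G V \<one> \<le> 0"
    using bk_norm_le_weight[of "[]"] by (simp add: bk_prod_def bk_weight_def)
  show "0 \<le> bk_norm G V \<one>"
    unfolding bk_norm_def by (rule cInf_greatest) (use bk_weight_nonneg in auto)
qed

lemma bk_norm_eq_1:
  assumes "x \<notin> V 0"
  shows "bk_norm G V x = 1"
proof (rule antisym[OF bk_norm_le_1])
  have "1 \<le> bk_weight L" if "\<forall>p\<in>set L. snd p \<in> V (fst p)" "bk_prod G L = x" for L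
    using bk_prod_in_V[OF that(1), of 0] that(2) assms by force
  then show "1 \<le> bk_norm G V x"
    unfolding bk_norm_def by (intro cInf_greatest) auto
qed

text \<open>Any factorization of \<open>x\<close> is extended by the single factor \<open>v\<close>
  of weight \<open>(1/2) ^ n\<close>; if the infimum is the truncation value 1, the bound is
  trivial.\<close>

lemma bk_norm_mult_le:
  assumes v: "v \<in> V n"
  shows "bk_norm G V (x \<otimes> v) \<le> bk_norm G V x + (1/2) ^ n"
proof -
  have "bk_norm G V (x \<otimes> v) - (1/2) ^ n \<le> bk_norm G V x"
    unfolding bk_norm_def[of G V x]
  proof (rule cInf_greatest)
    fix s assume "s \<in> insert 1 {bk_weight L | L. (\<forall>p\<in>set L. snd p \<in> V (fst p)) \<and> bk_prod G L = x}"
    then consider "s = 1" | L where "s = bk_weight L" "\<forall>p\<in>set L. snd p \<in> V (fst p)" "bk_prod G L = x"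
      by blast
    then show "bk_norm G V (x \<otimes> v) - (1/2) ^ n \<le> s"
    proof cases
      case 1
      have "0 \<le> (1/2::real) ^ n" by simp
      then show ?thesis
        using bk_norm_le_1[of "x \<otimes> v"] 1 by linarith
    next
      case 2
      have nv: "\<forall>p\<in>set [(n, v)]. snd p \<in> V (fst p)"
        using v by simp
      have "v \<in> carrier G" using v sub by blast
      then have "bk_prod G (L @ [(n, v)]) = x \<otimes> v"
        using bk_prod_append[OF 2(2) nv] 2(3) by (simp add: bk_prod_def)
      moreover have "bk_weight (L @ [(n, v)]) = s + (1/2) ^ n"
        by (simp add: bk_weight_def 2(1))
      moreover have "\<forall>p\<in>set (L @ [(n, v)]). snd p \<in> V (fst p)"
        using 2(2) nv by auto
      ultimately show ?thesis
        using bk_norm_le_weight[of "L @ [(n, v)]"] by simp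
    qed
  qed blast
  then show ?thesis by simp
qed

end

text \<open>The separating function is the length of \<open>z\<close> translated by the inverse of
  \<open>a\<close>. It vanishes at \<open>a\<close>, equals 1 on \<open>S\<close> because the
  translate of \<open>S\<close> avoids \<open>V 0\<close>, and varies by at most
  \<open>(1/2) ^ n\<close> between points that differ by a right factor in
  \<open>V n\<close>.\<close>

lemma completely_regular_topological_group:
  fixes G :: "'g monoid"
  assumes G: "topological_group G T"
  shows "completely_regular_space T"
  unfolding completely_regular_space_alt
proof (intro allI impI)
  interpret group G using G by (simp add: topological_group_def)
  have T: "topspace T = carrier G" using G by (simp add: topological_group_def)
  fix S a assume S: "closedin T S" and a: "a \<in> topspace T - S"
  then have aG: "a \<in> carrier G" by (simp add: T)
  have lmult: "continuous_map T T (\<lambda>x. b \<otimes>\<^bsub>G\<^esub> x)" if "b \<in> carrier G" for b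
    using that by (intro continuous_map_topological_group_mult[OF G]) (simp_all add: T)
  define U where "U = {x \<in> topspace T. a \<otimes>\<^bsub>G\<^esub> x \<in> topspace T - S}"
  have "openin T (topspace T - S)"
    using S by (simp add: closedin_def)
  then have "openin T U"
    unfolding U_def by (rule openin_continuous_map_preimage[OF lmult[OF aG]])
  moreover have "\<one>\<^bsub>G\<^esub> \<in> U"
    using a aG by (simp add: U_def T)
  ultimately have U: "openin T U" "\<one>\<^bsub>G\<^esub> \<in> U" .
  \<comment> \<open>Symmetry of the neighbourhoods allows exchanging \<open>y\<close> and
    \<open>z\<close> in \<open>step\<close>, which bounds the difference of the values from both
    sides.\<close>
  define P where "P W \<longleftrightarrow> openin T W \<and> \<one>\<^bsub>G\<^esub> \<in> W \<and> W \<subseteq> U \<and> (\<forall>x\<in>W. inv\<^bsub>G\<^esub> x \<in> W)" for W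
  have next_nbhd: "\<exists>V. P V \<and> (\<forall>x\<in>V. \<forall>y\<in>V. \<forall>z\<in>V. x \<otimes>\<^bsub>G\<^esub> y \<otimes>\<^bsub>G\<^esub> z \<in> W)"
    if W: "openin T W" "\<one>\<^bsub>G\<^esub> \<in> W" "W \<subseteq> U" for W
  proof -
    obtain V where V: "openin T V" "\<one>\<^bsub>G\<^esub> \<in> V" "\<And>x. x \<in> V \<Longrightarrow> inv\<^bsub>G\<^esub> x \<in> V"
      "\<And>x y z. x \<in> V \<Longrightarrow> y \<in> V \<Longrightarrow> z \<in> V \<Longrightarrow> x \<otimes>\<^bsub>G\<^esub> y \<otimes>\<^bsub>G\<^esub> z \<in> W"
      by (rule topological_group_nbhd_cube[OF G W(1,2)]) blast
    have VW: "V \<subseteq> W"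
    proof
      fix x assume x: "x \<in> V"
      then have "x \<in> carrier G"
        using openin_subset[OF V(1)] T by blast
      then show "x \<in> W"
        using V(4)[OF x V(2) V(2)] by simp
    qed
    have "P V"
      unfolding P_def by (intro conjI ballI V(1-3) subset_trans[OF VW W(3)])
    then show ?thesis
      by (intro exI[of _ V] conjI ballI V(4))
  qed
  have "\<exists>V. \<forall>n. P (V n) \<and> (\<forall>x\<in>V (Suc n). \<forall>y\<in>V (Suc n). \<forall>z\<in>V (Suc n). x \<otimes>\<^bsub>G\<^esub> y \<otimes>\<^bsub>G\<^esub> z \<in> V n)"
  proof (rule dependent_nat_choice)
    show "\<exists>V. P V"
      using next_nbhd[OF U order_refl] by blast
    show "\<exists>V'. P V' \<and> (\<forall>x\<in>V'. \<forall>y\<in>V'. \<forall>z\<in>V'. x \<otimes>\<^bsub>G\<^esub> y \<otimes>\<^bsub>G\<^esub> z \<in> V)" if "P V" for V and n :: nat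
      by (rule next_nbhd) (use that in \<open>simp_all add: P_def\<close>)
  qed
  then obtain V where V: "\<forall>n. P (V n) \<and>
      (\<forall>x\<in>V (Suc n). \<forall>y\<in>V (Suc n). \<forall>z\<in>V (Suc n). x \<otimes>\<^bsub>G\<^esub> y \<otimes>\<^bsub>G\<^esub> z \<in> V n)"
    by (rule exE)
  have Vo: "openin T (V n)" "\<one>\<^bsub>G\<^esub> \<in> V n" "V n \<subseteq> U" "\<And>x. x \<in> V n \<Longrightarrow> inv\<^bsub>G\<^esub> x \<in> V n" for n
    using V[THEN spec, THEN conjunct1, of n] unfolding P_def by blast+
  interpret bk: bk_nbhds G V
  proof
    show "V n \<subseteq> carrier G" for n
      using openin_subset[OF Vo(1)] T by simp
    show "\<one>\<^bsub>G\<^esub> \<in> V n" for n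
      by (rule Vo(2))
    show "x \<otimes>\<^bsub>G\<^esub> y \<otimes>\<^bsub>G\<^esub> z \<in> V n" if "x \<in> V (Suc n)" "y \<in> V (Suc n)" "z \<in> V (Suc n)" for x y z n
      using V[THEN spec, THEN conjunct2, of n] that by blast
  qed
  define f where "f z = bk_norm G V (inv\<^bsub>G\<^esub> a \<otimes>\<^bsub>G\<^esub> z)" for z
  have step: "f z \<le> f y + (1/2) ^ n" if "y \<in> carrier G" "z \<in> carrier G" "inv\<^bsub>G\<^esub> y \<otimes>\<^bsub>G\<^esub> z \<in> V n" for y z n
  proof -
    have "y \<otimes>\<^bsub>G\<^esub> (inv\<^bsub>G\<^esub> y \<otimes>\<^bsub>G\<^esub> z) = z"
      using that(1,2) by (simp add: m_assoc[symmetric])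
    then have "inv\<^bsub>G\<^esub> a \<otimes>\<^bsub>G\<^esub> y \<otimes>\<^bsub>G\<^esub> (inv\<^bsub>G\<^esub> y \<otimes>\<^bsub>G\<^esub> z) = inv\<^bsub>G\<^esub> a \<otimes>\<^bsub>G\<^esub> z"
      using that(1,2) aG by (simp add: m_assoc)
    then show ?thesis
      using bk.bk_norm_mult_le[OF that(3), of "inv\<^bsub>G\<^esub> a \<otimes>\<^bsub>G\<^esub> y"] by (simp add: f_def)
  qed
  have "continuous_map T euclideanreal f"
    unfolding continuous_map_def
  proof (intro conjI allI impI)
    fix W :: "real set" assume "openin euclideanreal W"
    then have W: "open W" by simp
    show "openin T {z \<in> topspace T. f z \<in> W}"
    proof (subst openin_subopen, rule ballI)
      fix y assume "y \<in> {z \<in> topspace T. f z \<in> W}"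
      then have y: "y \<in> carrier G" "f y \<in> W" by (simp_all add: T)
      obtain e where e: "e > 0" "\<And>r. dist r (f y) < e \<Longrightarrow> r \<in> W"
        using W y(2) unfolding open_dist by blast
      obtain n where n: "(1/2::real) ^ n < e"
        using real_arch_pow_inv[OF e(1), of "1/2"] by auto
      define N where "N = {z \<in> topspace T. inv\<^bsub>G\<^esub> y \<otimes>\<^bsub>G\<^esub> z \<in> V n}"
      have "openin T N"
        unfolding N_def using y by (intro openin_continuous_map_preimage[OF lmult] Vo(1)) simp
      moreover have "y \<in> N"
        using y Vo(2) by (simp add: N_def T)
      moreover have "z \<in> {z \<in> topspace T. f z \<in> W}" if "z \<in> N" for z
      proof -
        have z: "z \<in> carrier G" "inv\<^bsub>G\<^esub> y \<otimes>\<^bsub>G\<^esub> z \<in> V n"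
          using that by (simp_all add: N_def T)
        have "inv\<^bsub>G\<^esub> z \<otimes>\<^bsub>G\<^esub> y \<in> V n"
          using Vo(4)[OF z(2)] y(1) z(1) by (simp add: inv_mult_group)
        then have "\<bar>f z - f y\<bar> \<le> (1/2) ^ n"
          using step[OF y(1) z] step[OF z(1) y(1), of n] by (simp add: abs_le_iff)
        then have "f z \<in> W"
          using n by (intro e(2)) (simp add: dist_real_def)
        then show ?thesis
          using z(1) T by simp
      qed
      ultimately show "\<exists>N. openin T N \<and> y \<in> N \<and> N \<subseteq> {z \<in> topspace T. f z \<in> W}"
        by blast
    qed
  qed simp
  moreover have "f a = 0"
    using aG bk.bk_norm_one by (simp add: f_def)
  moreover have "f ` S \<subseteq> {1}"
  proof (rule image_subsetI)
    fix s assume s: "s \<in> S"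
    then have sG: "s \<in> carrier G"
      using closedin_subset[OF S] T by blast
    have "inv\<^bsub>G\<^esub> a \<otimes>\<^bsub>G\<^esub> s \<notin> U"
      using s sG aG by (simp add: U_def m_assoc[symmetric])
    then have "inv\<^bsub>G\<^esub> a \<otimes>\<^bsub>G\<^esub> s \<notin> V 0"
      using Vo(3) by blast
    then show "f s \<in> {1}"
      unfolding f_def by (simp add: bk.bk_norm_eq_1)
  qed
  ultimately show "\<exists>f. continuous_map T euclideanreal f \<and> f a = 0 \<and> f ` S \<subseteq> {1}"
    by blast
qed

text \<open>For \<open>n = 1\<close> the quotient property makes the generators from
  \<open>S\<close> a closed set among words of length at most 1. Such a set is the trace of a closed
  set \<open>K\<close> of the free topological group, and the generator \<open>y\<close> lies
  outside \<open>K\<close>. A function separating them in this group is pulled back along the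
  generators.\<close>

lemma completely_regular_if_quotient_map_reduction:
  assumes q: "quotient_map (unreduced_words_upto 1 Y) (free_markov_upto 1 Y) reduction_map"
  shows "completely_regular_space Y"
  unfolding completely_regular_space_alt
proof (intro allI impI)
  fix S y assume S: "closedin Y S" and y: "y \<in> topspace Y - S"
  have gen: "free_gen x \<in> words_upto 1 Y" if "x \<in> topspace Y" for x
    using that by (simp add: words_upto_def free_group_def)
  have "closedin (free_markov_upto 1 Y) (free_gen ` S)"
  proof (rule closedin_free_markov_uptoI[OF q])
    show "free_gen ` S \<subseteq> words_upto 1 Y"
      using gen closedin_subset[OF S] by blast
    fix i :: nat assume "i \<le> 1"
    then consider "i = 0" | "i = 1" by linarith
    then show "closedin (letters Y i) {x \<in> topspace (letters Y i). reduce (map x [0..<i]) \<in> free_gen ` S}"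
    proof cases
      case 1
      have "reduce (map x [0..<i]) \<notin> free_gen ` S" for x
        by (auto simp: 1 reduce_def)
      then have "{x \<in> topspace (letters Y i). reduce (map x [0..<i]) \<in> free_gen ` S} = {}"
        by blast
      then show ?thesis
        by (simp only: closedin_empty)
    next
      case 2
      have c: "closedin (letter_space Y) ({True} \<times> S)"
      proof -
        have "{x. (b, x) \<in> UNIV \<times> topspace Y - {True} \<times> S} = (if b then topspace Y - S else topspace Y)" for b
          by auto
        then have "openin (letter_space Y) (UNIV \<times> topspace Y - {True} \<times> S)"
          using S unfolding openin_letter_space closedin_def by simp
        then show ?thesis
          using closedin_subset[OF S] by (auto simp: closedin_def)
      qed
      have "closedin (letters Y 1) {x \<in> topspace (letters Y 1). x 0 \<in> {True} \<times> S}"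
        by (rule closedin_continuous_map_preimage[OF
              continuous_map_product_projection[of 0 "{..<1}" "\<lambda>_. letter_space Y"] c]) simp
      moreover have "reduce (map x [0..<1]) \<in> free_gen ` S \<longleftrightarrow> x 0 \<in> {True} \<times> S" for x :: "nat \<Rightarrow> bool \<times> 'a"
        by (cases "x 0") (auto simp: reduce_def)
      ultimately show ?thesis
        unfolding 2 by (simp only:)
    qed
  qed
  then obtain K where K: "closedin (free_markov Y) K" "free_gen ` S = K \<inter> words_upto 1 Y"
    unfolding free_markov_upto_def closedin_subtopology by blast
  have "free_gen y \<notin> free_gen ` S"
    using y by auto
  then have "free_gen y \<in> topspace (free_markov Y) - K"
    using gen[of y] y K(2) unfolding topspace_free_markov words_upto_def by blast
  then obtain f where f: "continuous_map (free_markov Y) euclideanreal f" "f (free_gen y) = 0" "f ` K \<subseteq> {1}"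
    using completely_regular_topological_group[OF topological_group_free_markov[of Y]] K(1)
    unfolding completely_regular_space_alt by blast
  have "free_gen ` S \<subseteq> K"
    using K(2) by blast
  then show "\<exists>f. continuous_map Y euclideanreal f \<and> f y = 0 \<and> f ` S \<subseteq> {1}"
    using continuous_map_compose[OF continuous_map_free_gen f(1)] f(2,3)
    by (intro exI[of _ "f \<circ> free_gen"]) auto
qed

theorem theorem3p20:
  fixes X :: "'a topology"
  assumes "Hausdorff_space X"
  shows "(topological_group (fundamental_group (suspension_plus X) (suspension_base X))
            (pi1_top (suspension_plus X) (suspension_base X)) \<and>
          Hausdorff_space (pi1_top (suspension_plus X) (suspension_base X))
          \<longleftrightarrow>
          Hausdorff_space (pi0_top X) \<and>
          (\<forall>n\<ge>1. quotient_map (product_topology (\<lambda>_. X) {..<n})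
                    (product_topology (\<lambda>_. pi0_top X) {..<n})
                    (power_map n (path_component_of_set X))) \<and>
          (\<forall>n\<ge>1. quotient_map (unreduced_words_upto n (pi0_top X))
                    (free_markov_upto n (pi0_top X)) reduction_map) \<and>
          has_inductive_limit_topology (pi0_top X))
       \<and> (Hausdorff_space (pi0_top X) \<and> \<not> completely_regular_space (pi0_top X) \<longrightarrow>
          \<not> ((\<forall>n\<ge>1. quotient_map (product_topology (\<lambda>_. X) {..<n})
                        (product_topology (\<lambda>_. pi0_top X) {..<n})
                        (power_map n (path_component_of_set X))) \<and>
             (\<forall>n\<ge>1. quotient_map (unreduced_words_upto n (pi0_top X))
                        (free_markov_upto n (pi0_top X)) reduction_map) \<and>
             has_inductive_limit_topology (pi0_top X)))"
  unfolding pi1_top_suspension_iff word_quotient_Hausdorff_group_iff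
  using completely_regular_if_quotient_map_reduction[of "pi0_top X"] by blast

end
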